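(* Let $\Psi_T\in L^2(\Omega)$, $\beta\ge0$ and $$\mathcal G_\beta(f)=\tfrac12\Big\|\int_0^T\theta(\cdot,t;f)\,dt-\Psi_T\Big\|^2+\tfrac\beta2\|f\|^2,\qquad f\in L^2(\Omega).$$ Let $\mathcal H\subseteq L^2(\Omega)$ be a real Hilbert space (continuously embedded in $L^2(\Omega)$). The Gâteaux directional derivative of $\mathcal G_\beta$ at $f\in L^2(\Omega)$ in the direction of the perturbation $\delta_f\in\mathcal H$ is given by $$\mathcal G'_\beta(f;\delta_f)=\int_\Omega\Big(\int_0^T\delta\theta(\mathbf x,t;f,\delta_f)\,dt\Big)\Big(\int_0^T\theta(\mathbf x,t;f)\,dt-\Psi_T(\mathbf x)\Big)d\mathbf x+\beta\int_\Omega f\,\delta_f\,d\mathbf x.$$ The mapping $\mathcal G'_\beta(f;\cdot)\colon\mathcal H\to\mathbb R$ is a bounded linear functional. Denoting by $\nabla_{\mathcal H}\mathcal G_\beta[f]$ the unique element of $\mathcal H$ such that $\mathcal G'_\beta(f;\delta_f)=\langle\nabla_{\mathcal H}\mathcal G_\beta[f],\delta_f\rangle_{\mathcal H}$ for all $\delta_f\in\mathcal H$, it holds that: (1) in case $\mathcal H=L^2(\Omega)$, $$\nabla\mathcal G_\beta[f]=\int_0^Tg(t)\,\theta^\ast(\cdot,t;f)\,dt+\beta f\in L^2(\Omega),$$ where $(\mathbf u^\ast,\theta^\ast)$ is the solution of the adjoint problem $$\begin{cases}\rho\,\partial_{tt}\mathbf u^\ast-\nabla\cdot\sigma(\mathbf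 u^\ast)+\gamma T_0\nabla\partial_t\theta^\ast=\mathbf 0&\text{in }Q_T,\\-\rho C_s\partial_t\theta^\ast-\kappa\Delta\theta^\ast-K^\ast(\Delta\theta^\ast)-\gamma\nabla\cdot\mathbf u^\ast=P_T(f)-\Psi_T&\text{in }Q_T,\\\mathbf u^\ast=\mathbf 0,\ \theta^\ast=0&\text{on }\Sigma_T,\\\mathbf u^\ast(\cdot,T)=\mathbf 0,\ \partial_t\mathbf u^\ast(\cdot,T)=\mathbf 0,\ \theta^\ast(\cdot,T)=0&\text{in }\Omega;\end{cases}$$ (2) in case $\mathcal H=H^1(\Omega)$ equipped with the inner product $\langle w,z\rangle_{H^1(\Omega,r_0,r_1)}=(r_0w,z)+(r_1\nabla w,\nabla z)$, the Sobolev gradient $\nabla_S\mathcal G_\beta\in H^1(\Omega)$ is the weak solution $\mathcal K$ of $$-\nabla\cdot(r_1\nabla\mathcal K)+r_0\mathcal K=\nabla\mathcal G_\beta\ \text{ in }\Omega,\qquad\nabla\mathcal K\cdot\mathbf n=0\ \text{ on }\Gamma,$$ with $\nabla\mathcal G_\beta=\nabla\mathcal G_\beta[f]$ the $L^2$-gradient of (1).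
   Context: Setting. $\Omega\subset\mathbb R^d$ ($d\in\mathbb N$) is open and bounded with Lipschitz boundary $\Gamma$ and outward unit normal $\mathbf n$; $T>0$; $Q_T=\Omega\times(0,T]$, $\Sigma_T=\Gamma\times(0,T]$. $\rho,C_s,\kappa,T_0,\lambda,\mu,\alpha_T$ are positive constants and $\gamma=\alpha_T(3\lambda+2\mu)>0$. $\epsilon(\mathbf u)=\frac12(\nabla\mathbf u+(\nabla\mathbf u)^\top)$, $\sigma(\mathbf u)=2\mu\,\epsilon(\mathbf u)+\lambda\,\mathrm{Tr}(\epsilon(\mathbf u))\,\mathrm{Id}$. The kernel $k\in C^2([0,T])$ is strongly positive definite (in the standard sense for convolution kernels) and satisfies $\lim_{t\to\infty}k(t)=0$, $(-1)^jk^{(j)}(t)\ge 0$ for $j=0,1,2$ and $t\in[0,T]$, $k'\not\equiv0$. $(k\ast z)(\mathbf x,t)=\int_0^tk(t-s)z(\mathbf x,s)\,ds$ and $K^\ast(z)(s)=\int_s^Tk(t-s)z(t)\,dt$, $s\in[0,T]$. $(\cdot,\cdot)$ and $\|\cdot\|$ denote the inner product and norm of $L^2(\Omega)$, $L^2(\Omega)^d$ and $L^2(\Omega)^{d\times d}$. The weights $r_0,r_1\colon\Omega\to\mathbb R$ are continuous with $0<\underline r_0\le r_0\le\overline r_0$, $0<\underline r_1\le r_1\le\overline r_1$ for constants. Function $g$: $g\in C^1([0,T])$ with $0\notin g([0,T])$ and $\partial_t(g(t)^2)\ge0$ for all $t\in[0,T]$. Problem $(P_1)$ with source $f\in L^2(\Omega)$: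 $\rho\,\partial_{tt}\mathbf u-\nabla\cdot\sigma(\mathbf u)+\gamma\nabla\theta=\mathbf 0$ in $Q_T$; $\rho C_s\partial_t\theta-\kappa\Delta\theta-k\ast\Delta\theta+T_0\gamma\nabla\cdot\partial_t\mathbf u=g(t)f(\mathbf x)$ in $Q_T$; $\mathbf u=\mathbf 0$, $\theta=0$ on $\Sigma_T$; $\mathbf u(\cdot,0)=\mathbf 0$, $\partial_t\mathbf u(\cdot,0)=\mathbf 0$, $\theta(\cdot,0)=0$ in $\Omega$. Solutions are weak: $(\mathbf u(t),\theta(t))\in H_0^1(\Omega)^d\times H_0^1(\Omega)$, and for a.e. $t$ and all $\boldsymbol\varphi\in H^1_0(\Omega)^d$, $\psi\in H^1_0(\Omega)$: $\rho(\partial_{tt}\mathbf u,\boldsymbol\varphi)+\mu(\nabla\mathbf u,\nabla\boldsymbol\varphi)+(\lambda+\mu)(\nabla\cdot\mathbf u,\nabla\cdot\boldsymbol\varphi)+\gamma(\nabla\theta,\boldsymbol\varphi)=0$ and $\rho C_s(\partial_t\theta,\psi)+\kappa(\nabla\theta,\nabla\psi)+(k\ast\nabla\theta,\nabla\psi)-T_0\gamma(\partial_t\mathbf u,\nabla\psi)=(g(t)f,\psi)$. There is a unique weak solution $(\mathbf u(\cdot,\cdot;f),\theta(\cdot,\cdot;f))$ (known), with $\mathbf u\in C([0,T],H_0^1(\Omega)^d)$, $\partial_t\mathbf u\in C([0,T],L^2(\Omega)^d)\cap L^2((0,T),H_0^1(\Omega)^d)$, $\partial_{tt}\mathbf u\in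 L^2((0,T),L^2(\Omega)^d)$, $\theta\in C([0,T],H_0^1(\Omega))$, $\partial_t\theta\in L^2((0,T),H^1_0(\Omega))$. Measurement operator: $P_T\colon L^2(\Omega)\to L^2(\Omega)$, $P_T(f)=\int_0^T\theta(\cdot,t;f)\,dt$. Variations: $\delta\theta(\cdot;f,\delta_f)=\lim_{\varepsilon\to0}\frac1\varepsilon(\theta(\cdot;f+\varepsilon\delta_f)-\theta(\cdot;f))$, and $\delta\mathbf u$ likewise; the pair $(\delta\mathbf u,\delta\theta)$ solves $(P_1)$ with source $\delta_f$ (sensitivity problem). The adjoint problem is a terminal-value problem, understood in the analogous weak sense and regarded as well posed. The Gâteaux derivative is $\mathcal G'_\beta(f;\delta_f)=\lim_{\varepsilon\to0}\varepsilon^{-1}(\mathcal G_\beta(f+\varepsilon\delta_f)-\mathcal G_\beta(f))$. A weak solution of the elliptic problem in (2) is $\mathcal K\in H^1(\Omega)$ with $(r_1\nabla\mathcal K,\nabla\varphi)+(r_0\mathcal K,\varphi)=(\nabla\mathcal G_\beta,\varphi)$ for all $\varphi\in H^1(\Omega)$. *)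

theory Defs
  imports "HOL-Analysis.Analysis"
begin

section \<open>Domains\<close>

text \<open>Locally, and up to a rigid motion (encoded by the inward direction \<open>\<nu>\<close>), the set is the
  strict epigraph of a Lipschitz function on the hyperplane orthogonal to \<open>\<nu>\<close>.\<close>

definition lipschitz_boundary :: "(real^'n) set \<Rightarrow> bool" where
  "lipschitz_boundary Om \<longleftrightarrow>
     (\<forall>p\<in>frontier Om. \<exists>r>0. \<exists>\<nu> h L. norm \<nu> = 1 \<and> L-lipschitz_on UNIV h \<and>
        (\<forall>x\<in>ball p r. x \<in> Om \<longleftrightarrow> h (x - (\<nu> \<bullet> x) *\<^sub>R \<nu>) < \<nu> \<bullet> x))"

section \<open>Test functions\<close>

definition pd :: "'a::euclidean_space \<Rightarrow> ('a \<Rightarrow> real) \<Rightarrow> 'a \<Rightarrow> real" where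
  "pd b \<phi> x = frechet_derivative \<phi> (at x) b"

primrec Ck :: "nat \<Rightarrow> ('a::euclidean_space \<Rightarrow> real) \<Rightarrow> bool" where
  "Ck 0 \<phi> \<longleftrightarrow> continuous_on UNIV \<phi>"
| "Ck (Suc n) \<phi> \<longleftrightarrow> (\<forall>x. \<phi> differentiable (at x)) \<and> (\<forall>b\<in>Basis. Ck n (pd b \<phi>))"

definition test_fun :: "'a::euclidean_space set \<Rightarrow> ('a \<Rightarrow> real) set" where
  "test_fun S = {\<phi>. (\<forall>n. Ck n \<phi>) \<and> compact (closure {x. \<phi> x \<noteq> 0}) \<and> closure {x. \<phi> x \<noteq> 0} \<subseteq> S}"

section \<open>Lebesgue and Sobolev spaces\<close>

text \<open>Elements of all function spaces are represented by functions; equality in the space is equality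
  almost everywhere with respect to \<open>lebesgue_on Om\<close>, and values outside \<open>Om\<close> are irrelevant.\<close>

definition L2 :: "(real^'n) set \<Rightarrow> (real^'n \<Rightarrow> 'b::euclidean_space) set" where
  "L2 Om = {w. w \<in> borel_measurable (lebesgue_on Om) \<and>
               integrable (lebesgue_on Om) (\<lambda>x. (norm (w x))\<^sup>2)}"

definition L2ip :: "(real^'n) set \<Rightarrow> (real^'n \<Rightarrow> 'b::euclidean_space) \<Rightarrow> (real^'n \<Rightarrow> 'b) \<Rightarrow> real" where
  "L2ip Om v w = (LINT x|lebesgue_on Om. v x \<bullet> w x)"

definition L2norm :: "(real^'n) set \<Rightarrow> (real^'n \<Rightarrow> 'b::euclidean_space) \<Rightarrow> real" where
  "L2norm Om w = sqrt (L2ip Om w w)"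

definition is_weak_grad :: "(real^'n) set \<Rightarrow> (real^'n \<Rightarrow> real) \<Rightarrow> (real^'n \<Rightarrow> real^'n) \<Rightarrow> bool" where
  "is_weak_grad Om w v \<longleftrightarrow> v \<in> L2 Om \<and>
     (\<forall>\<phi>\<in>test_fun Om. \<forall>i. (LINT x|lebesgue_on Om. w x * pd (axis i 1) \<phi> x) =
                         - (LINT x|lebesgue_on Om. v x $ i * \<phi> x))"

definition H1 :: "(real^'n) set \<Rightarrow> (real^'n \<Rightarrow> real) set" where
  "H1 Om = {w \<in> L2 Om. \<exists>v. is_weak_grad Om w v}"

text \<open>The weak gradient is unique up to null sets only; \<open>wgrad\<close> chooses a representative.\<close>

definition wgrad :: "(real^'n) set \<Rightarrow> (real^'n \<Rightarrow> real) \<Rightarrow> real^'n \<Rightarrow> real^'n" where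
  "wgrad Om w = (SOME v. is_weak_grad Om w v)"

definition H1norm :: "(real^'n) set \<Rightarrow> (real^'n \<Rightarrow> real) \<Rightarrow> real" where
  "H1norm Om w = sqrt ((L2norm Om w)\<^sup>2 + (L2norm Om (wgrad Om w))\<^sup>2)"

definition H01 :: "(real^'n) set \<Rightarrow> (real^'n \<Rightarrow> real) set" where
  "H01 Om = {w \<in> H1 Om. \<exists>\<phi>::nat \<Rightarrow> real^'n \<Rightarrow> real.
               (\<forall>n. \<phi> n \<in> test_fun Om) \<and> (\<lambda>n. H1norm Om (\<lambda>x. \<phi> n x - w x)) \<longlonglongrightarrow> 0}"

definition H01v :: "(real^'n) set \<Rightarrow> (real^'n \<Rightarrow> real^'n) set" where
  "H01v Om = {w. \<forall>i. (\<lambda>x. w x $ i) \<in> H01 Om}"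

definition H1normv :: "(real^'n) set \<Rightarrow> (real^'n \<Rightarrow> real^'n) \<Rightarrow> real" where
  "H1normv Om w = sqrt (\<Sum>i\<in>UNIV. (H1norm Om (\<lambda>x. w x $ i))\<^sup>2)"

definition wjac :: "(real^'n) set \<Rightarrow> (real^'n \<Rightarrow> real^'n) \<Rightarrow> real^'n \<Rightarrow> real^'n^'n" where
  "wjac Om w x = (\<chi> i. wgrad Om (\<lambda>y. w y $ i) x)"

definition wdiv :: "(real^'n) set \<Rightarrow> (real^'n \<Rightarrow> real^'n) \<Rightarrow> real^'n \<Rightarrow> real" where
  "wdiv Om w x = (\<Sum>i\<in>UNIV. wgrad Om (\<lambda>y. w y $ i) x $ i)"

section \<open>Time-dependent functions\<close>

text \<open>A function on \<open>Om \<times> [0,T]\<close> is written \<open>z t x\<close>. Joint measurability is always required, so that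
  the time integrals below may be taken pointwise in \<open>x\<close>; they then agree with the Bochner integrals.\<close>

definition jmeas :: "real \<Rightarrow> (real^'n) set \<Rightarrow> (real \<Rightarrow> real^'n \<Rightarrow> 'b::euclidean_space) \<Rightarrow> bool" where
  "jmeas T Om z \<longleftrightarrow>
     (\<lambda>(t, x). z t x) \<in> borel_measurable (lebesgue_on {0..T} \<Otimes>\<^sub>M lebesgue_on Om)"

definition grad_field ::
  "real \<Rightarrow> (real^'n) set \<Rightarrow> (real \<Rightarrow> real^'n \<Rightarrow> real) \<Rightarrow> (real \<Rightarrow> real^'n \<Rightarrow> real^'n) \<Rightarrow> bool" where
  "grad_field T Om z q \<longleftrightarrow>
     jmeas T Om q \<and> (AE t in lebesgue_on {0..T}. is_weak_grad Om (z t) (q t))"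

definition C_L2 :: "real \<Rightarrow> (real^'n) set \<Rightarrow> (real \<Rightarrow> real^'n \<Rightarrow> 'b::euclidean_space) \<Rightarrow> bool" where
  "C_L2 T Om z \<longleftrightarrow> jmeas T Om z \<and> (\<forall>t\<in>{0..T}. z t \<in> L2 Om) \<and>
     (\<forall>t\<in>{0..T}. ((\<lambda>s. L2norm Om (\<lambda>x. z s x - z t x)) \<longlongrightarrow> 0) (at t within {0..T}))"

definition C_H01 :: "real \<Rightarrow> (real^'n) set \<Rightarrow> (real \<Rightarrow> real^'n \<Rightarrow> real) \<Rightarrow> bool" where
  "C_H01 T Om z \<longleftrightarrow> jmeas T Om z \<and> (\<forall>t\<in>{0..T}. z t \<in> H01 Om) \<and>
     (\<forall>t\<in>{0..T}. ((\<lambda>s. H1norm Om (\<lambda>x. z s x - z t x)) \<longlongrightarrow> 0) (at t within {0..T}))"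

definition C_H01v :: "real \<Rightarrow> (real^'n) set \<Rightarrow> (real \<Rightarrow> real^'n \<Rightarrow> real^'n) \<Rightarrow> bool" where
  "C_H01v T Om z \<longleftrightarrow> (\<forall>i. C_H01 T Om (\<lambda>t x. z t x $ i))"

definition L2_L2 :: "real \<Rightarrow> (real^'n) set \<Rightarrow> (real \<Rightarrow> real^'n \<Rightarrow> 'b::euclidean_space) \<Rightarrow> bool" where
  "L2_L2 T Om z \<longleftrightarrow> jmeas T Om z \<and> (AE t in lebesgue_on {0..T}. z t \<in> L2 Om) \<and>
     integrable (lebesgue_on {0..T}) (\<lambda>t. (L2norm Om (z t))\<^sup>2)"

text \<open>Joint measurability of \<open>z\<close> and of its gradient amounts to strong measurability into \<open>H\<^sup>1\<close>.\<close>

definition L2_H01 :: "real \<Rightarrow> (real^'n) set \<Rightarrow> (real \<Rightarrow> real^'n \<Rightarrow> real) \<Rightarrow> bool" where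
  "L2_H01 T Om z \<longleftrightarrow> jmeas T Om z \<and> (\<exists>q. grad_field T Om z q) \<and>
     (AE t in lebesgue_on {0..T}. z t \<in> H01 Om) \<and>
     integrable (lebesgue_on {0..T}) (\<lambda>t. (H1norm Om (z t))\<^sup>2)"

definition L2_H01v :: "real \<Rightarrow> (real^'n) set \<Rightarrow> (real \<Rightarrow> real^'n \<Rightarrow> real^'n) \<Rightarrow> bool" where
  "L2_H01v T Om z \<longleftrightarrow> (\<forall>i. L2_H01 T Om (\<lambda>t x. z t x $ i))"

text \<open>The space \<open>L\<^sup>2((0,T), H\<^sup>-\<^sup>1(Om)\<^sup>d)\<close>; \<open>F t \<phi>\<close> is the duality pairing of \<open>F t\<close> with \<open>\<phi>\<close>.\<close>

definition L2_Hdual :: "real \<Rightarrow> (real^'n) set \<Rightarrow> (real \<Rightarrow> (real^'n \<Rightarrow> real^'n) \<Rightarrow> real) \<Rightarrow> bool" where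
  "L2_Hdual T Om F \<longleftrightarrow>
     (\<forall>\<phi>\<in>H01v Om. (\<lambda>t. F t \<phi>) \<in> borel_measurable (lebesgue_on {0..T})) \<and>
     (AE t in lebesgue_on {0..T}. \<forall>\<phi>\<in>H01v Om. \<forall>\<xi>\<in>H01v Om. \<forall>a b.
        F t (\<lambda>x. a *\<^sub>R \<phi> x + b *\<^sub>R \<xi> x) = a * F t \<phi> + b * F t \<xi>) \<and>
     (\<exists>m. integrable (lebesgue_on {0..T}) (\<lambda>t. (m t)\<^sup>2) \<and>
        (AE t in lebesgue_on {0..T}. \<forall>\<phi>\<in>H01v Om. \<bar>F t \<phi>\<bar> \<le> m t * H1normv Om \<phi>))"

text \<open>Vector-valued distributional time derivatives on \<open>(0,T)\<close>, with values in \<open>L\<^sup>2\<close> and \<open>H\<^sup>-\<^sup>1\<close>.\<close>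

definition has_tderiv :: "real \<Rightarrow> (real^'n) set \<Rightarrow>
    (real \<Rightarrow> real^'n \<Rightarrow> 'b::euclidean_space) \<Rightarrow> (real \<Rightarrow> real^'n \<Rightarrow> 'b) \<Rightarrow> bool" where
  "has_tderiv T Om z v \<longleftrightarrow> (\<forall>\<eta>\<in>test_fun {0<..<T}. AE x in lebesgue_on Om.
     (LINT t|lebesgue_on {0..T}. pd 1 \<eta> t *\<^sub>R z t x) = - (LINT t|lebesgue_on {0..T}. \<eta> t *\<^sub>R v t x))"

definition has_tderiv_dual :: "real \<Rightarrow> (real^'n) set \<Rightarrow>
    (real \<Rightarrow> real^'n \<Rightarrow> real^'n) \<Rightarrow> (real \<Rightarrow> (real^'n \<Rightarrow> real^'n) \<Rightarrow> real) \<Rightarrow> bool" where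
  "has_tderiv_dual T Om z F \<longleftrightarrow> (\<forall>\<eta>\<in>test_fun {0<..<T}. \<forall>\<phi>\<in>H01v Om.
     (LINT t|lebesgue_on {0..T}. pd 1 \<eta> t * L2ip Om (z t) \<phi>) =
       - (LINT t|lebesgue_on {0..T}. \<eta> t * F t \<phi>))"

section \<open>The convolution kernel\<close>

definition conv :: "(real \<Rightarrow> real) \<Rightarrow> (real \<Rightarrow> real^'n \<Rightarrow> 'b::euclidean_space) \<Rightarrow> real \<Rightarrow> real^'n \<Rightarrow> 'b" where
  "conv k z t x = (LINT s|lebesgue_on {0..t}. k (t - s) *\<^sub>R z s x)"

definition conv_adj ::
  "real \<Rightarrow> (real \<Rightarrow> real) \<Rightarrow> (real \<Rightarrow> real^'n \<Rightarrow> 'b::euclidean_space) \<Rightarrow> real \<Rightarrow> real^'n \<Rightarrow> 'b" where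
  "conv_adj T k z s x = (LINT t|lebesgue_on {s..T}. k (t - s) *\<^sub>R z t x)"

definition positive_definite_kernel :: "real \<Rightarrow> (real \<Rightarrow> real) \<Rightarrow> bool" where
  "positive_definite_kernel T k \<longleftrightarrow> (\<forall>y::real \<Rightarrow> real. continuous_on {0..T} y \<longrightarrow> (\<forall>\<tau>\<in>{0..T}.
     0 \<le> (LINT t|lebesgue_on {0..\<tau>}. (LINT s|lebesgue_on {0..t}. k (t - s) * y s) * y t)))"

text \<open>The notion of Nohel and Shea, on the time horizon \<open>[0,T]\<close> on which the kernel acts.\<close>

definition strongly_positive_definite_kernel :: "real \<Rightarrow> (real \<Rightarrow> real) \<Rightarrow> bool" where
  "strongly_positive_definite_kernel T k \<longleftrightarrow>
     (\<exists>c>0. positive_definite_kernel T (\<lambda>t. k t - c * exp (- t)))"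

definition admissible_kernel :: "real \<Rightarrow> (real \<Rightarrow> real) \<Rightarrow> bool" where
  "admissible_kernel T k \<longleftrightarrow>
     strongly_positive_definite_kernel T k \<and> (k \<longlongrightarrow> 0) at_top \<and>
     (\<exists>k' k''.
        (\<forall>t\<in>{0..T}. (k has_real_derivative k' t) (at t within {0..T})) \<and>
        (\<forall>t\<in>{0..T}. (k' has_real_derivative k'' t) (at t within {0..T})) \<and>
        continuous_on {0..T} k'' \<and>
        (\<forall>t\<in>{0..T}. 0 \<le> k t \<and> k' t \<le> 0 \<and> 0 \<le> k'' t) \<and>
        (\<exists>t\<in>{0..T}. k' t \<noteq> 0))"

definition admissible_g :: "real \<Rightarrow> (real \<Rightarrow> real) \<Rightarrow> bool" where
  "admissible_g T g \<longleftrightarrow>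
     (\<exists>g'. (\<forall>t\<in>{0..T}. (g has_real_derivative g' t) (at t within {0..T})) \<and> continuous_on {0..T} g') \<and>
     0 \<notin> g ` {0..T} \<and>
     (\<forall>t\<in>{0..T}. \<exists>D\<ge>0. ((\<lambda>s. (g s)\<^sup>2) has_real_derivative D) (at t within {0..T}))"

section \<open>Forward and adjoint problems\<close>

definition elastic_form ::
  "(real^'n) set \<Rightarrow> real \<Rightarrow> real \<Rightarrow> (real^'n \<Rightarrow> real^'n) \<Rightarrow> (real^'n \<Rightarrow> real^'n) \<Rightarrow> real" where
  "elastic_form Om lam mu u \<phi> =
     mu * L2ip Om (wjac Om u) (wjac Om \<phi>) + (lam + mu) * L2ip Om (wdiv Om u) (wdiv Om \<phi>)"

text \<open>Weak solutions of problem \<open>(P\<^sub>1)\<close> with source \<open>g(t) f(x)\<close>. Here \<open>ut\<close>, \<open>utt\<close>, \<open>\<theta>t\<close> are the time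
  derivatives and \<open>q\<close> is a jointly measurable version of the gradient of \<open>\<theta>\<close>, needed in the
  convolution; the choice of \<open>q\<close> is immaterial.\<close>

definition forward_solution ::
  "real \<Rightarrow> (real^'n) set \<Rightarrow> real \<Rightarrow> real \<Rightarrow> real \<Rightarrow> real \<Rightarrow> real \<Rightarrow> real \<Rightarrow> real \<Rightarrow>
   (real \<Rightarrow> real) \<Rightarrow> (real \<Rightarrow> real) \<Rightarrow> (real^'n \<Rightarrow> real) \<Rightarrow>
   (real \<Rightarrow> real^'n \<Rightarrow> real^'n) \<Rightarrow> (real \<Rightarrow> real^'n \<Rightarrow> real) \<Rightarrow> bool" where
  "forward_solution T Om rho Cs kap T0 lam mu \<gamma> k g f u \<theta> \<longleftrightarrow>
     (\<exists>ut utt \<theta>t q.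
        C_H01v T Om u \<and> has_tderiv T Om u ut \<and>
        C_L2 T Om ut \<and> L2_H01v T Om ut \<and> has_tderiv T Om ut utt \<and> L2_L2 T Om utt \<and>
        C_H01 T Om \<theta> \<and> has_tderiv T Om \<theta> \<theta>t \<and> L2_H01 T Om \<theta>t \<and> grad_field T Om \<theta> q \<and>
        (AE t in lebesgue_on {0..T}. \<forall>\<phi>\<in>H01v Om. \<forall>\<psi>\<in>H01 Om.
           rho * L2ip Om (utt t) \<phi> + elastic_form Om lam mu (u t) \<phi>
             + \<gamma> * L2ip Om (wgrad Om (\<theta> t)) \<phi> = 0 \<and>
           rho * Cs * L2ip Om (\<theta>t t) \<psi> + kap * L2ip Om (wgrad Om (\<theta> t)) (wgrad Om \<psi>)
             + L2ip Om (conv k q t) (wgrad Om \<psi>) - T0 * \<gamma> * L2ip Om (ut t) (wgrad Om \<psi>)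
             = L2ip Om (\<lambda>x. g t * f x) \<psi>) \<and>
        (AE x in lebesgue_on Om. u 0 x = 0 \<and> ut 0 x = 0 \<and> \<theta> 0 x = 0))"

text \<open>Weak solutions of the terminal-value (adjoint) problem with source \<open>h(x)\<close>. In contrast to the
  forward problem, \<open>\<partial>\<^sub>t\<^sub>t u\<close> is only taken in \<open>L\<^sup>2((0,T), H\<^sup>-\<^sup>1)\<close>: since the first equation contains
  \<open>\<nabla>\<partial>\<^sub>t\<theta>\<close>, the problem with \<open>h \<in> L\<^sup>2\<close> does not in general have a solution with
  \<open>\<partial>\<^sub>t\<^sub>t u \<in> L\<^sup>2((0,T), L\<^sup>2)\<close> or \<open>\<partial>\<^sub>t u \<in> L\<^sup>2((0,T), H\<^sup>1\<^sub>0)\<close>.\<close>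

definition adjoint_solution ::
  "real \<Rightarrow> (real^'n) set \<Rightarrow> real \<Rightarrow> real \<Rightarrow> real \<Rightarrow> real \<Rightarrow> real \<Rightarrow> real \<Rightarrow> real \<Rightarrow>
   (real \<Rightarrow> real) \<Rightarrow> (real^'n \<Rightarrow> real) \<Rightarrow>
   (real \<Rightarrow> real^'n \<Rightarrow> real^'n) \<Rightarrow> (real \<Rightarrow> real^'n \<Rightarrow> real) \<Rightarrow> bool" where
  "adjoint_solution T Om rho Cs kap T0 lam mu \<gamma> k h u \<theta> \<longleftrightarrow>
     (\<exists>ut utt \<theta>t q.
        C_H01v T Om u \<and> has_tderiv T Om u ut \<and>
        C_L2 T Om ut \<and> has_tderiv_dual T Om ut utt \<and> L2_Hdual T Om utt \<and>
        C_H01 T Om \<theta> \<and> has_tderiv T Om \<theta> \<theta>t \<and> L2_H01 T Om \<theta>t \<and> grad_field T Om \<theta> q \<and>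
        (AE t in lebesgue_on {0..T}. \<forall>\<phi>\<in>H01v Om. \<forall>\<psi>\<in>H01 Om.
           rho * utt t \<phi> + elastic_form Om lam mu (u t) \<phi>
             + \<gamma> * T0 * L2ip Om (wgrad Om (\<theta>t t)) \<phi> = 0 \<and>
           - (rho * Cs * L2ip Om (\<theta>t t) \<psi>) + kap * L2ip Om (wgrad Om (\<theta> t)) (wgrad Om \<psi>)
             + L2ip Om (conv_adj T k q t) (wgrad Om \<psi>) + \<gamma> * L2ip Om (u t) (wgrad Om \<psi>)
             = L2ip Om h \<psi>) \<and>
        (AE x in lebesgue_on Om. u T x = 0 \<and> ut T x = 0 \<and> \<theta> T x = 0))"

definition same_pair :: "real \<Rightarrow> (real^'n) set \<Rightarrow>
    (real \<Rightarrow> real^'n \<Rightarrow> real^'n) \<Rightarrow> (real \<Rightarrow> real^'n \<Rightarrow> real) \<Rightarrow>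
    (real \<Rightarrow> real^'n \<Rightarrow> real^'n) \<Rightarrow> (real \<Rightarrow> real^'n \<Rightarrow> real) \<Rightarrow> bool" where
  "same_pair T Om u \<theta> u' \<theta>' \<longleftrightarrow>
     (\<forall>t\<in>{0..T}. AE x in lebesgue_on Om. u t x = u' t x \<and> \<theta> t x = \<theta>' t x)"

section \<open>The cost functional, variations and gradients\<close>

text \<open>Below, \<open>u f\<close> and \<open>\<theta> f\<close> denote the components of the solution with source \<open>f\<close>.\<close>

definition measurement ::
  "real \<Rightarrow> ((real^'n \<Rightarrow> real) \<Rightarrow> real \<Rightarrow> real^'n \<Rightarrow> real) \<Rightarrow> (real^'n \<Rightarrow> real) \<Rightarrow> real^'n \<Rightarrow> real" where
  "measurement T \<theta> f x = (LINT t|lebesgue_on {0..T}. \<theta> f t x)"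

definition cost :: "real \<Rightarrow> (real^'n) set \<Rightarrow> ((real^'n \<Rightarrow> real) \<Rightarrow> real \<Rightarrow> real^'n \<Rightarrow> real) \<Rightarrow>
    (real^'n \<Rightarrow> real) \<Rightarrow> real \<Rightarrow> (real^'n \<Rightarrow> real) \<Rightarrow> real" where
  "cost T Om \<theta> \<Psi> \<beta> f =
     1 / 2 * (L2norm Om (\<lambda>x. measurement T \<theta> f x - \<Psi> x))\<^sup>2 + \<beta> / 2 * (L2norm Om f)\<^sup>2"

text \<open>\<open>(\<delta>u, \<delta>\<theta>)\<close> is the limit of the difference quotients in \<open>C([0,T], H\<^sup>1\<^sub>0)\<close>.\<close>

definition is_variation :: "real \<Rightarrow> (real^'n) set \<Rightarrow>
    ((real^'n \<Rightarrow> real) \<Rightarrow> real \<Rightarrow> real^'n \<Rightarrow> real^'n) \<Rightarrow> ((real^'n \<Rightarrow> real) \<Rightarrow> real \<Rightarrow> real^'n \<Rightarrow> real) \<Rightarrow>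
    (real^'n \<Rightarrow> real) \<Rightarrow> (real^'n \<Rightarrow> real) \<Rightarrow>
    (real \<Rightarrow> real^'n \<Rightarrow> real^'n) \<Rightarrow> (real \<Rightarrow> real^'n \<Rightarrow> real) \<Rightarrow> bool" where
  "is_variation T Om u \<theta> f \<delta>f \<delta>u \<delta>\<theta> \<longleftrightarrow>
     C_H01v T Om \<delta>u \<and> C_H01 T Om \<delta>\<theta> \<and>
     uniform_limit {0..T}
       (\<lambda>e t. H1normv Om (\<lambda>x. (1 / e) *\<^sub>R (u (\<lambda>y. f y + e * \<delta>f y) t x - u f t x) - \<delta>u t x))
       (\<lambda>t. 0) (at 0) \<and>
     uniform_limit {0..T}
       (\<lambda>e t. H1norm Om (\<lambda>x. (1 / e) * (\<theta> (\<lambda>y. f y + e * \<delta>f y) t x - \<theta> f t x) - \<delta>\<theta> t x))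
       (\<lambda>t. 0) (at 0)"

definition has_gateaux_deriv ::
  "((real^'n \<Rightarrow> real) \<Rightarrow> real) \<Rightarrow> (real^'n \<Rightarrow> real) \<Rightarrow> (real^'n \<Rightarrow> real) \<Rightarrow> real \<Rightarrow> bool" where
  "has_gateaux_deriv G f \<delta>f D \<longleftrightarrow> ((\<lambda>e. (G (\<lambda>x. f x + e * \<delta>f x) - G f) / e) \<longlongrightarrow> D) (at 0)"

definition gateaux_deriv ::
  "((real^'n \<Rightarrow> real) \<Rightarrow> real) \<Rightarrow> (real^'n \<Rightarrow> real) \<Rightarrow> (real^'n \<Rightarrow> real) \<Rightarrow> real" where
  "gateaux_deriv G f \<delta>f = (THE D. has_gateaux_deriv G f \<delta>f D)"

text \<open>\<open>H\<close> with inner product \<open>ip\<close> is a real Hilbert space (modulo equality a.e.) that is continuously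
  embedded in \<open>L\<^sup>2(Om)\<close>.\<close>

definition hilbert_in_L2 :: "(real^'n) set \<Rightarrow> (real^'n \<Rightarrow> real) set \<Rightarrow>
    ((real^'n \<Rightarrow> real) \<Rightarrow> (real^'n \<Rightarrow> real) \<Rightarrow> real) \<Rightarrow> bool" where
  "hilbert_in_L2 Om H ip \<longleftrightarrow>
     H \<subseteq> L2 Om \<and> (\<lambda>x. 0) \<in> H \<and>
     (\<forall>v\<in>H. \<forall>w\<in>H. \<forall>a b. (\<lambda>x. a * v x + b * w x) \<in> H) \<and>
     (\<forall>v\<in>H. \<forall>w\<in>H. ip v w = ip w v) \<and>
     (\<forall>v\<in>H. \<forall>w\<in>H. \<forall>z\<in>H. \<forall>a b. ip (\<lambda>x. a * v x + b * w x) z = a * ip v z + b * ip w z) \<and>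
     (\<forall>w\<in>H. 0 \<le> ip w w) \<and>
     (\<forall>w\<in>H. ip w w = 0 \<longleftrightarrow> (AE x in lebesgue_on Om. w x = 0)) \<and>
     (\<forall>X::nat \<Rightarrow> real^'n \<Rightarrow> real. (\<forall>n. X n \<in> H) \<and>
        (\<forall>e>0. \<exists>N. \<forall>m\<ge>N. \<forall>n\<ge>N. sqrt (ip (\<lambda>x. X m x - X n x) (\<lambda>x. X m x - X n x)) < e) \<longrightarrow>
        (\<exists>w\<in>H. (\<lambda>n. sqrt (ip (\<lambda>x. X n x - w x) (\<lambda>x. X n x - w x))) \<longlonglongrightarrow> 0)) \<and>
     (\<exists>C. \<forall>w\<in>H. L2norm Om w \<le> C * sqrt (ip w w))"

definition bounded_linear_functional_on :: "(real^'n \<Rightarrow> real) set \<Rightarrow>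
    ((real^'n \<Rightarrow> real) \<Rightarrow> (real^'n \<Rightarrow> real) \<Rightarrow> real) \<Rightarrow> ((real^'n \<Rightarrow> real) \<Rightarrow> real) \<Rightarrow> bool" where
  "bounded_linear_functional_on H ip l \<longleftrightarrow>
     (\<forall>v\<in>H. \<forall>w\<in>H. \<forall>a b. l (\<lambda>x. a * v x + b * w x) = a * l v + b * l w) \<and>
     (\<exists>C. \<forall>w\<in>H. \<bar>l w\<bar> \<le> C * sqrt (ip w w))"

definition is_gradient :: "(real^'n \<Rightarrow> real) set \<Rightarrow>
    ((real^'n \<Rightarrow> real) \<Rightarrow> (real^'n \<Rightarrow> real) \<Rightarrow> real) \<Rightarrow>
    ((real^'n \<Rightarrow> real) \<Rightarrow> real) \<Rightarrow> (real^'n \<Rightarrow> real) \<Rightarrow> (real^'n \<Rightarrow> real) \<Rightarrow> bool" where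
  "is_gradient H ip G f w \<longleftrightarrow> w \<in> H \<and> (\<forall>\<delta>f\<in>H. gateaux_deriv G f \<delta>f = ip w \<delta>f)"

definition H1ip :: "(real^'n) set \<Rightarrow> (real^'n \<Rightarrow> real) \<Rightarrow> (real^'n \<Rightarrow> real) \<Rightarrow>
    (real^'n \<Rightarrow> real) \<Rightarrow> (real^'n \<Rightarrow> real) \<Rightarrow> real" where
  "H1ip Om r0 r1 w z =
     L2ip Om (\<lambda>x. r0 x * w x) z + L2ip Om (\<lambda>x. r1 x *\<^sub>R wgrad Om w x) (wgrad Om z)"

text \<open>Weak solutions of \<open>-\<nabla>\<cdot>(r1 \<nabla>K) + r0 K = h\<close> with homogeneous Neumann boundary condition.\<close>

definition elliptic_solution :: "(real^'n) set \<Rightarrow> (real^'n \<Rightarrow> real) \<Rightarrow> (real^'n \<Rightarrow> real) \<Rightarrow>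
    (real^'n \<Rightarrow> real) \<Rightarrow> (real^'n \<Rightarrow> real) \<Rightarrow> bool" where
  "elliptic_solution Om r0 r1 h K \<longleftrightarrow> K \<in> H1 Om \<and>
     (\<forall>\<phi>\<in>H1 Om. L2ip Om (\<lambda>x. r1 x *\<^sub>R wgrad Om K x) (wgrad Om \<phi>) + L2ip Om (\<lambda>x. r0 x * K x) \<phi>
        = L2ip Om h \<phi>)"

end

theory Submission
  imports Defs
begin

text \<open>The solution operator is linear because the forward problem is linear and uniquely solvable. Hence the
  difference quotients are themselves the solution for the source \<open>\<delta>f\<close>, the cost functional is a quadratic
  polynomial along every line, and its derivative is \<open>(P \<delta>f, P f - \<Psi>) + \<beta> (f, \<delta>f)\<close>. Testing the forward
  equations with the adjoint solution and conversely, and integrating by parts in time, turns the first term into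
  \<open>(\<integral> g \<theta>\<^sup>* dt, \<delta>f)\<close>. This gives the \<open>L\<^sup>2\<close>-gradient, and with it the boundedness of the derivative without
  any energy estimate, so that the Riesz representation theorem applies in every Hilbert space embedded in \<open>L\<^sup>2\<close>;
  in \<open>H\<^sup>1\<close> the representation identity is literally the weak form of the elliptic problem.\<close>

section \<open>Semi-inner product spaces of functions\<close>

text \<open>The main obstacle is low regularity in time. Derivatives exist only as distributions,
  and the second time derivative of the adjoint displacement is a functional whose link to the first
  derivative is known for time-independent test functions only. Hence no product rule in time is
  used. Each vanishing initial or terminal value is turned into a representation by
  \<open>iop V\<close> (integral over \<open>[0,t]\<close>) or \<open>iop V'\<close> (integral over
  \<open>[t,T]\<close>). These operators are adjoint to each other, so that integration by parts
  becomes Fubini's theorem; the same adjointness carries \<open>conv\<close> into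
  \<open>conv_adj\<close>. A second obstacle is that \<open>wgrad\<close> chooses its value
  separately at every time, so that gradients need not be jointly measurable. They are replaced by
  versions in \<open>ST\<close>, obtained from continuity in time. Uniqueness of weak gradients and
  the passage from distributional derivatives to integrals both rest on the fundamental lemma, for
  which smooth bump functions are constructed explicitly. Functions equal almost everywhere are not
  identified, so all inner products are treated as semidefinite forms on sets of functions.\<close>

locale semi_inner_space =
  fixes H :: "('a \<Rightarrow> 'b::real_vector) set" and ip :: "('a \<Rightarrow> 'b) \<Rightarrow> ('a \<Rightarrow> 'b) \<Rightarrow> real"
  assumes zero_mem: "(\<lambda>x. 0) \<in> H"
    and lincomb_mem: "v \<in> H \<Longrightarrow> w \<in> H \<Longrightarrow> (\<lambda>x. a *\<^sub>R v x + b *\<^sub>R w x) \<in> H"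
    and ip_sym: "v \<in> H \<Longrightarrow> w \<in> H \<Longrightarrow> ip v w = ip w v"
    and ip_lincomb: "v \<in> H \<Longrightarrow> w \<in> H \<Longrightarrow> z \<in> H \<Longrightarrow>
      ip (\<lambda>x. a *\<^sub>R v x + b *\<^sub>R w x) z = a * ip v z + b * ip w z"
    and ip_nonneg: "w \<in> H \<Longrightarrow> 0 \<le> ip w w"
begin

definition nrm :: "('a \<Rightarrow> 'b) \<Rightarrow> real" where "nrm w = sqrt (ip w w)"

lemma diff_mem: "v \<in> H \<Longrightarrow> w \<in> H \<Longrightarrow> (\<lambda>x. v x - w x) \<in> H"
  using lincomb_mem[of v w 1 "-1"] by simp

lemma add_mem: "v \<in> H \<Longrightarrow> w \<in> H \<Longrightarrow> (\<lambda>x. v x + w x) \<in> H"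
  using lincomb_mem[of v w 1 1] by simp

lemma ip_diff: "v \<in> H \<Longrightarrow> w \<in> H \<Longrightarrow> z \<in> H \<Longrightarrow> ip (\<lambda>x. v x - w x) z = ip v z - ip w z"
  using ip_lincomb[of v w z 1 "-1"] by simp

lemma ip_lincomb_right:
  "v \<in> H \<Longrightarrow> w \<in> H \<Longrightarrow> z \<in> H \<Longrightarrow> ip z (\<lambda>x. a *\<^sub>R v x + b *\<^sub>R w x) = a * ip z v + b * ip z w"
  using ip_lincomb[of v w z a b] ip_sym lincomb_mem by metis

lemma ip_lincomb_self:
  assumes "v \<in> H" "w \<in> H"
  shows "ip (\<lambda>x. a *\<^sub>R v x + b *\<^sub>R w x) (\<lambda>x. a *\<^sub>R v x + b *\<^sub>R w x) =
    a\<^sup>2 * ip v v + 2 * a * b * ip v w + b\<^sup>2 * ip w w"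
  using assms ip_sym[of v w]
  by (simp add: ip_lincomb ip_lincomb_right lincomb_mem power2_eq_square algebra_simps)

lemma nrm_nonneg: "w \<in> H \<Longrightarrow> 0 \<le> nrm w"
  unfolding nrm_def using ip_nonneg by simp

lemma nrm_square: "w \<in> H \<Longrightarrow> (nrm w)\<^sup>2 = ip w w"
  unfolding nrm_def using ip_nonneg by simp

text \<open>Nonnegativity of \<open>ip\<close> on all combinations of \<open>v\<close> and
  \<open>w\<close>. As the form is only semidefinite, null vectors \<open>w\<close> are a separate
  case: there the quadratic expression is affine in \<open>b\<close> and can stay nonnegative only
  if \<open>ip v w = 0\<close>.\<close>

lemma Cauchy_Schwarz:
  assumes v: "v \<in> H" and w: "w \<in> H"
  shows "\<bar>ip v w\<bar> \<le> nrm v * nrm w"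
proof -
  have q: "0 \<le> a\<^sup>2 * ip v v + 2 * a * b * ip v w + b\<^sup>2 * ip w w" for a b
    using ip_lincomb_self[OF v w, of a b] ip_nonneg[OF lincomb_mem[OF v w, of a b]] by simp
  have "(ip v w)\<^sup>2 \<le> ip v v * ip w w"
  proof (cases "ip w w = 0")
    case True
    have "ip v w = 0"
    proof (rule ccontr)
      assume "ip v w \<noteq> 0"
      \<comment> \<open>With this \<open>b\<close> the quadratic expression equals -1.\<close>
      then show False
        using q[of 1 "- (ip v v + 1) / (2 * ip v w)"] True by (simp add: field_simps)
    qed
    then show ?thesis using True by simp
  next
    case False
    then have pos: "0 < ip w w" using ip_nonneg[OF w] by simp
    \<comment> \<open>The residual of projecting \<open>v\<close> onto \<open>w\<close>, multiplied
      by \<open>ip w w\<close> to avoid a division.\<close>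
    have "0 \<le> (ip w w)\<^sup>2 * ip v v + 2 * ip w w * (- ip v w) * ip v w + (- ip v w)\<^sup>2 * ip w w"
      by (rule q)
    also have "\<dots> = ip w w * (ip v v * ip w w - (ip v w)\<^sup>2)"
      by (simp add: power2_eq_square algebra_simps)
    finally show ?thesis using pos by (simp add: zero_le_mult_iff)
  qed
  then have "sqrt ((ip v w)\<^sup>2) \<le> sqrt (ip v v * ip w w)" by (rule real_sqrt_le_mono)
  then show ?thesis by (simp add: nrm_def real_sqrt_mult)
qed

lemma nrm_lincomb_le:
  assumes v: "v \<in> H" and w: "w \<in> H"
  shows "nrm (\<lambda>x. a *\<^sub>R v x + b *\<^sub>R w x) \<le> \<bar>a\<bar> * nrm v + \<bar>b\<bar> * nrm w"
proof (rule power2_le_imp_le)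
  have "(nrm (\<lambda>x. a *\<^sub>R v x + b *\<^sub>R w x))\<^sup>2 = a\<^sup>2 * (nrm v)\<^sup>2 + 2 * a * b * ip v w + b\<^sup>2 * (nrm w)\<^sup>2"
    using v w by (simp add: nrm_square lincomb_mem ip_lincomb_self)
  also have "2 * a * b * ip v w \<le> 2 * (\<bar>a\<bar> * nrm v) * (\<bar>b\<bar> * nrm w)"
  proof -
    have "a * b * ip v w \<le> \<bar>a\<bar> * \<bar>b\<bar> * \<bar>ip v w\<bar>" using abs_ge_self[of "a * b * ip v w"] by (simp add: abs_mult)
    also have "\<dots> \<le> \<bar>a\<bar> * \<bar>b\<bar> * (nrm v * nrm w)"
      by (intro mult_left_mono Cauchy_Schwarz v w) auto
    finally show ?thesis by (simp add: algebra_simps)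
  qed
  finally show "(nrm (\<lambda>x. a *\<^sub>R v x + b *\<^sub>R w x))\<^sup>2 \<le> (\<bar>a\<bar> * nrm v + \<bar>b\<bar> * nrm w)\<^sup>2"
    by (simp add: power2_sum power_mult_distrib)
  show "0 \<le> \<bar>a\<bar> * nrm v + \<bar>b\<bar> * nrm w" using nrm_nonneg v w by simp
qed

lemma nrm_triangle: "v \<in> H \<Longrightarrow> w \<in> H \<Longrightarrow> z \<in> H \<Longrightarrow>
    nrm (\<lambda>x. v x - w x) \<le> nrm (\<lambda>x. v x - z x) + nrm (\<lambda>x. z x - w x)"
  using nrm_lincomb_le[of "\<lambda>x. v x - z x" "\<lambda>x. z x - w x" 1 1] by (simp add: diff_mem)

lemma nrm_minus_commute: "v \<in> H \<Longrightarrow> w \<in> H \<Longrightarrow> nrm (\<lambda>x. v x - w x) = nrm (\<lambda>x. w x - v x)"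
  unfolding nrm_def by (simp add: ip_diff ip_sym[of _ "\<lambda>x. _ x - _ x"] diff_mem ip_sym[of v w])

lemma nrm_diff_le: "v \<in> H \<Longrightarrow> w \<in> H \<Longrightarrow> \<bar>nrm v - nrm w\<bar> \<le> nrm (\<lambda>x. v x - w x)"
  using nrm_triangle[of v "\<lambda>x. 0" w] nrm_triangle[of w "\<lambda>x. 0" v] nrm_minus_commute[of v w] zero_mem
  by simp

lemma tendsto_ip:
  assumes X: "\<forall>\<^sub>F n in F. X n \<in> H" and w: "w \<in> H" and v: "v \<in> H"
    and lim: "((\<lambda>n. nrm (\<lambda>x. X n x - w x)) \<longlongrightarrow> 0) F"
  shows "((\<lambda>n. ip (X n) v) \<longlongrightarrow> ip w v) F"
proof -
  have "((\<lambda>n. ip (X n) v - ip w v) \<longlongrightarrow> 0) F"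
  proof (rule Lim_null_comparison)
    show "((\<lambda>n. nrm (\<lambda>x. X n x - w x) * nrm v) \<longlongrightarrow> 0) F" using tendsto_mult_right[OF lim] by simp
    show "\<forall>\<^sub>F n in F. norm (ip (X n) v - ip w v) \<le> nrm (\<lambda>x. X n x - w x) * nrm v"
      using X
    proof eventually_elim
      case (elim n)
      then show ?case using Cauchy_Schwarz[OF diff_mem[OF elim w] v] by (simp add: ip_diff w v)
    qed
  qed
  from tendsto_add[OF this tendsto_const[of "ip w v"]] show ?thesis by simp
qed

text \<open>The representing element minimises \<open>w \<mapsto> ip w w - 2 * l w\<close>; minimising sequences are Cauchy by the
  parallelogram law.\<close>

theorem Riesz_representation:
  assumes complete: "\<And>X. (\<And>n. X n \<in> H) \<Longrightarrow>
      (\<forall>e>0. \<exists>N. \<forall>m\<ge>N. \<forall>n\<ge>N. nrm (\<lambda>x. X m x - X n x) < e) \<Longrightarrow>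
      \<exists>w\<in>H. (\<lambda>n::nat. nrm (\<lambda>x. X n x - w x)) \<longlonglongrightarrow> 0"
    and lin: "\<And>v w a b. v \<in> H \<Longrightarrow> w \<in> H \<Longrightarrow> l (\<lambda>x. a *\<^sub>R v x + b *\<^sub>R w x) = a * l v + b * l w"
    and bdd: "\<And>w. w \<in> H \<Longrightarrow> \<bar>l w\<bar> \<le> C * nrm w"
  shows "\<exists>w\<in>H. \<forall>v\<in>H. l v = ip w v"
proof -
  define J where "J w = ip w w - 2 * l w" for w
  define d where "d = Inf (J ` H)"
  \<comment> \<open>Boundedness of \<open>l\<close> and completing the square keep \<open>J\<close>
    bounded below, so that its infimum is meaningful.\<close>
  have lb: "- C\<^sup>2 \<le> J w" if w: "w \<in> H" for w
  proof -
    have "2 * l w \<le> 2 * (C * nrm w)" using bdd[OF w] by linarith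
    also have "\<dots> \<le> C\<^sup>2 + (nrm w)\<^sup>2" using sum_squares_bound[of C "nrm w"] by simp
    finally show ?thesis by (simp add: J_def nrm_square[OF w])
  qed
  then have bb: "bdd_below (J ` H)" by (intro bdd_belowI2)
  have ne: "J ` H \<noteq> {}" using zero_mem by auto
  have d_le: "d \<le> J w" if "w \<in> H" for w unfolding d_def using that bb by (intro cInf_lower) auto
  have "\<exists>w\<in>H. J w < d + 1 / Suc n" for n
  proof -
    have "Inf (J ` H) < d + 1 / Suc n" by (simp add: d_def)
    then show ?thesis using cInf_lessD[OF ne] by blast
  qed
  then obtain X where XH: "\<And>n. X n \<in> H" and XJ: "\<And>n::nat. J (X n) < d + 1 / Suc n" by metis
  \<comment> \<open>The midpoint of \<open>X m\<close> and \<open>X n\<close> cannot lie below the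
    infimum \<open>d\<close>; this bounds a quarter of the squared distance by the mean excess of
    the two values over \<open>d\<close>.\<close>
  have key: "(nrm (\<lambda>x. X m x - X n x))\<^sup>2 \<le> 2 / Suc m + 2 / Suc n" for m n
  proof -
    let ?z = "\<lambda>x. (1/2) *\<^sub>R X m x + (1/2) *\<^sub>R X n x"
    let ?e = "\<lambda>x. 1 *\<^sub>R X m x + (-1) *\<^sub>R X n x"
    have "d \<le> J ?z" using lincomb_mem[OF XH XH] by (rule d_le)
    also have "J ?z = J (X m) / 2 + J (X n) / 2 - ip ?e ?e / 4"
      unfolding J_def lin[OF XH XH] ip_lincomb_self[OF XH XH] by (simp add: power2_eq_square field_simps)
    finally have "ip ?e ?e \<le> 2 * (J (X m) - d) + 2 * (J (X n) - d)" by simp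
    also have "\<dots> \<le> 2 * (1 / Suc m) + 2 * (1 / Suc n)"
      using XJ[of m] XJ[of n] by (intro add_mono mult_left_mono) linarith+
    finally show ?thesis using nrm_square[OF lincomb_mem[OF XH[of m] XH[of n], of 1 "-1"]] by simp
  qed
  have "\<exists>w\<in>H. (\<lambda>n. nrm (\<lambda>x. X n x - w x)) \<longlonglongrightarrow> 0"
  proof (rule complete[OF XH], intro allI impI)
    fix e :: real assume e: "0 < e"
    \<comment> \<open>This \<open>N\<close> makes each of the two terms \<open>2 / Suc j\<close>
      smaller than half of \<open>e\<^sup>2\<close>.\<close>
    then obtain N where N: "4 / e\<^sup>2 < real N" using reals_Archimedean2 by blast
    have "nrm (\<lambda>x. X m x - X n x) < e" if "N \<le> m" "N \<le> n" for m n
    proof (rule power2_less_imp_less[OF le_less_trans[OF key]])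
      have a: "2 / real (Suc j) < e\<^sup>2 / 2" if "N \<le> j" for j
      proof -
        have "4 / e\<^sup>2 < real (Suc j)" using N that by linarith
        then show ?thesis using e by (simp add: field_simps)
      qed
      show "2 / real (Suc m) + 2 / real (Suc n) < e\<^sup>2" using a[OF that(1)] a[OF that(2)] by linarith
    qed (use e in simp)
    then show "\<exists>N. \<forall>m\<ge>N. \<forall>n\<ge>N. nrm (\<lambda>x. X m x - X n x) < e" by blast
  qed
  then obtain w where w: "w \<in> H" and lim: "(\<lambda>n. nrm (\<lambda>x. X n x - w x)) \<longlonglongrightarrow> 0" by blast
  have Jexp: "J (\<lambda>x. 1 *\<^sub>R a x + s *\<^sub>R v x) = J a + 2 * s * (ip a v - l v) + s\<^sup>2 * ip v v"
    if "a \<in> H" "v \<in> H" for a v s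
    unfolding J_def lin[OF that] ip_lincomb_self[OF that] by (simp add: algebra_simps)
  have "l v = ip w v" if v: "v \<in> H" for v
  proof -
    define c where "c = ip w v - l v"
    have lim_ip: "(\<lambda>n. ip (X n) v - l v) \<longlonglongrightarrow> c"
      unfolding c_def by (intro tendsto_diff tendsto_const tendsto_ip w v lim) (simp add: XH)
    \<comment> \<open>The nearly minimal \<open>X n\<close> is compared with its perturbation
      \<open>X n + s v\<close>, and \<open>n\<close> tends to infinity. Only
      \<open>ip (X n) v\<close> has to converge; minimality of \<open>w\<close> itself is never
      established.\<close>
    have "0 \<le> 2 * s * c + s\<^sup>2 * ip v v" for s
    proof (rule tendsto_le[OF trivial_limit_sequentially _ tendsto_const])
      show "(\<lambda>n. 1 / Suc n + 2 * s * (ip (X n) v - l v) + s\<^sup>2 * ip v v) \<longlonglongrightarrow> 2 * s * c + s\<^sup>2 * ip v v"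
      proof -
        have "(\<lambda>n. 1 / real (Suc n) + 2 * s * (ip (X n) v - l v) + s\<^sup>2 * ip v v) \<longlonglongrightarrow> 0 + 2 * s * c + s\<^sup>2 * ip v v"
          by (intro tendsto_intros lim_ip LIMSEQ_Suc lim_1_over_n)
        then show ?thesis by simp
      qed
      show "\<forall>\<^sub>F n in sequentially. 0 \<le> 1 / Suc n + 2 * s * (ip (X n) v - l v) + s\<^sup>2 * ip v v"
      proof (intro always_eventually allI)
        fix n
        have "d \<le> J (X n) + 2 * s * (ip (X n) v - l v) + s\<^sup>2 * ip v v"
          using d_le[OF lincomb_mem[OF XH[of n] v, of 1 s]] Jexp[OF XH[of n] v, of s] by simp
        then show "0 \<le> 1 / Suc n + 2 * s * (ip (X n) v - l v) + s\<^sup>2 * ip v v"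
          using XJ[of n] by linarith
      qed
    qed
    note quad = this
    \<comment> \<open>A step of size \<open>- c / p\<close> in direction \<open>v\<close>
      contradicts the inequality unless \<open>c = 0\<close>; the summand 1 keeps \<open>p\<close>
      positive when \<open>v\<close> is a null vector.\<close>
    define p where "p = ip v v + 1"
    define s where "s = - c / p"
    have p: "0 < p" using ip_nonneg[OF v] by (simp add: p_def)
    then have sp: "s * p = - c" by (simp add: s_def)
    have "0 \<le> 2 * s * c + s\<^sup>2 * (p - 1)" using quad[of s] by (simp add: p_def)
    also have "\<dots> = 2 * s * c + s * (s * p) - s\<^sup>2" by (simp add: power2_eq_square algebra_simps)
    also have "\<dots> = s * c - s\<^sup>2" by (simp add: sp)
    finally have "0 \<le> p * (s * c - s\<^sup>2)" using p by simp
    also have "\<dots> = (s * p) * c - p * s\<^sup>2" by (simp add: algebra_simps)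
    finally have "c\<^sup>2 + p * s\<^sup>2 \<le> 0" by (simp add: sp power2_eq_square)
    moreover have "0 \<le> p * s\<^sup>2" using p by simp
    ultimately have "c\<^sup>2 \<le> 0" by linarith
    then have "c = 0" by simp
    then show ?thesis by (simp add: c_def)
  qed
  then show ?thesis using w by blast
qed

end

section \<open>Square-integrable functions\<close>

text \<open>Over an arbitrary measure, because the same facts are used on \<open>Om\<close>, on the
  time interval and on their product.\<close>

definition sq_int :: "'a measure \<Rightarrow> ('a \<Rightarrow> 'b::euclidean_space) set" where
  "sq_int M = {f \<in> borel_measurable M. integrable M (\<lambda>x. (norm (f x))\<^sup>2)}"

definition ipM :: "'a measure \<Rightarrow> ('a \<Rightarrow> 'b::euclidean_space) \<Rightarrow> ('a \<Rightarrow> 'b) \<Rightarrow> real" where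
  "ipM M f g = (LINT x|M. f x \<bullet> g x)"

lemma sq_int_measurable[measurable_dest]: "f \<in> sq_int M \<Longrightarrow> f \<in> borel_measurable M"
  by (simp add: sq_int_def)

lemma sq_int_integrable: "f \<in> sq_int M \<Longrightarrow> integrable M (\<lambda>x. (norm (f x))\<^sup>2)"
  by (simp add: sq_int_def)

lemma sq_int_bound:
  assumes g: "g \<in> borel_measurable M" and f: "f \<in> sq_int M" and b: "AE x in M. norm (g x) \<le> C * norm (f x)"
  shows "g \<in> sq_int M"
proof -
  have "integrable M (\<lambda>x. (norm (g x))\<^sup>2)"
  proof (rule Bochner_Integration.integrable_bound)
    show "integrable M (\<lambda>x. C\<^sup>2 * (norm (f x))\<^sup>2)" using sq_int_integrable[OF f] by simp
    show "AE x in M. norm ((norm (g x))\<^sup>2) \<le> norm (C\<^sup>2 * (norm (f x))\<^sup>2)"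
      using b
    proof eventually_elim
      case (elim x)
      have "(norm (g x))\<^sup>2 \<le> (C * norm (f x))\<^sup>2" using elim by (intro power_mono) auto
      then show ?case by (simp add: power_mult_distrib)
    qed
  qed (use g in measurable)
  then show ?thesis using g by (simp add: sq_int_def)
qed

lemma integrable_inner:
  assumes f: "f \<in> sq_int M" and g: "g \<in> sq_int M"
  shows "integrable M (\<lambda>x. f x \<bullet> g x)"
proof (rule Bochner_Integration.integrable_bound)
  show "integrable M (\<lambda>x. (norm (f x))\<^sup>2 + (norm (g x))\<^sup>2)"
    using sq_int_integrable[OF f] sq_int_integrable[OF g] by simp
  show "(\<lambda>x. f x \<bullet> g x) \<in> borel_measurable M"
    using sq_int_measurable[OF f] sq_int_measurable[OF g] by measurable
  have "\<bar>v \<bullet> w\<bar> \<le> (norm v)\<^sup>2 + (norm w)\<^sup>2" for v w :: 'b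
  proof -
    have "\<bar>v \<bullet> w\<bar> \<le> norm v * norm w" by (rule Cauchy_Schwarz_ineq2)
    moreover have "2 * (norm v * norm w) \<le> (norm v)\<^sup>2 + (norm w)\<^sup>2"
      using sum_squares_bound[of "norm v" "norm w"] by simp
    moreover have "0 \<le> norm v * norm w" by simp
    ultimately show ?thesis by linarith
  qed
  then show "AE x in M. norm (f x \<bullet> g x) \<le> norm ((norm (f x))\<^sup>2 + (norm (g x))\<^sup>2)" by simp
qed

lemma sq_int_lincomb:
  assumes f: "f \<in> sq_int M" and g: "g \<in> sq_int M"
  shows "(\<lambda>x. a *\<^sub>R f x + b *\<^sub>R g x) \<in> sq_int M"
proof -
  have "integrable M (\<lambda>x. a\<^sup>2 * (norm (f x))\<^sup>2 + 2 * a * b * (f x \<bullet> g x) + b\<^sup>2 * (norm (g x))\<^sup>2)"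
    using sq_int_integrable[OF f] sq_int_integrable[OF g] integrable_inner[OF f g] by simp
  moreover have "(norm (a *\<^sub>R f x + b *\<^sub>R g x))\<^sup>2 =
      a\<^sup>2 * (norm (f x))\<^sup>2 + 2 * a * b * (f x \<bullet> g x) + b\<^sup>2 * (norm (g x))\<^sup>2" for x
    unfolding power2_norm_eq_inner
    by (simp add: inner_add_left inner_add_right inner_commute power2_eq_square algebra_simps)
  ultimately show ?thesis
    using sq_int_measurable[OF f] sq_int_measurable[OF g] by (simp add: sq_int_def)
qed

global_interpretation sq: semi_inner_space "sq_int M" "ipM M" for M
  defines nrmM = sq.nrm
proof
  show "(\<lambda>x. 0) \<in> sq_int M" by (simp add: sq_int_def)
  show "ipM M v w = ipM M w v" for v w :: "'a \<Rightarrow> 'b" by (simp add: ipM_def inner_commute)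
  show "ipM M (\<lambda>x. a *\<^sub>R v x + b *\<^sub>R w x) z = a * ipM M v z + b * ipM M w z"
    if "v \<in> sq_int M" "w \<in> sq_int M" "z \<in> sq_int M" for v w z :: "'a \<Rightarrow> 'b" and a b
    using integrable_inner[OF that(1,3)] integrable_inner[OF that(2,3)]
    by (simp add: ipM_def inner_add_left)
qed (auto intro: sq_int_lincomb simp: ipM_def)

lemma nrmM_eq: "nrmM M f = sqrt (LINT x|M. (norm (f x))\<^sup>2)"
  by (simp add: sq.nrm_def ipM_def power2_norm_eq_inner)

lemma sq_int_cmult: "f \<in> sq_int M \<Longrightarrow> (\<lambda>x. a *\<^sub>R f x) \<in> sq_int M"
  using sq_int_lincomb[of f M f a 0] by simp

lemma sq_int_cong_AE:
  assumes "f \<in> sq_int M" "AE x in M. f x = g x" "g \<in> borel_measurable M"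
  shows "g \<in> sq_int M"
  by (rule sq_int_bound[OF assms(3,1), of 1]) (use assms(2) in auto)

lemma ipM_cong_AE:
  assumes "AE x in M. f x = f' x" "AE x in M. g x = g' x"
    and "f \<in> borel_measurable M" "f' \<in> borel_measurable M" "g \<in> borel_measurable M" "g' \<in> borel_measurable M"
  shows "ipM M f g = ipM M f' g'"
  unfolding ipM_def by (rule integral_cong_AE) (use assms in auto)

lemma nrmM_cong_AE:
  assumes "AE x in M. f x = f' x" "f \<in> borel_measurable M" "f' \<in> borel_measurable M"
  shows "nrmM M f = nrmM M f'"
  by (simp only: sq.nrm_def ipM_cong_AE[OF assms(1,1,2,3,2,3)])

lemma nrmM_eq_0_iff:
  assumes f: "f \<in> sq_int M"
  shows "nrmM M f = 0 \<longleftrightarrow> (AE x in M. f x = 0)"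
  unfolding nrmM_eq using integral_nonneg_eq_0_iff_AE[OF sq_int_integrable[OF f]] by simp

lemma ipM_self_eq_0_iff: "f \<in> sq_int M \<Longrightarrow> ipM M f f = 0 \<longleftrightarrow> (AE x in M. f x = 0)"
  using nrmM_eq_0_iff[of f M] by (simp add: sq.nrm_def)

context finite_measure
begin

lemma sq_int_bounded:
  assumes "f \<in> borel_measurable M" "AE x in M. norm (f x) \<le> C"
  shows "f \<in> sq_int M"
proof -
  have "integrable M (\<lambda>x. (norm (f x))\<^sup>2)"
    by (rule integrable_const_bound[where B = "C\<^sup>2"])
      (use assms in \<open>auto elim!: eventually_mono intro: power_mono\<close>)
  then show ?thesis using assms by (simp add: sq_int_def)
qed

lemma sq_int_imp_integrable:
  assumes f: "f \<in> sq_int M"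
  shows "integrable M f"
proof -
  have "integrable M (\<lambda>x. norm (f x))"
    using square_integrable_imp_integrable[of "\<lambda>x. norm (f x)"] f by (simp add: sq_int_def)
  then show ?thesis using f integrable_norm_cancel sq_int_measurable by blast
qed

text \<open>Cauchy-Schwarz against the constant 1, which is square integrable because the measure is
  finite.\<close>

lemma L1_le_nrmM:
  assumes f: "f \<in> sq_int M"
  shows "(LINT x|M. norm (f x)) \<le> nrmM M f * sqrt (measure M (space M))"
proof -
  have n: "(\<lambda>x. norm (f x)) \<in> sq_int M"
    using f measurable_compose[OF sq_int_measurable[OF f] borel_measurable_norm] by (simp add: sq_int_def)
  have o: "(\<lambda>x. 1::real) \<in> sq_int M" by (simp add: sq_int_def)
  have "\<bar>ipM M (\<lambda>x. norm (f x)) (\<lambda>x. 1)\<bar> \<le> nrmM M (\<lambda>x. norm (f x)) * nrmM M (\<lambda>x. 1::real)"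
    by (rule sq.Cauchy_Schwarz[OF n o])
  then show ?thesis by (simp add: ipM_def nrmM_eq)
qed

text \<open>A square-integrable limit is first found pointwise almost everywhere along a subsequence; Fatou's lemma then
  bounds the distance of the whole sequence from it.\<close>

theorem sq_int_complete:
  fixes X :: "nat \<Rightarrow> 'a \<Rightarrow> 'b::euclidean_space"
  assumes X: "\<And>n. X n \<in> sq_int M"
    and Cauchy: "\<forall>e>0. \<exists>N. \<forall>m\<ge>N. \<forall>n\<ge>N. nrmM M (\<lambda>x. X m x - X n x) < e"
  shows "\<exists>w\<in>sq_int M. (\<lambda>n. nrmM M (\<lambda>x. X n x - w x)) \<longlonglongrightarrow> 0"
proof -
  let ?K = "sqrt (measure M (space M))"
  have K: "0 < ?K + 1" by (intro add_nonneg_pos) auto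
  note [measurable] = sq_int_measurable[OF X]
  have L1: "\<exists>N. \<forall>i\<ge>N. \<forall>j\<ge>N. (LINT x|M. norm (X i x - X j x)) < e" if e: "0 < e" for e
  proof -
    have "0 < e / (?K + 1)" using e K by simp
    then obtain N where N: "\<And>m n. m \<ge> N \<Longrightarrow> n \<ge> N \<Longrightarrow> nrmM M (\<lambda>x. X m x - X n x) < e / (?K + 1)"
      using Cauchy by blast
    have "(LINT x|M. norm (X i x - X j x)) < e" if ij: "i \<ge> N" "j \<ge> N" for i j
    proof -
      have "nrmM M (\<lambda>x. X i x - X j x) * ?K \<le> nrmM M (\<lambda>x. X i x - X j x) * (?K + 1)"
        using sq.nrm_nonneg[OF sq.diff_mem[OF X[of i] X[of j]]] by (simp add: distrib_left)
      moreover have "nrmM M (\<lambda>x. X i x - X j x) * (?K + 1) < e"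
        using N[OF ij] K by (simp add: pos_less_divide_eq)
      ultimately show ?thesis
        using L1_le_nrmM[OF sq.diff_mem[OF X[of i] X[of j]]] by linarith
    qed
    then show ?thesis by blast
  qed
  obtain r where r: "strict_mono r" "AE x in M. Cauchy (\<lambda>i. X (r i) x)"
    by (rule cauchy_L1_AE_cauchy_subseq[OF sq_int_imp_integrable[OF X] L1])
  define w where "w x = lim (\<lambda>i. X (r i) x)" for x
  have [measurable]: "w \<in> borel_measurable M" unfolding w_def by measurable
  have conv: "AE x in M. (\<lambda>i. X (r i) x) \<longlonglongrightarrow> w x"
    using r(2)
  proof eventually_elim
    case (elim x)
    then have "convergent (\<lambda>i. X (r i) x)" by (rule Cauchy_convergent)
    then show ?case unfolding w_def convergent_LIMSEQ_iff .
  qed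
  have est: "(\<lambda>x. X n x - w x) \<in> sq_int M \<and> nrmM M (\<lambda>x. X n x - w x) \<le> e"
    if e: "0 < e" and N: "\<And>m n. m \<ge> N \<Longrightarrow> n \<ge> N \<Longrightarrow> nrmM M (\<lambda>x. X m x - X n x) < e" and n: "n \<ge> N" for e N n
  proof -
    have "(\<integral>\<^sup>+x. ennreal ((norm (X n x - w x))\<^sup>2) \<partial>M) \<le>
        (\<integral>\<^sup>+x. liminf (\<lambda>i. ennreal ((norm (X n x - X (r i) x))\<^sup>2)) \<partial>M)"
    proof (rule nn_integral_mono_AE)
      show "AE x in M. ennreal ((norm (X n x - w x))\<^sup>2) \<le> liminf (\<lambda>i. ennreal ((norm (X n x - X (r i) x))\<^sup>2))"
        using conv
      proof eventually_elim
        case (elim x)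
        have lim: "(\<lambda>i. ennreal ((norm (X n x - X (r i) x))\<^sup>2)) \<longlonglongrightarrow> ennreal ((norm (X n x - w x))\<^sup>2)"
          by (intro tendsto_ennrealI tendsto_intros elim)
        show ?case unfolding lim_imp_Liminf[OF trivial_limit_sequentially lim] by (rule order_refl)
      qed
    qed
    also have "\<dots> \<le> liminf (\<lambda>i. \<integral>\<^sup>+x. ennreal ((norm (X n x - X (r i) x))\<^sup>2) \<partial>M)"
      by (rule nn_integral_liminf) measurable
    also have "\<dots> \<le> ennreal (e\<^sup>2)"
    proof (rule Liminf_le)
      have "(\<integral>\<^sup>+x. ennreal ((norm (X n x - X (r i) x))\<^sup>2) \<partial>M) \<le> ennreal (e\<^sup>2)" if "i \<ge> N" for i
      proof -
        have "i \<le> r i" using r(1) by (rule seq_suble)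
        then have ri: "r i \<ge> N" using that by simp
        have "(\<integral>\<^sup>+x. ennreal ((norm (X n x - X (r i) x))\<^sup>2) \<partial>M) = ennreal (LINT x|M. (norm (X n x - X (r i) x))\<^sup>2)"
          by (rule nn_integral_eq_integral) (use sq_int_integrable[OF sq.diff_mem[OF X X]] in auto)
        also have "(LINT x|M. (norm (X n x - X (r i) x))\<^sup>2) = (nrmM M (\<lambda>x. X n x - X (r i) x))\<^sup>2"
          by (simp add: nrmM_eq)
        also have "\<dots> \<le> e\<^sup>2" using N[OF n ri] sq.nrm_nonneg[OF sq.diff_mem[OF X X]] by (intro power_mono) auto
        finally show ?thesis using ennreal_leI by simp
      qed
      then show "\<forall>\<^sub>F i in sequentially. (\<integral>\<^sup>+x. ennreal ((norm (X n x - X (r i) x))\<^sup>2) \<partial>M) \<le> ennreal (e\<^sup>2)"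
        using eventually_sequentially by blast
      show "sequentially \<noteq> bot" by simp
    qed
    finally have fin: "(\<integral>\<^sup>+x. ennreal ((norm (X n x - w x))\<^sup>2) \<partial>M) \<le> ennreal (e\<^sup>2)" .
    then have int: "integrable M (\<lambda>x. (norm (X n x - w x))\<^sup>2)"
      by (intro integrableI_bounded) (auto simp: le_less_trans)
    have "(LINT x|M. (norm (X n x - w x))\<^sup>2) \<le> e\<^sup>2"
      using fin nn_integral_eq_integral[OF int] by (simp add: ennreal_le_iff)
    then have "nrmM M (\<lambda>x. X n x - w x) \<le> e"
      unfolding nrmM_eq using e by (intro real_le_lsqrt) auto
    then show ?thesis using int by (simp add: sq_int_def)
  qed
  obtain N1 where "\<And>m n. m \<ge> N1 \<Longrightarrow> n \<ge> N1 \<Longrightarrow> nrmM M (\<lambda>x. X m x - X n x) < 1"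
    using Cauchy zero_less_one by blast
  then have "(\<lambda>x. X N1 x - w x) \<in> sq_int M" using est[of 1 N1 N1] by simp
  \<comment> \<open>The limit is recovered as \<open>X N1 - (X N1 - w)\<close>, both terms being
    square integrable.\<close>
  from sq.diff_mem[OF X[of N1] this] have w: "w \<in> sq_int M" by simp
  have "(\<lambda>n. nrmM M (\<lambda>x. X n x - w x)) \<longlonglongrightarrow> 0"
  proof (rule LIMSEQ_I)
    fix e :: real assume e: "0 < e"
    then have "0 < e / 2" by simp
    with Cauchy obtain N where "\<And>m n. m \<ge> N \<Longrightarrow> n \<ge> N \<Longrightarrow> nrmM M (\<lambda>x. X m x - X n x) < e / 2"
      by blast
    then have le: "nrmM M (\<lambda>x. X n x - w x) \<le> e / 2" if "n \<ge> N" for n using est[of "e / 2" N n] e that by simp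
    have "norm (nrmM M (\<lambda>x. X n x - w x) - 0) < e" if "n \<ge> N" for n
      using le[OF that] e sq.nrm_nonneg[OF sq.diff_mem[OF X[of n] w]] by simp
    then show "\<exists>N. \<forall>n\<ge>N. norm (nrmM M (\<lambda>x. X n x - w x) - 0) < e" by blast
  qed
  then show ?thesis using w by blast
qed

text \<open>The geometric rate gives the sum of all distances a finite integral, so it is finite
  almost everywhere and its terms tend to 0. No subsequence is extracted:
  \<open>continuous_version\<close> needs one approximating sequence that works for every
  time.\<close>

lemma AE_tendsto_if_nrmM_summable:
  fixes X :: "nat \<Rightarrow> 'a \<Rightarrow> 'b::euclidean_space"
  assumes X: "\<And>n. X n \<in> sq_int M" and w: "w \<in> sq_int M"
    and rate: "\<And>n. nrmM M (\<lambda>x. X n x - w x) \<le> (1/2) ^ n"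
  shows "AE x in M. (\<lambda>n. X n x) \<longlonglongrightarrow> w x"
proof -
  let ?K = "sqrt (measure M (space M))"
  let ?d = "\<lambda>n x. norm (X n x - w x)"
  note [measurable] = sq_int_measurable[OF X] sq_int_measurable[OF w]
  have int: "integrable M (?d n)" for n using sq_int_imp_integrable[OF sq.diff_mem[OF X w]] by simp
  have le: "(\<integral>\<^sup>+x. ennreal (?d n x) \<partial>M) \<le> ennreal (?K * (1/2) ^ n)" for n
  proof -
    have "(LINT x|M. ?d n x) \<le> nrmM M (\<lambda>x. X n x - w x) * ?K" by (rule L1_le_nrmM[OF sq.diff_mem[OF X w]])
    also have "\<dots> \<le> (1/2) ^ n * ?K" using rate by (intro mult_right_mono) auto
    finally show ?thesis by (simp add: nn_integral_eq_integral[OF int] mult.commute ennreal_leI)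
  qed
  have "(\<integral>\<^sup>+x. (\<Sum>n. ennreal (?d n x)) \<partial>M) = (\<Sum>n. \<integral>\<^sup>+x. ennreal (?d n x) \<partial>M)"
    by (rule nn_integral_suminf) measurable
  also have "\<dots> \<le> (\<Sum>n. ennreal (?K * (1/2) ^ n))" by (rule suminf_le) (use le in auto)
  also have "\<dots> < \<infinity>"
  proof -
    have "summable (\<lambda>n. ?K * (1/2::real) ^ n)" by (intro summable_mult summable_geometric) simp
    then show ?thesis by (subst suminf_ennreal2) auto
  qed
  finally have "(\<integral>\<^sup>+x. (\<Sum>n. ennreal (?d n x)) \<partial>M) \<noteq> \<infinity>" by simp
  then have "AE x in M. (\<Sum>n. ennreal (?d n x)) \<noteq> \<infinity>" by (intro nn_integral_PInf_AE) measurable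
  then show ?thesis
  proof eventually_elim
    case (elim x)
    then have "summable (\<lambda>n. ?d n x)" by (intro summable_suminf_not_top) auto
    then have "(\<lambda>n. ?d n x) \<longlonglongrightarrow> 0" by (rule summable_LIMSEQ_zero)
    then show ?case by (simp add: tendsto_norm_zero_iff Lim_null[symmetric])
  qed
qed

end

section \<open>Smooth functions\<close>

lemma pd_eq: "(f has_derivative f') (at x) \<Longrightarrow> pd b f x = f' b"
  unfolding pd_def using frechet_derivative_at by metis

lemma has_derivative_pd:
  assumes "f differentiable (at x)"
  shows "(f has_derivative (\<lambda>b. pd b f x)) (at x)"
  using assms unfolding pd_def frechet_derivative_works .

lemma Ck_Suc_imp_Ck: "Ck (Suc n) f \<Longrightarrow> Ck n f"
proof (induction n arbitrary: f)
  case 0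
  then show ?case
    by (auto intro: differentiable_imp_continuous_within simp: continuous_on_eq_continuous_at)
next
  case (Suc n)
  then have "\<forall>x. f differentiable (at x)" "\<And>b. b \<in> Basis \<Longrightarrow> Ck n (pd b f)" by simp_all
  then show ?case by simp
qed

text \<open>\<open>Ck\<close> is stated through \<open>frechet_derivative\<close>; this form lets
  the derivative be supplied explicitly.\<close>

lemma Ck_SucI:
  assumes D: "\<And>x. (f has_derivative f' x) (at x)" and C: "\<And>b. b \<in> Basis \<Longrightarrow> Ck n (\<lambda>x. f' x b)"
  shows "Ck (Suc n) f"
proof -
  have "pd b f = (\<lambda>x. f' x b)" for b using pd_eq[OF D] by auto
  moreover have "f differentiable (at x)" for x using D by (rule differentiableI)
  ultimately show ?thesis using C by simp
qed

lemma Ck_lincomb: "Ck n f \<Longrightarrow> Ck n g \<Longrightarrow> Ck n (\<lambda>x. a * f x + b * g x)"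
proof (induction n arbitrary: f g)
  case 0
  then show ?case by (auto intro!: continuous_intros)
next
  case (Suc n)
  have d: "f differentiable (at x)" "g differentiable (at x)" for x using Suc.prems by simp_all
  have "((\<lambda>x. a * f x + b * g x) has_derivative (\<lambda>c. a * pd c f x + b * pd c g x)) (at x)" for x
    using has_derivative_pd[OF d(1)] has_derivative_pd[OF d(2)] by (auto intro!: derivative_eq_intros)
  then show ?case by (rule Ck_SucI) (use Suc in auto)
qed

lemma Ck_const: "Ck n (\<lambda>x. c)"
proof (induction n arbitrary: c)
  case (Suc n)
  show ?case by (rule Ck_SucI[OF has_derivative_const Suc])
qed simp

lemma Ck_mult: "Ck n f \<Longrightarrow> Ck n g \<Longrightarrow> Ck n (\<lambda>x. f x * g x)"
proof (induction n arbitrary: f g)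
  case 0
  then show ?case by (auto intro!: continuous_intros)
next
  case (Suc n)
  have d: "f differentiable (at x)" "g differentiable (at x)" for x using Suc.prems by simp_all
  \<comment> \<open>The factors 1 give the derivative the shape expected by
    \<open>Ck_lincomb\<close>.\<close>
  have "((\<lambda>x. f x * g x) has_derivative (\<lambda>c. 1 * (f x * pd c g x) + 1 * (pd c f x * g x))) (at x)" for x
    using has_derivative_mult[OF has_derivative_pd[OF d(1)] has_derivative_pd[OF d(2)]] by simp
  moreover have "Ck n (\<lambda>x. 1 * (f x * pd c g x) + 1 * (pd c f x * g x))" if "c \<in> Basis" for c
    using Suc.prems that by (intro Ck_lincomb Suc.IH) (auto intro: Ck_Suc_imp_Ck)
  ultimately show ?case by (rule Ck_SucI)
qed

lemma Ck_prod: "finite A \<Longrightarrow> (\<And>i. i \<in> A \<Longrightarrow> Ck n (f i)) \<Longrightarrow> Ck n (\<lambda>x. \<Prod>i\<in>A. f i x)"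
  by (induction A rule: finite_induct) (auto intro: Ck_const Ck_mult)

text \<open>Affine inner functions are enough, since \<open>bump\<close> is a product of
  one-variable functions of coordinates. Differentiation stays within the family: it yields a
  constant times the derivative of \<open>h\<close> at the same affine argument.\<close>

lemma Ck_affine:
  fixes h :: "real \<Rightarrow> real" and v :: "'a::euclidean_space"
  shows "Ck n h \<Longrightarrow> Ck n (\<lambda>x. h (v \<bullet> x + d))"
proof (induction n arbitrary: h)
  case 0
  then have "continuous_on UNIV h" by simp
  then have "continuous_on UNIV (\<lambda>x. h (v \<bullet> x + d))"
    by (rule continuous_on_compose2) (auto intro!: continuous_intros)
  then show ?case by simp
next
  case (Suc n)
  have d: "h differentiable (at x)" for x using Suc.prems by simp
  have lin: "pd c h y = c * pd 1 h y" for c y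
    using linear_scale[OF has_derivative_linear[OF has_derivative_pd[OF d]], of c 1] by simp
  have "((\<lambda>x. h (v \<bullet> x + d)) has_derivative (\<lambda>c. pd (v \<bullet> c) h (v \<bullet> x + d))) (at x)" for x
    by (rule has_derivative_compose[where f = "\<lambda>x. v \<bullet> x + d", OF _ has_derivative_pd[OF d]])
      (auto intro!: derivative_eq_intros)
  then have "((\<lambda>x. h (v \<bullet> x + d)) has_derivative (\<lambda>c. (v \<bullet> c) * pd 1 h (v \<bullet> x + d) + 0 * 0)) (at x)" for x
    by (simp add: lin[of "v \<bullet> _"])
  moreover have "Ck n (\<lambda>x. (v \<bullet> c) * pd 1 h (v \<bullet> x + d) + 0 * 0)" for c
    using Suc.prems by (intro Ck_lincomb Suc.IH Ck_const) simp
  ultimately show ?case by (rule Ck_SucI)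
qed

text \<open>The family \<open>s\<^sup>-\<^sup>m exp (-1/s)\<close> is closed under differentiation up to linear combinations, which
  makes smoothness of \<open>exp (-1/s)\<close> at \<open>0\<close> an induction.\<close>

definition flat :: "nat \<Rightarrow> real \<Rightarrow> real" where
  "flat m s = (if s \<le> 0 then 0 else (1 / s) ^ m * exp (- (1 / s)))"

text \<open>Follows from \<open>z \<le> exp z\<close> at \<open>z = y / Suc n\<close> by raising
  both sides to the power \<open>Suc n\<close>.\<close>

lemma power_le_exp:
  fixes y :: real
  assumes "0 \<le> y"
  shows "y ^ Suc n \<le> real (Suc n) ^ Suc n * exp y"
proof -
  let ?N = "real (Suc n)"
  have "(y / ?N) ^ Suc n \<le> exp (y / ?N) ^ Suc n"
  proof (rule power_mono)
    show "y / ?N \<le> exp (y / ?N)" using exp_ge_add_one_self[of "y / ?N"] by linarith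
  qed (use assms in simp)
  also have "\<dots> = exp y" by (simp add: exp_of_nat_mult[symmetric] del: of_nat_Suc power_Suc)
  finally have "y ^ Suc n / ?N ^ Suc n \<le> exp y" by (simp add: power_divide)
  then show ?thesis by (simp add: pos_divide_le_eq mult.commute del: power_Suc of_nat_Suc)
qed

text \<open>A quadratic bound is what makes the difference quotient at 0 vanish. It is
  \<open>power_le_exp\<close> with exponent \<open>m + 2\<close>, two of the factors
  \<open>1 / s\<close> being cancelled by \<open>s\<^sup>2\<close>.\<close>

lemma flat_le: "\<exists>C. \<forall>s. \<bar>flat m s\<bar> \<le> C * s\<^sup>2"
proof -
  let ?C = "real (Suc (m + 1)) ^ Suc (m + 1)"
  have "\<bar>flat m s\<bar> \<le> ?C * s\<^sup>2" for s
  proof (cases "s \<le> 0")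
    case False
    then have "(1 / s) ^ Suc (m + 1) \<le> ?C * exp (1 / s)" by (intro power_le_exp) simp
    then have "(1 / s) ^ Suc (m + 1) * exp (- (1 / s)) \<le> ?C * exp (1 / s) * exp (- (1 / s))"
      by (intro mult_right_mono) auto
    also have "\<dots> = ?C" by (simp add: exp_minus field_simps)
    finally have "(1 / s) ^ Suc (m + 1) * exp (- (1 / s)) * s\<^sup>2 \<le> ?C * s\<^sup>2" by (intro mult_right_mono) auto
    moreover have "(1 / s) ^ Suc (m + 1) * exp (- (1 / s)) * s\<^sup>2 = flat m s"
      using False by (simp add: flat_def power2_eq_square)
    moreover have "0 \<le> flat m s" using False by (simp add: flat_def)
    ultimately show ?thesis by simp
  qed (simp add: flat_def)
  then show ?thesis by blast
qed

text \<open>One formula serves all signs of \<open>s\<close> because every \<open>flat\<close>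
  vanishes for \<open>s \<le> 0\<close>. For positive \<open>s\<close>, differentiating the
  exponential adds two factors \<open>1 / s\<close>, differentiating the power adds one.\<close>

lemma flat_DERIV: "(flat m has_real_derivative (flat (m + 2) s - real m * flat (m + 1) s)) (at s)"
proof -
  consider "s < 0" | "s = 0" | "0 < s" by linarith
  then show ?thesis
  proof cases
    case 1
    have "((\<lambda>s. 0) has_real_derivative 0) (at s)" by simp
    then have "(flat m has_real_derivative 0) (at s)"
      by (rule DERIV_cong_ev[THEN iffD1, OF refl _ refl, rotated])
        (use 1 in \<open>auto simp: flat_def eventually_nhds intro!: exI[of _ "{..<0}"]\<close>)
    then show ?thesis using 1 by (simp add: flat_def)
  next
    case 2
    obtain C where C: "\<And>s. \<bar>flat m s\<bar> \<le> C * s\<^sup>2" using flat_le by blast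
    have "((\<lambda>h. (flat m (0 + h) - flat m 0) / h) \<longlongrightarrow> 0) (at 0)"
    proof (rule Lim_null_comparison)
      show "\<forall>\<^sub>F h in at 0. norm ((flat m (0 + h) - flat m 0) / h) \<le> C * \<bar>h\<bar>"
        unfolding eventually_at_filter
      proof (intro always_eventually allI impI)
        fix h :: real assume "h \<noteq> 0"
        then show "norm ((flat m (0 + h) - flat m 0) / h) \<le> C * \<bar>h\<bar>"
          using C[of h] by (simp add: flat_def[of m 0] abs_divide divide_le_eq power2_eq_square mult.assoc)
      qed
      have "((\<lambda>h. C * \<bar>h\<bar>) \<longlongrightarrow> C * \<bar>0\<bar>) (at 0)" by (intro tendsto_intros)
      then show "((\<lambda>h. C * \<bar>h\<bar>) \<longlongrightarrow> 0) (at 0)" by simp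
    qed
    then show ?thesis using 2 by (simp add: DERIV_def flat_def)
  next
    case 3
    have "((\<lambda>s. (1 / s) ^ m * exp (- (1 / s))) has_real_derivative
        (1 / s) ^ m * (exp (- (1 / s)) * (1 / s\<^sup>2)) + real m * (1 / s) ^ (m - 1) * (- (1 / s\<^sup>2)) * exp (- (1 / s))) (at s)"
      using 3 by (auto intro!: derivative_eq_intros simp: power2_eq_square)
    moreover have "(1 / s) ^ m * (exp (- (1 / s)) * (1 / s\<^sup>2)) + real m * (1 / s) ^ (m - 1) * (- (1 / s\<^sup>2)) * exp (- (1 / s))
        = flat (m + 2) s - real m * flat (m + 1) s"
      using 3 by (cases m) (auto simp: flat_def power2_eq_square field_simps)
    ultimately have "((\<lambda>s. (1 / s) ^ m * exp (- (1 / s))) has_real_derivative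
        flat (m + 2) s - real m * flat (m + 1) s) (at s)" by simp
    then show ?thesis
      by (rule DERIV_cong_ev[THEN iffD1, OF refl _ refl, rotated])
        (use 3 in \<open>auto simp: flat_def eventually_nhds intro!: exI[of _ "{0<..}"]\<close>)
  qed
qed

lemma Ck_flat: "Ck n (flat m)"
proof (induction n arbitrary: m)
  case 0
  show ?case using DERIV_isCont[OF flat_DERIV] by (simp add: continuous_on_eq_continuous_at)
next
  case (Suc n)
  have D: "(flat m has_derivative (\<lambda>h. h * (flat (m + 2) s - real m * flat (m + 1) s))) (at s)" for s
    using flat_DERIV[of m s] by (simp add: has_field_derivative_def mult_commute_abs)
  show ?case
    by (rule Ck_SucI[OF D]) (use Ck_lincomb[OF Suc Suc, of 1 "m + 2" "- real m" "m + 1"] in simp)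
qed

text \<open>For each coordinate, one cut-off at either face of the box; the factor \<open>m\<close>
  steepens them, so that the functions tend to the indicator of \<open>box a b\<close>. The
  arguments are written as an inner product plus a constant to match
  \<open>Ck_affine\<close>.\<close>

definition bump :: "'a::euclidean_space \<Rightarrow> 'a \<Rightarrow> nat \<Rightarrow> 'a \<Rightarrow> real" where
  "bump a b m x = (\<Prod>i\<in>Basis. flat 0 ((real m *\<^sub>R i) \<bullet> x + (- real m * (a \<bullet> i))) *
      flat 0 ((- real m *\<^sub>R i) \<bullet> x + real m * (b \<bullet> i)))"

lemma flat_0_bounds: "0 \<le> flat 0 s" "flat 0 s \<le> 1"
  by (auto simp: flat_def)

lemma bump_bounds: "0 \<le> bump a b m x" "bump a b m x \<le> 1"
  unfolding bump_def
  by (auto intro!: prod_nonneg prod_le_1 mult_nonneg_nonneg mult_le_one flat_0_bounds)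

lemma bump_eq_0: "x \<notin> box a b \<Longrightarrow> bump a b m x = 0"
proof -
  assume "x \<notin> box a b"
  then obtain i where i: "i \<in> Basis" "x \<bullet> i \<le> a \<bullet> i \<or> b \<bullet> i \<le> x \<bullet> i" by (auto simp: mem_box)
  have "real m * (i \<bullet> x) \<le> real m * (a \<bullet> i) \<or> real m * (b \<bullet> i) \<le> real m * (i \<bullet> x)"
    using i(2) by (auto intro!: mult_left_mono simp: inner_commute)
  then show ?thesis unfolding bump_def using i(1)
    by (intro prod_zero bexI[of _ i]) (auto simp: flat_def)
qed

lemma bump_tendsto:
  assumes "x \<in> box a b"
  shows "(\<lambda>m. bump a b m x) \<longlonglongrightarrow> 1"
proof -
  have fl: "(\<lambda>m. flat 0 (real m * s)) \<longlonglongrightarrow> 1" if s: "0 < s" for s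
  proof -
    have "(\<lambda>m. 1 / (real m * s)) \<longlonglongrightarrow> 0"
      using tendsto_mult_right[OF lim_1_over_n, of "1 / s"] by simp
    then have "(\<lambda>m. exp (- (1 / (real m * s)))) \<longlonglongrightarrow> exp (- 0)" by (intro tendsto_intros)
    moreover have "\<forall>\<^sub>F m in sequentially. exp (- (1 / (real m * s))) = flat 0 (real m * s)"
      using eventually_gt_at_top[of 0] by eventually_elim (use s in \<open>auto simp: flat_def mult_le_0_iff\<close>)
    ultimately show ?thesis using Lim_transform_eventually by fastforce
  qed
  have "(\<lambda>m. bump a b m x) \<longlonglongrightarrow> (\<Prod>i\<in>(Basis::'a set). 1 * 1)"
    unfolding bump_def
  proof (intro tendsto_prod tendsto_mult)
    fix i :: 'a assume i: "i \<in> Basis"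
    have "real m *\<^sub>R i \<bullet> x + - real m * (a \<bullet> i) = real m * (x \<bullet> i - a \<bullet> i)" for m
      by (simp add: inner_commute algebra_simps)
    then show "(\<lambda>m. flat 0 (real m *\<^sub>R i \<bullet> x + - real m * (a \<bullet> i))) \<longlonglongrightarrow> 1"
      using fl[of "x \<bullet> i - a \<bullet> i"] assms i by (simp add: mem_box)
    have "- real m *\<^sub>R i \<bullet> x + real m * (b \<bullet> i) = real m * (b \<bullet> i - x \<bullet> i)" for m
      by (simp add: inner_commute algebra_simps)
    then show "(\<lambda>m. flat 0 (- real m *\<^sub>R i \<bullet> x + real m * (b \<bullet> i))) \<longlonglongrightarrow> 1"
      using fl[of "b \<bullet> i - x \<bullet> i"] assms i by (simp add: mem_box)
  qed
  then show ?thesis by simp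
qed

text \<open>Any compact superset of the support serves as witness, so that the closure of the
  non-zero set is never computed.\<close>

lemma test_funI:
  assumes "\<And>n. Ck n \<phi>" "\<And>x. x \<notin> K \<Longrightarrow> \<phi> x = 0" "compact K" "K \<subseteq> S"
  shows "\<phi> \<in> test_fun S"
proof -
  have "{x. \<phi> x \<noteq> 0} \<subseteq> K" using assms(2) by auto
  then have cl: "closure {x. \<phi> x \<noteq> 0} \<subseteq> K"
    by (rule closure_minimal) (use assms(3) compact_imp_closed in auto)
  then have "compact (closure {x. \<phi> x \<noteq> 0})" using assms(3)
    by (metis closed_closure compact_Int_closed inf.absorb_iff2)
  then show ?thesis using assms cl by (auto simp: test_fun_def)
qed

lemma test_funE:
  assumes "\<phi> \<in> test_fun S"
  obtains K where "\<And>n. Ck n \<phi>" "\<And>x. x \<notin> K \<Longrightarrow> \<phi> x = 0" "compact K" "K \<subseteq> S"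
proof (rule that)
  show "\<phi> x = 0" if "x \<notin> closure {x. \<phi> x \<noteq> 0}" for x
    using that closure_subset[of "{x. \<phi> x \<noteq> 0}"] by auto
qed (use assms in \<open>auto simp: test_fun_def\<close>)

lemma bump_test_fun: "cbox a b \<subseteq> S \<Longrightarrow> bump a b m \<in> test_fun S"
proof (rule test_funI[of _ "cbox a b"])
  show "Ck n (bump a b m)" for n
  proof -
    have "bump a b m = (\<lambda>x. \<Prod>i\<in>Basis. flat 0 ((real m *\<^sub>R i) \<bullet> x + (- real m * (a \<bullet> i))) *
      flat 0 ((- real m *\<^sub>R i) \<bullet> x + real m * (b \<bullet> i)))" by (rule ext) (rule bump_def)
    then show ?thesis by (simp only:) (intro Ck_prod Ck_mult Ck_affine Ck_flat finite_Basis)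
  qed
  show "bump a b m x = 0" if "x \<notin> cbox a b" for x
    using that box_subset_cbox[of a b] by (intro bump_eq_0) auto
qed auto

section \<open>Closure properties and bounds of test functions\<close>

lemma test_fun_lincomb:
  assumes f: "f \<in> test_fun S" and g: "g \<in> test_fun S"
  shows "(\<lambda>x. a * f x + b * g x) \<in> test_fun S"
proof -
  obtain K where K: "\<And>n. Ck n f" "\<And>x. x \<notin> K \<Longrightarrow> f x = 0" "compact K" "K \<subseteq> S" by (rule test_funE[OF f]) blast
  obtain L where L: "\<And>n. Ck n g" "\<And>x. x \<notin> L \<Longrightarrow> g x = 0" "compact L" "L \<subseteq> S" by (rule test_funE[OF g]) blast
  show ?thesis
    by (rule test_funI[of _ "K \<union> L"]) (use K L in \<open>auto intro: Ck_lincomb\<close>)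
qed

lemma test_fun_pd:
  assumes f: "f \<in> test_fun S" and b: "b \<in> Basis"
  shows "pd b f \<in> test_fun S"
proof -
  obtain K where K: "\<And>n. Ck n f" "\<And>x. x \<notin> K \<Longrightarrow> f x = 0" "compact K" "K \<subseteq> S" by (rule test_funE[OF f]) blast
  show ?thesis
  proof (rule test_funI[OF _ _ K(3,4)])
    show "Ck n (pd b f)" for n using K(1)[of "Suc n"] b by simp
    show "pd b f x = 0" if "x \<notin> K" for x
    proof (rule pd_eq[where f' = "\<lambda>b. 0"])
      have "open (- K)" using K(3) compact_imp_closed by blast
      from has_derivative_transform_within_open[OF has_derivative_const[of 0] this, of x f]
      show "(f has_derivative (\<lambda>b. 0)) (at x)" using K(2) that by auto
    qed
  qed
qed

lemma test_fun_continuous: "f \<in> test_fun S \<Longrightarrow> continuous_on A f"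
  using continuous_on_subset[of UNIV f A] by (auto simp: test_fun_def dest!: spec[of _ 0])

lemma test_fun_bounded:
  assumes f: "f \<in> test_fun S"
  obtains B where "\<And>x. \<bar>f x\<bar> \<le> B"
proof -
  obtain K where K: "\<And>x. x \<notin> K \<Longrightarrow> f x = 0" "compact K" by (rule test_funE[OF f]) blast
  have "bounded (f ` K)"
    using K(2) test_fun_continuous[OF f] by (intro compact_imp_bounded compact_continuous_image)
  then obtain B where B: "\<And>x. x \<in> K \<Longrightarrow> norm (f x) \<le> B" "0 < B"
    unfolding bounded_pos by auto
  show ?thesis
    by (rule that[of B]) (use B K in force)
qed

lemma test_fun_measurable: "f \<in> test_fun S \<Longrightarrow> f \<in> borel_measurable (lebesgue_on A)"
proof -
  assume "f \<in> test_fun S"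
  then have "f \<in> borel_measurable borel"
    by (intro borel_measurable_continuous_onI test_fun_continuous)
  then have "f \<in> borel_measurable lborel" by simp
  then have "f \<in> borel_measurable lebesgue" by (rule measurable_completion)
  then show ?thesis by (rule measurable_restrict_space1)
qed

section \<open>The fundamental lemma of the calculus of variations\<close>

text \<open>Bump functions tend to indicators of boxes, so the integral of \<open>f\<close> over
  every box inside \<open>S\<close> is zero. By Lebesgue's differentiation theorem \<open>f\<close>
  is almost everywhere the limit of such averages.\<close>

theorem fundamental_lemma:
  fixes f :: "'a::euclidean_space \<Rightarrow> real"
  assumes S: "open S" and f: "integrable (lebesgue_on S) f"
    and zero: "\<And>\<phi>. \<phi> \<in> test_fun S \<Longrightarrow> (LINT x|lebesgue_on S. f x * \<phi> x) = 0"
  shows "AE x in lebesgue_on S. f x = 0"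
proof -
  have SL: "S \<in> sets lebesgue" using S by simp
  \<comment> \<open>Extension by zero, so that integrals over arbitrary boxes make sense on the
    whole space.\<close>
  define F where "F x = indicator S x *\<^sub>R f x" for x
  have FI: "integrable lebesgue F"
    using f SL unfolding F_def by (simp add: integrable_restrict_space)
  have [measurable]: "F \<in> borel_measurable lebesgue" using FI by simp
  have Fbox: "F absolutely_integrable_on cbox a b" for a b
    using integrable_mult_indicator[OF _ FI, of "cbox a b"] by (simp add: set_integrable_def)
  then have Fint: "F integrable_on cbox a b" for a b by (rule absolutely_integrable_on_def[THEN iffD1, THEN conjunct1])
  have int0: "integral (cbox a b) F = 0" if sub: "cbox a b \<subseteq> S" for a b
  proof -
    \<comment> \<open>Dominated convergence with bound \<open>\<bar>F x\<bar>\<close>, as bump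
      functions take values in \<open>[0,1]\<close>.\<close>
    have "(\<lambda>m. LINT x|lebesgue. F x * bump a b m x) \<longlonglongrightarrow> (LINT x|lebesgue. indicator (box a b) x *\<^sub>R F x)"
    proof (rule integral_dominated_convergence[where w = "\<lambda>x. \<bar>F x\<bar>"])
      show "integrable lebesgue (\<lambda>x. \<bar>F x\<bar>)" using FI by simp
      show "AE x in lebesgue. (\<lambda>m. F x * bump a b m x) \<longlonglongrightarrow> indicator (box a b) x *\<^sub>R F x"
      proof (rule AE_I2)
        fix x
        show "(\<lambda>m. F x * bump a b m x) \<longlonglongrightarrow> indicator (box a b) x *\<^sub>R F x"
          using tendsto_mult_left[OF bump_tendsto, of x a b "F x"] bump_eq_0[of x a b]
          by (cases "x \<in> box a b") (auto simp: indicator_def)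
      qed
      show "AE x in lebesgue. norm (F x * bump a b m x) \<le> \<bar>F x\<bar>" for m
        using bump_bounds[of a b m] by (auto simp: abs_mult intro!: mult_left_le)
      show "(\<lambda>x. F x * bump a b m x) \<in> borel_measurable lebesgue" for m
        using test_fun_measurable[OF bump_test_fun[OF sub], of m UNIV] by simp
      show "(\<lambda>x. indicator (box a b) x *\<^sub>R F x) \<in> borel_measurable lebesgue"
        using borel_measurable_integrable[OF integrable_mult_indicator[OF _ FI, of "box a b"]] by simp
    qed
    moreover have "(LINT x|lebesgue. F x * bump a b m x) = 0" for m
    proof -
      have "(LINT x|lebesgue. F x * bump a b m x) = (LINT x|lebesgue. indicator S x *\<^sub>R (f x * bump a b m x))"
        by (simp add: F_def mult.assoc)
      also have "\<dots> = (LINT x|lebesgue_on S. f x * bump a b m x)"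
        using SL by (simp add: integral_restrict_space)
      finally show ?thesis using zero[OF bump_test_fun[OF sub]] by simp
    qed
    ultimately have "(LINT x|lebesgue. indicator (box a b) x *\<^sub>R F x) = 0"
      by (simp add: LIMSEQ_const_iff)
    moreover have "set_lebesgue_integral lebesgue (box a b) F = integral (box a b) F"
      by (rule set_lebesgue_integral_eq_integral)
        (use integrable_mult_indicator[OF _ FI, of "box a b"] in \<open>simp add: set_integrable_def\<close>)
    ultimately have "integral (box a b) F = 0" by (simp add: set_lebesgue_integral_def)
    then show ?thesis by (simp add: integral_open_interval)
  qed
  \<comment> \<open>Lebesgue differentiation along cubes with lower corner \<open>x\<close>.\<close>
  obtain N where N: "negligible N"
    and diff: "\<And>x e. x \<notin> N \<Longrightarrow> 0 < e \<Longrightarrow>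
      \<exists>d>0. \<forall>h. 0 < h \<and> h < d \<longrightarrow> norm (integral (cbox x (x + h *\<^sub>R One)) F /\<^sub>R h ^ DIM('a) - F x) < e"
    using integrable_ccontinuous_explicit[of F] Fint by blast
  have F0: "F x = 0" if x: "x \<in> S" "x \<notin> N" for x
  proof (rule ccontr)
    assume "F x \<noteq> 0"
    then have "0 < norm (F x)" by simp
    then obtain d where d: "0 < d"
      and dd: "\<And>h. 0 < h \<Longrightarrow> h < d \<Longrightarrow> norm (integral (cbox x (x + h *\<^sub>R One)) F /\<^sub>R h ^ DIM('a) - F x) < norm (F x)"
      using diff[OF x(2)] by blast
    obtain r where r: "0 < r" "ball x r \<subseteq> S" using S x(1) open_contains_ball by blast
    \<comment> \<open>\<open>d / 2\<close> respects the threshold of the differentiation theorem;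
      the other bound keeps the cube inside the ball, since a point of the cube has l1 distance at
      most \<open>DIM('a)\<close> times the side from the corner.\<close>
    let ?h = "min (d / 2) (r / (2 * DIM('a)))"
    have h: "0 < ?h" "?h < d" using d r by auto
    have "cbox x (x + ?h *\<^sub>R One) \<subseteq> ball x r"
    proof
      fix y assume y: "y \<in> cbox x (x + ?h *\<^sub>R One)"
      have "norm (y - x) \<le> (\<Sum>i\<in>Basis. \<bar>(y - x) \<bullet> i\<bar>)" by (rule norm_le_l1)
      also have "\<dots> \<le> (\<Sum>i\<in>(Basis::'a set). ?h)"
        using y by (intro sum_mono) (auto simp: mem_box inner_diff_left inner_add_left)
      also have "\<dots> = DIM('a) * ?h" by simp
      also have "\<dots> \<le> DIM('a) * (r / (2 * DIM('a)))" by (intro mult_left_mono) auto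
      also have "\<dots> < r" using r by simp
      finally show "y \<in> ball x r" by (simp add: dist_norm norm_minus_commute)
    qed
    then have "integral (cbox x (x + ?h *\<^sub>R One)) F = 0" using r by (intro int0) auto
    then show False using dd[OF h] by simp
  qed
  have "AE x in lebesgue. x \<notin> N" using N AE_not_in negligible_iff_null_sets by blast
  then have "AE x in lebesgue. x \<in> S \<longrightarrow> f x = 0"
    by eventually_elim (use F0 in \<open>auto simp: F_def\<close>)
  then show ?thesis using SL by (simp add: AE_restrict_space_iff)
qed

section \<open>Weak gradients\<close>

lemma test_fun_differentiable: "\<phi> \<in> test_fun S \<Longrightarrow> \<phi> differentiable (at x)"
  by (auto simp: test_fun_def dest!: spec[of _ "Suc 0"])

lemma test_fun_mult:
  assumes f: "f \<in> test_fun S" and g: "g \<in> test_fun S"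
  shows "(\<lambda>x. f x * g x) \<in> test_fun S"
proof -
  obtain K where K: "\<And>n. Ck n f" "\<And>x. x \<notin> K \<Longrightarrow> f x = 0" "compact K" "K \<subseteq> S" by (rule test_funE[OF f]) blast
  have "Ck n g" for n using g by (simp add: test_fun_def)
  then show ?thesis by (intro test_funI[of _ K]) (use K in \<open>auto intro: Ck_mult\<close>)
qed

text \<open>The integral of a difference quotient vanishes by translation invariance.\<close>

lemma integral_pd_test_fun:
  fixes \<phi> :: "'a::euclidean_space \<Rightarrow> real"
  assumes \<phi>: "\<phi> \<in> test_fun S" and S: "open S" and b: "b \<in> Basis"
  shows "(LINT x|lebesgue_on S. pd b \<phi> x) = 0"
proof -
  obtain K where K: "\<And>x. x \<notin> K \<Longrightarrow> \<phi> x = 0" "compact K" "K \<subseteq> S" by (rule test_funE[OF \<phi>]) blast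
  have pd: "pd b \<phi> \<in> test_fun S" by (rule test_fun_pd[OF \<phi> b])
  obtain L where L: "\<And>x. x \<notin> L \<Longrightarrow> pd b \<phi> x = 0" "L \<subseteq> S" by (rule test_funE[OF pd]) blast
  obtain B where B: "\<And>x. \<bar>pd b \<phi> x\<bar> \<le> B" by (rule test_fun_bounded[OF pd]) blast
  obtain R where R: "\<And>x. x \<in> K \<Longrightarrow> norm x \<le> R" using compact_imp_bounded[OF K(2)] by (auto simp: bounded_iff)
  have cont: "continuous_on UNIV \<phi>" "continuous_on UNIV (pd b \<phi>)" using test_fun_continuous \<phi> pd by auto
  then have [measurable]: "\<phi> \<in> borel_measurable borel" "pd b \<phi> \<in> borel_measurable borel"
    by (auto intro: borel_measurable_continuous_onI)
  define h where "h n = 1 / real (Suc n)" for n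
  have h: "0 < h n" "h n \<le> 1" for n by (auto simp: h_def)
  have h0: "h \<longlonglongrightarrow> 0" unfolding h_def by (rule LIMSEQ_Suc[OF lim_1_over_n])
  define q where "q n x = (\<phi> (h n *\<^sub>R b + x) - \<phi> x) / h n" for n x
  have line: "((\<lambda>s. \<phi> (s *\<^sub>R b + x)) has_real_derivative pd b \<phi> (s *\<^sub>R b + x)) (at s)" for s x
  proof -
    have lin: "pd (t *\<^sub>R b) \<phi> y = t * pd b \<phi> y" for t y
      using linear_scale[OF has_derivative_linear[OF has_derivative_pd[OF test_fun_differentiable[OF \<phi>]]]] by simp
    have "((\<lambda>s. \<phi> (s *\<^sub>R b + x)) has_derivative (\<lambda>t. pd (t *\<^sub>R b) \<phi> (s *\<^sub>R b + x))) (at s)"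
      by (rule has_derivative_compose[where f = "\<lambda>s. s *\<^sub>R b + x", OF _ has_derivative_pd[OF test_fun_differentiable[OF \<phi>]]])
        (auto intro!: derivative_eq_intros)
    then show ?thesis unfolding lin has_field_derivative_def by (simp add: mult_commute_abs)
  qed
  \<comment> \<open>The dominating function: inside the ball, the mean value theorem bounds the
    quotient by \<open>B\<close>; outside, both values of \<open>\<phi>\<close> are 0, since the
    shift has length at most 1 and \<open>K\<close> lies within radius \<open>R\<close>.\<close>
  have qB: "norm (q n x) \<le> B * indicator (cball 0 (R + 1)) x" for n x
  proof (cases "x \<in> cball 0 (R + 1)")
    case True
    obtain z where "\<phi> (h n *\<^sub>R b + x) - \<phi> (0 *\<^sub>R b + x) = (h n - 0) * pd b \<phi> (z *\<^sub>R b + x)"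
      using MVT2[OF h(1)[of n] line[of x]] by blast
    then have "q n x = pd b \<phi> (z *\<^sub>R b + x)" using h(1)[of n] by (simp add: q_def)
    then show ?thesis using True B by simp
  next
    case False
    have "x \<notin> K" using False R[of x] by (auto simp: not_le)
    moreover have "h n *\<^sub>R b + x \<notin> K"
    proof
      assume "h n *\<^sub>R b + x \<in> K"
      then have "norm (h n *\<^sub>R b + x) \<le> R" by (rule R)
      moreover have "norm x \<le> norm (h n *\<^sub>R b + x) + norm (h n *\<^sub>R b)"
        using norm_triangle_ineq4[of "h n *\<^sub>R b + x" "h n *\<^sub>R b"] by simp
      moreover have "norm (h n *\<^sub>R b) \<le> 1" using h[of n] b by simp
      ultimately show False using False by simp
    qed
    ultimately show ?thesis using K(1) False by (simp add: q_def)
  qed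
  have "(\<lambda>n. LINT x|lborel. q n x) \<longlonglongrightarrow> (LINT x|lborel. pd b \<phi> x)"
  proof (rule integral_dominated_convergence[where w = "\<lambda>x. B * indicator (cball 0 (R + 1)) x"])
    show "integrable lborel (\<lambda>x::'a. B * indicator (cball 0 (R + 1)) x)"
      using emeasure_bounded_finite[of "cball (0::'a) (R + 1)"]
      by (intro integrable_mult_right integrable_real_indicator) auto
    show "AE x in lborel. (\<lambda>n. q n x) \<longlonglongrightarrow> pd b \<phi> x"
    proof (rule AE_I2)
      fix x
      have "((\<lambda>t. (\<phi> ((0 + t) *\<^sub>R b + x) - \<phi> (0 *\<^sub>R b + x)) / t) \<longlongrightarrow> pd b \<phi> (0 *\<^sub>R b + x)) (at 0)"
        using line[of x 0] unfolding DERIV_def .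
      then have "((\<lambda>t. (\<phi> (t *\<^sub>R b + x) - \<phi> x) / t) \<longlongrightarrow> pd b \<phi> x) (at 0)" by simp
      moreover have "filterlim h (at 0) sequentially"
        unfolding filterlim_at using h0 h(1) by (auto simp: less_imp_neq[THEN not_sym])
      ultimately show "(\<lambda>n. q n x) \<longlonglongrightarrow> pd b \<phi> x" unfolding q_def by (rule filterlim_compose)
    qed
    show "q n \<in> borel_measurable lborel" for n unfolding q_def by measurable
    show "AE x in lborel. norm (q n x) \<le> B * indicator (cball 0 (R + 1)) x" for n using qB by simp
  qed simp
  moreover have "(LINT x|lborel. q n x) = 0" for n
  proof -
    have int: "integrable lborel \<phi>"
    proof -
      have "integrable lborel (\<lambda>x. indicator K x *\<^sub>R \<phi> x)"
        by (rule borel_integrable_compact[OF K(2) test_fun_continuous[OF \<phi>]])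
      moreover have "(\<lambda>x. indicator K x *\<^sub>R \<phi> x) = \<phi>" using K(1) by (auto simp: fun_eq_iff indicator_def)
      ultimately show ?thesis by simp
    qed
    have "integrable (distr lborel borel ((+) (h n *\<^sub>R b))) \<phi>" using int by (simp add: lborel_distr_plus)
    then have int2: "integrable lborel (\<lambda>x. \<phi> (h n *\<^sub>R b + x))" by (subst (asm) integrable_distr_eq) auto
    have "(LINT x|lborel. \<phi> (h n *\<^sub>R b + x)) = (LINT x|distr lborel borel ((+) (h n *\<^sub>R b)). \<phi> x)"
      by (subst integral_distr) auto
    then have "(LINT x|lborel. \<phi> (h n *\<^sub>R b + x)) = (LINT x|lborel. \<phi> x)" by (simp add: lborel_distr_plus)
    then show ?thesis unfolding q_def using int int2 by simp
  qed
  ultimately have "(LINT x|lborel. pd b \<phi> x) = 0" by (simp add: LIMSEQ_const_iff)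
  moreover have "(LINT x|lebesgue_on S. pd b \<phi> x) = (LINT x|lebesgue. indicator S x *\<^sub>R pd b \<phi> x)"
    using S by (simp add: integral_restrict_space)
  moreover have "(\<lambda>x. indicator S x *\<^sub>R pd b \<phi> x) = pd b \<phi>" using L by (auto simp: fun_eq_iff indicator_def)
  moreover have "(LINT x|lebesgue. pd b \<phi> x) = (LINT x|lborel. pd b \<phi> x)"
    by (rule integral_completion) simp
  ultimately show ?thesis by simp
qed

section \<open>Calculus of weak gradients on a bounded domain\<close>

lemma sq_int_scaleR_bounded:
  assumes r: "r \<in> borel_measurable M" "\<And>x. x \<in> space M \<Longrightarrow> \<bar>r x\<bar> \<le> C" and w: "w \<in> sq_int M"
  shows "(\<lambda>x. r x *\<^sub>R w x) \<in> sq_int M"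
proof (rule sq_int_bound[OF _ w, where C = C])
  show "(\<lambda>x. r x *\<^sub>R w x) \<in> borel_measurable M"
    by (intro borel_measurable_scaleR r sq_int_measurable w)
  show "AE x in M. norm (r x *\<^sub>R w x) \<le> C * norm (w x)"
    using r(2) by (intro AE_I2) (simp add: mult_right_mono)
qed

lemma L2_eq: "L2 Om = sq_int (lebesgue_on Om)"
  by (simp add: L2_def sq_int_def)

lemma L2ip_eq: "L2ip Om = ipM (lebesgue_on Om)"
  by (simp add: L2ip_def ipM_def fun_eq_iff)

lemma L2norm_eq: "L2norm Om = nrmM (lebesgue_on Om)"
  by (simp add: L2norm_def sq.nrm_def L2ip_eq fun_eq_iff)

lemma sq_int_nth: "v \<in> sq_int M \<Longrightarrow> (\<lambda>x. v x $ i) \<in> sq_int M"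
proof (rule sq_int_bound[where f = v and C = 1])
  assume v: "v \<in> sq_int M"
  have "(\<lambda>w. w $ i) \<in> borel_measurable borel"
    by (intro borel_measurable_continuous_onI continuous_intros)
  then show "(\<lambda>x. v x $ i) \<in> borel_measurable M"
    by (rule measurable_compose[OF sq_int_measurable[OF v]])
qed (auto intro: Finite_Cartesian_Product.norm_nth_le)

locale bounded_domain =
  fixes Om :: "(real^'n) set"
  assumes open_Om: "open Om" and bounded_Om: "bounded Om"
begin

abbreviation "MO \<equiv> lebesgue_on Om"

lemma finite_MO: "finite_measure MO"
  by (intro finite_measure_lebesgue_on lmeasurable_open open_Om bounded_Om)

sublocale MO: finite_measure MO by (rule finite_MO)

lemma test_fun_sq_int:
  assumes "\<phi> \<in> test_fun S"
  shows "\<phi> \<in> sq_int MO" "(\<lambda>x. \<phi> x *\<^sub>R (c :: 'b::euclidean_space)) \<in> sq_int MO"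
proof -
  obtain B where B: "\<And>x. \<bar>\<phi> x\<bar> \<le> B" by (rule test_fun_bounded[OF assms]) blast
  note [measurable] = test_fun_measurable[OF assms, of Om]
  show "\<phi> \<in> sq_int MO" by (rule MO.sq_int_bounded[where C = B]) (use B in auto)
  then show "(\<lambda>x. \<phi> x *\<^sub>R c) \<in> sq_int MO"
    by (rule sq_int_bound[where C = "norm c", rotated]) (auto simp: mult.commute)
qed

text \<open>With inner products on both sides, linearity, limits and changes on null sets for weak
  gradients reduce to the corresponding facts for \<open>ipM\<close>.\<close>

lemma is_weak_grad_iff:
  "is_weak_grad Om w v \<longleftrightarrow> v \<in> sq_int MO \<and>
     (\<forall>\<phi>\<in>test_fun Om. \<forall>i. ipM MO w (pd (axis i 1) \<phi>) = - ipM MO v (\<lambda>x. \<phi> x *\<^sub>R axis i 1))"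
  unfolding is_weak_grad_def L2_eq ipM_def by (simp add: inner_axis mult.commute)

lemma pd_test_fun: "\<phi> \<in> test_fun Om \<Longrightarrow> pd (axis i 1) \<phi> \<in> test_fun Om"
  by (rule test_fun_pd) (auto simp: axis_in_Basis_iff)

lemma is_weak_grad_sq_int: "is_weak_grad Om w v \<Longrightarrow> v \<in> sq_int MO"
  by (simp add: is_weak_grad_iff)

lemma is_weak_grad_cong_AE:
  assumes "is_weak_grad Om w v" "AE x in MO. w x = w' x" "AE x in MO. v x = v' x"
    and "w \<in> borel_measurable MO" "w' \<in> borel_measurable MO" "v' \<in> borel_measurable MO"
  shows "is_weak_grad Om w' v'"
proof -
  have v: "v \<in> borel_measurable MO" using assms(1) is_weak_grad_sq_int sq_int_measurable by blast
  have "ipM MO w' \<phi> = ipM MO w \<phi>" if "\<phi> \<in> borel_measurable MO" for \<phi>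
    by (rule ipM_cong_AE) (use assms that in auto)
  note w = this
  have v': "ipM MO v' \<phi> = ipM MO v \<phi>" if "\<phi> \<in> borel_measurable MO" for \<phi>
    by (rule ipM_cong_AE) (use assms v that in auto)
  have "ipM MO w' (pd (axis i 1) \<phi>) = - ipM MO v' (\<lambda>x. \<phi> x *\<^sub>R axis i 1)" if \<phi>: "\<phi> \<in> test_fun Om" for \<phi> i
    unfolding w[OF sq_int_measurable[OF test_fun_sq_int(1)[OF pd_test_fun[OF \<phi>]]]]
      v'[OF sq_int_measurable[OF test_fun_sq_int(2)[OF \<phi>]]]
    using assms(1) \<phi> by (simp add: is_weak_grad_iff)
  then show ?thesis
    using sq_int_cong_AE[OF is_weak_grad_sq_int[OF assms(1)] assms(3,6)] by (simp add: is_weak_grad_iff)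
qed

lemma is_weak_grad_lincomb:
  assumes "is_weak_grad Om w v" "is_weak_grad Om w' v'" "w \<in> sq_int MO" "w' \<in> sq_int MO"
  shows "is_weak_grad Om (\<lambda>x. a * w x + b * w' x) (\<lambda>x. a *\<^sub>R v x + b *\<^sub>R v' x)"
proof -
  have v: "v \<in> sq_int MO" "v' \<in> sq_int MO" using assms is_weak_grad_sq_int by auto
  have "ipM MO (\<lambda>x. a * w x + b * w' x) (pd (axis i 1) \<phi>) =
      - ipM MO (\<lambda>x. a *\<^sub>R v x + b *\<^sub>R v' x) (\<lambda>x. \<phi> x *\<^sub>R axis i 1)" if \<phi>: "\<phi> \<in> test_fun Om" for \<phi> i
    using assms(1,2) \<phi> sq.ip_lincomb[OF assms(3,4) test_fun_sq_int(1)[OF pd_test_fun[OF \<phi>]], of a b i]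
      sq.ip_lincomb[OF v test_fun_sq_int(2)[OF \<phi>], of a b "axis i 1"]
    by (simp add: is_weak_grad_iff)
  then show ?thesis using sq_int_lincomb[OF v] by (simp add: is_weak_grad_iff)
qed

lemma is_weak_grad_zero: "is_weak_grad Om (\<lambda>x. 0) (\<lambda>x. 0)"
  unfolding is_weak_grad_iff using sq.zero_mem by (simp add: ipM_def)

text \<open>Each component of the difference is orthogonal to all test functions, so the fundamental
  lemma applies.\<close>

lemma is_weak_grad_unique:
  assumes "is_weak_grad Om w v" "is_weak_grad Om w v'"
  shows "AE x in MO. v x = v' x"
proof -
  have v: "v \<in> sq_int MO" "v' \<in> sq_int MO" using assms is_weak_grad_sq_int by auto
  have "AE x in MO. v x $ i - v' x $ i = 0" for i
  proof (rule fundamental_lemma[OF open_Om])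
    show "integrable MO (\<lambda>x. v x $ i - v' x $ i)"
      using MO.sq_int_imp_integrable[OF sq_int_nth[OF v(1)]] MO.sq_int_imp_integrable[OF sq_int_nth[OF v(2)]] by simp
    show "(LINT x|MO. (v x $ i - v' x $ i) * \<phi> x) = 0" if \<phi>: "\<phi> \<in> test_fun Om" for \<phi>
    proof -
      have "ipM MO (\<lambda>x. v x - v' x) (\<lambda>x. \<phi> x *\<^sub>R axis i 1) = 0"
        using assms \<phi> sq.ip_diff[OF v test_fun_sq_int(2)[OF \<phi>], of "axis i 1"] by (simp add: is_weak_grad_iff)
      then show ?thesis by (simp add: ipM_def inner_axis mult.commute)
    qed
  qed
  then have "AE x in MO. \<forall>i\<in>UNIV. v x $ i - v' x $ i = 0" by (intro AE_finite_allI) auto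
  then show ?thesis by eventually_elim (simp add: vec_eq_iff)
qed

text \<open>For a fixed test function both sides of the defining identity are continuous in
  \<open>L2\<close>. This closedness is the core of the completeness of \<open>H1\<close>.\<close>

lemma is_weak_grad_limit:
  assumes g: "\<And>n. is_weak_grad Om (X n) (V n)" and X: "\<And>n. X n \<in> sq_int MO" "w \<in> sq_int MO" and v: "v \<in> sq_int MO"
    and lim: "(\<lambda>n. nrmM MO (\<lambda>x. X n x - w x)) \<longlonglongrightarrow> 0" "(\<lambda>n. nrmM MO (\<lambda>x. V n x - v x)) \<longlonglongrightarrow> 0"
  shows "is_weak_grad Om w v"
proof -
  have "ipM MO w (pd (axis i 1) \<phi>) = - ipM MO v (\<lambda>x. \<phi> x *\<^sub>R axis i 1)" if \<phi>: "\<phi> \<in> test_fun Om" for \<phi> i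
  proof (rule LIMSEQ_unique)
    show "(\<lambda>n. ipM MO (X n) (pd (axis i 1) \<phi>)) \<longlonglongrightarrow> ipM MO w (pd (axis i 1) \<phi>)"
      by (intro sq.tendsto_ip lim X v test_fun_sq_int(1)[OF pd_test_fun] \<phi> always_eventually allI)
    have "(\<lambda>n. - ipM MO (V n) (\<lambda>x. \<phi> x *\<^sub>R axis i 1)) \<longlonglongrightarrow> - ipM MO v (\<lambda>x. \<phi> x *\<^sub>R axis i 1)"
      by (intro tendsto_minus sq.tendsto_ip lim X v test_fun_sq_int(2)[OF \<phi>] always_eventually allI is_weak_grad_sq_int[OF g])
    then show "(\<lambda>n. ipM MO (X n) (pd (axis i 1) \<phi>)) \<longlonglongrightarrow> - ipM MO v (\<lambda>x. \<phi> x *\<^sub>R axis i 1)"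
      using g \<phi> by (simp add: is_weak_grad_iff)
  qed
  then show ?thesis using v by (simp add: is_weak_grad_iff)
qed

section \<open>The Sobolev spaces\<close>

lemma H1_iff: "w \<in> H1 Om \<longleftrightarrow> w \<in> sq_int MO \<and> (\<exists>v. is_weak_grad Om w v)"
  by (auto simp: H1_def L2_eq)

lemma H1_sq_int: "w \<in> H1 Om \<Longrightarrow> w \<in> sq_int MO"
  by (simp add: H1_iff)

lemma wgrad_weak_grad: "w \<in> H1 Om \<Longrightarrow> is_weak_grad Om w (wgrad Om w)"
  unfolding H1_iff wgrad_def using someI_ex[of "is_weak_grad Om w"] by auto

lemma wgrad_sq_int: "w \<in> H1 Om \<Longrightarrow> wgrad Om w \<in> sq_int MO"
  using wgrad_weak_grad is_weak_grad_sq_int by blast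

lemma is_weak_grad_wgrad: "is_weak_grad Om w v \<Longrightarrow> is_weak_grad Om w (wgrad Om w)"
  unfolding wgrad_def by (rule someI[of "is_weak_grad Om w"])

lemma wgrad_AE_eq:
  assumes "is_weak_grad Om w v"
  shows "AE x in MO. wgrad Om w x = v x"
  by (rule is_weak_grad_unique[OF is_weak_grad_wgrad assms]) (rule assms)

text \<open>The gradients are equal as functions, not only almost everywhere: both are
  \<open>SOME\<close> applied to the same predicate.\<close>

lemma wgrad_cong_AE:
  assumes "AE x in MO. w x = w' x" "w \<in> borel_measurable MO" "w' \<in> borel_measurable MO"
  shows "wgrad Om w = wgrad Om w'"
proof -
  have e: "AE x in MO. w' x = w x" using assms(1) by eventually_elim simp
  have "is_weak_grad Om w v \<longleftrightarrow> is_weak_grad Om w' v" for v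
    using is_weak_grad_cong_AE[of w v w' v] is_weak_grad_cong_AE[of w' v w v] assms e
      is_weak_grad_sq_int[of w v] is_weak_grad_sq_int[of w' v] sq_int_measurable[of v MO] by auto
  then show ?thesis by (simp add: wgrad_def)
qed

lemma H1_lincomb: "v \<in> H1 Om \<Longrightarrow> w \<in> H1 Om \<Longrightarrow> (\<lambda>x. a * v x + b * w x) \<in> H1 Om"
  unfolding H1_iff[of "\<lambda>x. a * v x + b * w x"]
  using is_weak_grad_lincomb[OF wgrad_weak_grad wgrad_weak_grad H1_sq_int H1_sq_int, of v w a b]
    sq_int_lincomb[OF H1_sq_int H1_sq_int, of v w a b]
  unfolding real_scaleR_def by blast

lemma wgrad_lincomb: "v \<in> H1 Om \<Longrightarrow> w \<in> H1 Om \<Longrightarrow>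
    AE x in MO. wgrad Om (\<lambda>x. a * v x + b * w x) x = a *\<^sub>R wgrad Om v x + b *\<^sub>R wgrad Om w x"
  by (intro wgrad_AE_eq is_weak_grad_lincomb wgrad_weak_grad H1_sq_int)

text \<open>The product \<open>\<phi> * \<psi>\<close> is again a test function, so its partial
  derivatives have integral 0; the product rule then moves the derivative from one factor to the
  other.\<close>

lemma test_fun_weak_grad:
  assumes \<phi>: "\<phi> \<in> test_fun Om"
  shows "is_weak_grad Om \<phi> (\<lambda>x. \<chi> i. pd (axis i 1) \<phi> x)"
proof -
  let ?v = "\<lambda>x. \<chi> i. pd (axis i 1) \<phi> x"
  \<comment> \<open>Square integrability is shown for the expansion in unit vectors, where each
    summand is a test function times a constant vector.\<close>
  have "(\<lambda>x. \<Sum>i\<in>UNIV. pd (axis i 1) \<phi> x *\<^sub>R axis i (1::real)) \<in> sq_int MO"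
  proof -
    have "(\<lambda>x. \<Sum>i\<in>A. pd (axis i 1) \<phi> x *\<^sub>R axis i (1::real)) \<in> sq_int MO" if "finite A" for A :: "'n set"
      using that
    proof (induction A rule: finite_induct)
      case empty
      show ?case using sq.zero_mem by simp
    next
      case (insert i A)
      then show ?case using sq.add_mem[OF test_fun_sq_int(2)[OF pd_test_fun[OF \<phi>]] insert.IH] by simp
    qed
    then show ?thesis by simp
  qed
  moreover have "(\<lambda>x. \<Sum>i\<in>UNIV. pd (axis i 1) \<phi> x *\<^sub>R axis i (1::real)) = ?v"
    by (simp add: fun_eq_iff vec_eq_iff axis_def if_distrib[of "\<lambda>c. _ * c"] cong: if_cong)
  ultimately have v: "?v \<in> sq_int MO" by simp
  have "(LINT x|MO. \<phi> x * pd (axis i 1) \<psi> x) = - (LINT x|MO. pd (axis i 1) \<phi> x * \<psi> x)"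
    if \<psi>: "\<psi> \<in> test_fun Om" for \<psi> i
  proof -
    have "pd (axis i 1) (\<lambda>x. \<phi> x * \<psi> x) = (\<lambda>x. \<phi> x * pd (axis i 1) \<psi> x + pd (axis i 1) \<phi> x * \<psi> x)"
      by (rule ext, rule pd_eq, rule has_derivative_mult[OF has_derivative_pd has_derivative_pd];
          rule test_fun_differentiable, rule \<phi> \<psi>)
    moreover have "(LINT x|MO. pd (axis i 1) (\<lambda>x. \<phi> x * \<psi> x) x) = 0"
      using open_Om by (intro integral_pd_test_fun test_fun_mult \<phi> \<psi>) (auto simp: axis_in_Basis_iff)
    moreover have "integrable MO (\<lambda>x. \<phi> x * pd (axis i 1) \<psi> x)" "integrable MO (\<lambda>x. pd (axis i 1) \<phi> x * \<psi> x)"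
      using integrable_inner[OF test_fun_sq_int(1)[OF \<phi>] test_fun_sq_int(1)[OF pd_test_fun[OF \<psi>, of i]]]
        integrable_inner[OF test_fun_sq_int(1)[OF pd_test_fun[OF \<phi>, of i]] test_fun_sq_int(1)[OF \<psi>]] by simp_all
    ultimately show ?thesis by simp
  qed
  then show ?thesis using v unfolding is_weak_grad_def L2_eq by simp
qed

lemma test_fun_H1: "\<phi> \<in> test_fun Om \<Longrightarrow> \<phi> \<in> H1 Om"
  using test_fun_weak_grad test_fun_sq_int(1) unfolding H1_iff by blast

end

section \<open>Weighted inner products on H1: coercivity, completeness, Hilbert space
  structure\<close>

locale weighted_domain = bounded_domain Om for Om :: "(real^'n) set" +
  fixes r0 r1 :: "real^'n \<Rightarrow> real" and r0l r0u r1l r1u :: real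
  assumes r0_meas: "r0 \<in> borel_measurable (lebesgue_on Om)" and r0_pos: "0 < r0l"
    and r0_bounds: "\<And>x. x \<in> Om \<Longrightarrow> r0l \<le> r0 x \<and> r0 x \<le> r0u"
    and r1_meas: "r1 \<in> borel_measurable (lebesgue_on Om)" and r1_pos: "0 < r1l"
    and r1_bounds: "\<And>x. x \<in> Om \<Longrightarrow> r1l \<le> r1 x \<and> r1 x \<le> r1u"
begin

lemma r0_mult: "w \<in> sq_int MO \<Longrightarrow> (\<lambda>x. r0 x *\<^sub>R w x) \<in> sq_int MO"
  by (rule sq_int_scaleR_bounded[where C = r0u])
    (use r0_meas r0_bounds r0_pos in \<open>force simp: abs_le_iff\<close>)+

lemma r1_mult: "w \<in> sq_int MO \<Longrightarrow> (\<lambda>x. r1 x *\<^sub>R w x) \<in> sq_int MO"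
  by (rule sq_int_scaleR_bounded[where C = r1u])
    (use r1_meas r1_bounds r1_pos in \<open>force simp: abs_le_iff\<close>)+

lemma H1ip_eq: "H1ip Om r0 r1 w z =
    ipM MO (\<lambda>x. r0 x *\<^sub>R w x) z + ipM MO (\<lambda>x. r1 x *\<^sub>R wgrad Om w x) (wgrad Om z)"
  by (simp add: H1ip_def L2ip_eq)

lemma H1ip_self_ge:
  assumes w: "w \<in> H1 Om"
  shows "r0l * (nrmM MO w)\<^sup>2 + r1l * (nrmM MO (wgrad Om w))\<^sup>2 \<le> H1ip Om r0 r1 w w"
proof -
  have *: "l * (nrmM MO f)\<^sup>2 \<le> ipM MO (\<lambda>x. r x *\<^sub>R f x) f"
    if f: "f \<in> sq_int MO" "(\<lambda>x. r x *\<^sub>R f x) \<in> sq_int MO" and r: "\<And>x. x \<in> Om \<Longrightarrow> l \<le> r x"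
    for f :: "real^'n \<Rightarrow> 'b::euclidean_space" and r l
  proof -
    have "ipM MO (\<lambda>x. l *\<^sub>R f x) f \<le> ipM MO (\<lambda>x. r x *\<^sub>R f x) f"
      unfolding ipM_def
      by (rule integral_mono)
        (use integrable_inner[OF f(2,1)] integrable_inner[OF f(1,1)] r in \<open>auto intro!: mult_right_mono\<close>)
    then show ?thesis by (simp add: sq.nrm_square[OF f(1)] ipM_def)
  qed
  show ?thesis unfolding H1ip_eq
    by (intro add_mono * r0_mult r1_mult H1_sq_int wgrad_sq_int w) (use r0_bounds r1_bounds in auto)
qed

sublocale H1: semi_inner_space "H1 Om" "H1ip Om r0 r1"
proof
  show "(\<lambda>x. 0) \<in> H1 Om" using is_weak_grad_zero sq.zero_mem by (auto simp: H1_iff)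
  fix v w z :: "real^'n \<Rightarrow> real" and a b :: real
  show "(\<lambda>x. a *\<^sub>R v x + b *\<^sub>R w x) \<in> H1 Om" if "v \<in> H1 Om" "w \<in> H1 Om"
    using H1_lincomb[OF that] by simp
  show "H1ip Om r0 r1 v w = H1ip Om r0 r1 w v"
    unfolding H1ip_def L2ip_def by (simp add: inner_commute mult_ac)
  show "0 \<le> H1ip Om r0 r1 w w" if "w \<in> H1 Om"
    using H1ip_self_ge[OF that] r0_pos r1_pos
    by (smt (verit) mult_nonneg_nonneg zero_le_power2)
  show "H1ip Om r0 r1 (\<lambda>x. a *\<^sub>R v x + b *\<^sub>R w x) z = a * H1ip Om r0 r1 v z + b * H1ip Om r0 r1 w z"
    if H: "v \<in> H1 Om" "w \<in> H1 Om" "z \<in> H1 Om"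
  proof -
    have "ipM MO (\<lambda>x. r0 x *\<^sub>R (a *\<^sub>R v x + b *\<^sub>R w x)) z =
        ipM MO (\<lambda>x. a *\<^sub>R (r0 x *\<^sub>R v x) + b *\<^sub>R (r0 x *\<^sub>R w x)) z"
      by (simp add: algebra_simps)
    also have "\<dots> = a * ipM MO (\<lambda>x. r0 x *\<^sub>R v x) z + b * ipM MO (\<lambda>x. r0 x *\<^sub>R w x) z"
      by (intro sq.ip_lincomb r0_mult H1_sq_int H)
    finally have 1: "ipM MO (\<lambda>x. r0 x *\<^sub>R (a *\<^sub>R v x + b *\<^sub>R w x)) z = \<dots>" .
    have L: "(\<lambda>x. a *\<^sub>R v x + b *\<^sub>R w x) \<in> H1 Om" using H1_lincomb[OF H(1,2)] by simp
    have "ipM MO (\<lambda>x. r1 x *\<^sub>R wgrad Om (\<lambda>x. a *\<^sub>R v x + b *\<^sub>R w x) x) (wgrad Om z) =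
        ipM MO (\<lambda>x. a *\<^sub>R (r1 x *\<^sub>R wgrad Om v x) + b *\<^sub>R (r1 x *\<^sub>R wgrad Om w x)) (wgrad Om z)"
    proof (rule ipM_cong_AE)
      show "AE x in MO. r1 x *\<^sub>R wgrad Om (\<lambda>x. a *\<^sub>R v x + b *\<^sub>R w x) x =
          a *\<^sub>R (r1 x *\<^sub>R wgrad Om v x) + b *\<^sub>R (r1 x *\<^sub>R wgrad Om w x)"
        using wgrad_lincomb[OF H(1,2), of a b] by eventually_elim (simp add: algebra_simps)
    qed (rule AE_I2, rule refl, (intro sq_int_measurable sq_int_lincomb r1_mult wgrad_sq_int H L)+)
    also have "\<dots> = a * ipM MO (\<lambda>x. r1 x *\<^sub>R wgrad Om v x) (wgrad Om z) + b * ipM MO (\<lambda>x. r1 x *\<^sub>R wgrad Om w x) (wgrad Om z)"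
      by (intro sq.ip_lincomb r1_mult wgrad_sq_int H)
    finally show ?thesis unfolding H1ip_eq 1 by (simp add: algebra_simps)
  qed
qed

lemma nrmM_le_H1_nrm:
  assumes w: "w \<in> H1 Om"
  shows "nrmM MO w \<le> 1 / sqrt r0l * H1.nrm w" "nrmM MO (wgrad Om w) \<le> 1 / sqrt r1l * H1.nrm w"
proof -
  have "sqrt r0l * nrmM MO w \<le> H1.nrm w"
  proof (rule power2_le_imp_le[OF _ H1.nrm_nonneg[OF w]])
    have "(sqrt r0l * nrmM MO w)\<^sup>2 = r0l * (nrmM MO w)\<^sup>2" using r0_pos by (simp add: power_mult_distrib)
    also have "\<dots> \<le> H1ip Om r0 r1 w w" using H1ip_self_ge[OF w] r1_pos
      by (smt (verit) mult_nonneg_nonneg zero_le_power2)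
    finally show "(sqrt r0l * nrmM MO w)\<^sup>2 \<le> (H1.nrm w)\<^sup>2" by (simp add: H1.nrm_square[OF w])
  qed
  then show "nrmM MO w \<le> 1 / sqrt r0l * H1.nrm w" using r0_pos by (simp add: field_simps)
  have "sqrt r1l * nrmM MO (wgrad Om w) \<le> H1.nrm w"
  proof (rule power2_le_imp_le[OF _ H1.nrm_nonneg[OF w]])
    have "(sqrt r1l * nrmM MO (wgrad Om w))\<^sup>2 = r1l * (nrmM MO (wgrad Om w))\<^sup>2" using r1_pos by (simp add: power_mult_distrib)
    also have "\<dots> \<le> H1ip Om r0 r1 w w" using H1ip_self_ge[OF w] r0_pos
      by (smt (verit) mult_nonneg_nonneg zero_le_power2)
    finally show "(sqrt r1l * nrmM MO (wgrad Om w))\<^sup>2 \<le> (H1.nrm w)\<^sup>2" by (simp add: H1.nrm_square[OF w])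
  qed
  then show "nrmM MO (wgrad Om w) \<le> 1 / sqrt r1l * H1.nrm w" using r1_pos by (simp add: field_simps)
qed

end

lemma nrmM_power2: "(nrmM M f)\<^sup>2 = ipM M f f"
  by (simp add: sq.nrm_def ipM_def)

context weighted_domain
begin

lemma H1ip_self_le:
  assumes w: "w \<in> H1 Om"
  shows "H1ip Om r0 r1 w w \<le> r0u * (nrmM MO w)\<^sup>2 + r1u * (nrmM MO (wgrad Om w))\<^sup>2"
proof -
  have *: "ipM MO (\<lambda>x. r x *\<^sub>R f x) f \<le> l * (nrmM MO f)\<^sup>2"
    if f: "f \<in> sq_int MO" "(\<lambda>x. r x *\<^sub>R f x) \<in> sq_int MO" and r: "\<And>x. x \<in> Om \<Longrightarrow> r x \<le> l"
    for f :: "real^'n \<Rightarrow> 'b::euclidean_space" and r l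
  proof -
    have "ipM MO (\<lambda>x. r x *\<^sub>R f x) f \<le> ipM MO (\<lambda>x. l *\<^sub>R f x) f"
      unfolding ipM_def
      by (rule integral_mono)
        (use integrable_inner[OF f(2,1)] integrable_inner[OF f(1,1)] r in \<open>auto intro!: mult_right_mono\<close>)
    then show ?thesis by (simp add: sq.nrm_square[OF f(1)] ipM_def)
  qed
  show ?thesis unfolding H1ip_eq
    by (intro add_mono * r0_mult r1_mult H1_sq_int wgrad_sq_int w) (use r0_bounds r1_bounds in auto)
qed

text \<open>Functions and gradients are Cauchy in \<open>L2\<close> separately. Closedness
  identifies the second limit as the gradient of the first, and the upper bounds on the weights
  bring convergence back to the weighted norm.\<close>

theorem H1_complete:
  assumes X: "\<And>n. X n \<in> H1 Om"
    and Cauchy: "\<forall>e>0. \<exists>N. \<forall>m\<ge>N. \<forall>n\<ge>N. H1.nrm (\<lambda>x. X m x - X n x) < e"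
  shows "\<exists>w\<in>H1 Om. (\<lambda>n::nat. H1.nrm (\<lambda>x. X n x - w x)) \<longlonglongrightarrow> 0"
proof -
  \<comment> \<open>Transfers the Cauchy property to any distance dominated by the weighted norm;
    used for the functions and for their gradients.\<close>
  have tr: "\<forall>e>0. \<exists>N. \<forall>m\<ge>N. \<forall>n\<ge>N. D m n < e"
    if D: "\<And>m n. D m n \<le> c * H1.nrm (\<lambda>x. X m x - X n x)" and c: "0 < c" for D :: "nat \<Rightarrow> nat \<Rightarrow> real" and c
  proof (intro allI impI)
    fix e :: real assume "0 < e"
    then have "0 < e / c" using c by simp
    then obtain N where N: "\<And>m n. m \<ge> N \<Longrightarrow> n \<ge> N \<Longrightarrow> H1.nrm (\<lambda>x. X m x - X n x) < e / c" using Cauchy by blast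
    have "D m n < e" if "m \<ge> N" "n \<ge> N" for m n
      using D[of m n] N[OF that] c by (simp add: pos_less_divide_eq mult.commute)
    then show "\<exists>N. \<forall>m\<ge>N. \<forall>n\<ge>N. D m n < e" by blast
  qed
  have XX: "(\<lambda>x. X m x - X n x) \<in> H1 Om" for m n by (rule H1.diff_mem[OF X X])
  have gd: "AE x in MO. wgrad Om (\<lambda>x. v x - w x) x = wgrad Om v x - wgrad Om w x"
    if "v \<in> H1 Om" "w \<in> H1 Om" for v w
    using wgrad_lincomb[OF that, of 1 "-1"] by simp
  have "\<forall>e>0. \<exists>N. \<forall>m\<ge>N. \<forall>n\<ge>N. nrmM MO (\<lambda>x. X m x - X n x) < e"
    by (rule tr[OF nrmM_le_H1_nrm(1)[OF XX]]) (use r0_pos in simp)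
  from MO.sq_int_complete[OF H1_sq_int[OF X] this]
  obtain w where w: "w \<in> sq_int MO" "(\<lambda>n. nrmM MO (\<lambda>x. X n x - w x)) \<longlonglongrightarrow> 0" by blast
  have g: "nrmM MO (\<lambda>x. wgrad Om (X m) x - wgrad Om (X n) x) = nrmM MO (wgrad Om (\<lambda>x. X m x - X n x))" for m n
    by (rule nrmM_cong_AE[symmetric, OF gd[OF X X]])
      (intro sq_int_measurable wgrad_sq_int XX sq.diff_mem X)+
  have "\<forall>e>0. \<exists>N. \<forall>m\<ge>N. \<forall>n\<ge>N. nrmM MO (\<lambda>x. wgrad Om (X m) x - wgrad Om (X n) x) < e"
    unfolding g by (rule tr[OF nrmM_le_H1_nrm(2)[OF XX]]) (use r1_pos in simp)
  from MO.sq_int_complete[OF wgrad_sq_int[OF X] this]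
  obtain v where v: "v \<in> sq_int MO" "(\<lambda>n. nrmM MO (\<lambda>x. wgrad Om (X n) x - v x)) \<longlonglongrightarrow> 0" by blast
  have wv: "is_weak_grad Om w v"
    by (rule is_weak_grad_limit[OF wgrad_weak_grad[OF X] H1_sq_int[OF X] w(1) v(1) w(2) v(2)])
  then have wH: "w \<in> H1 Om" using w(1) by (auto simp: H1_iff)
  have "(\<lambda>n. H1.nrm (\<lambda>x. X n x - w x)) \<longlonglongrightarrow> 0"
  proof (rule tendsto_sandwich[OF _ _ tendsto_const])
    let ?u = "\<lambda>n. sqrt (r0u * (nrmM MO (\<lambda>x. X n x - w x))\<^sup>2 + r1u * (nrmM MO (\<lambda>x. wgrad Om (X n) x - v x))\<^sup>2)"
    have "?u \<longlonglongrightarrow> sqrt (r0u * 0\<^sup>2 + r1u * 0\<^sup>2)" by (intro tendsto_intros w v)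
    then show "?u \<longlonglongrightarrow> 0" by simp
    have "H1.nrm (\<lambda>x. X n x - w x) \<le> ?u n" for n
    proof -
      have D: "(\<lambda>x. X n x - w x) \<in> H1 Om" by (rule H1.diff_mem[OF X wH])
      have "AE x in MO. wgrad Om (\<lambda>x. X n x - w x) x = wgrad Om (X n) x - v x"
        using gd[OF X wH, of n] wgrad_AE_eq[OF wv] by eventually_elim simp
      then have "nrmM MO (wgrad Om (\<lambda>x. X n x - w x)) = nrmM MO (\<lambda>x. wgrad Om (X n) x - v x)"
        by (rule nrmM_cong_AE) (intro sq_int_measurable wgrad_sq_int D sq.diff_mem X v)+
      then show ?thesis unfolding H1.nrm_def using H1ip_self_le[OF D] by simp
    qed
    then show "\<forall>\<^sub>F n in sequentially. H1.nrm (\<lambda>x. X n x - w x) \<le> ?u n" by simp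
    show "\<forall>\<^sub>F n in sequentially. 0 \<le> H1.nrm (\<lambda>x. X n x - w x)"
      by (intro always_eventually allI H1.nrm_nonneg H1.diff_mem X wH)
  qed
  then show ?thesis using wH by blast
qed

lemma hilbert_H1: "hilbert_in_L2 Om (H1 Om) (H1ip Om r0 r1)"
  unfolding hilbert_in_L2_def
proof (intro conjI ballI allI impI)
  show "H1 Om \<subseteq> L2 Om" by (auto simp: H1_def)
  show "(\<lambda>x. 0) \<in> H1 Om" by (rule H1.zero_mem)
  show "(\<lambda>x. a * v x + b * w x) \<in> H1 Om" if "v \<in> H1 Om" "w \<in> H1 Om" for v w a b
    using that by (rule H1_lincomb)
  show "H1ip Om r0 r1 v w = H1ip Om r0 r1 w v" if "v \<in> H1 Om" "w \<in> H1 Om" for v w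
    using that by (rule H1.ip_sym)
  show "H1ip Om r0 r1 (\<lambda>x. a * v x + b * w x) z = a * H1ip Om r0 r1 v z + b * H1ip Om r0 r1 w z"
    if "v \<in> H1 Om" "w \<in> H1 Om" "z \<in> H1 Om" for v w z a b
    using H1.ip_lincomb[OF that] by simp
  show "0 \<le> H1ip Om r0 r1 w w" if "w \<in> H1 Om" for w using that by (rule H1.ip_nonneg)
  show "H1ip Om r0 r1 w w = 0 \<longleftrightarrow> (AE x in MO. w x = 0)" if w: "w \<in> H1 Om" for w
  proof
    assume "H1ip Om r0 r1 w w = 0"
    then have "nrmM MO w \<le> 0" using nrmM_le_H1_nrm(1)[OF w] by (simp add: H1.nrm_def)
    then show "AE x in MO. w x = 0" using sq.nrm_nonneg[OF H1_sq_int[OF w]] nrmM_eq_0_iff[OF H1_sq_int[OF w]] by simp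
  next
    assume z: "AE x in MO. w x = 0"
    \<comment> \<open>The gradient part of the norm must vanish too: \<open>w\<close> has the same
      chosen gradient as the zero function, and that gradient is null.\<close>
    have "wgrad Om w = wgrad Om (\<lambda>x. 0)" by (rule wgrad_cong_AE[OF z]) (use sq_int_measurable[OF H1_sq_int[OF w]] in auto)
    then have "AE x in MO. wgrad Om w x = 0" using wgrad_AE_eq[OF is_weak_grad_zero] by simp
    then have "nrmM MO (wgrad Om w) = 0" using nrmM_eq_0_iff[OF wgrad_sq_int[OF w]] by simp
    moreover have "nrmM MO w = 0" using z nrmM_eq_0_iff[OF H1_sq_int[OF w]] by simp
    ultimately have "H1ip Om r0 r1 w w \<le> 0" using H1ip_self_le[OF w] by simp
    then show "H1ip Om r0 r1 w w = 0" using H1.ip_nonneg[OF w] by simp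
  qed
  show "\<exists>w\<in>H1 Om. (\<lambda>n. sqrt (H1ip Om r0 r1 (\<lambda>x. X n x - w x) (\<lambda>x. X n x - w x))) \<longlonglongrightarrow> 0"
    if "(\<forall>n. X n \<in> H1 Om) \<and> (\<forall>e>0. \<exists>N. \<forall>m\<ge>N. \<forall>n\<ge>N.
      sqrt (H1ip Om r0 r1 (\<lambda>x. X m x - X n x) (\<lambda>x. X m x - X n x)) < e)" for X :: "nat \<Rightarrow> _"
    using H1_complete[of X] that unfolding H1.nrm_def by blast
  show "\<exists>C. \<forall>w\<in>H1 Om. L2norm Om w \<le> C * sqrt (H1ip Om r0 r1 w w)"
    using nrmM_le_H1_nrm(1) unfolding H1.nrm_def L2norm_eq by blast
qed

end

context bounded_domain
begin

lemma hilbert_L2: "hilbert_in_L2 Om (L2 Om) (L2ip Om)"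
  unfolding hilbert_in_L2_def L2_eq L2ip_eq L2norm_eq
proof (intro conjI ballI allI impI)
  show "(\<lambda>x. a * v x + b * w x) \<in> sq_int MO" if "v \<in> sq_int MO" "w \<in> sq_int MO" for v w :: "real^'n \<Rightarrow> real" and a b
    using sq_int_lincomb[OF that] by simp
  show "ipM MO (\<lambda>x. a * v x + b * w x) z = a * ipM MO v z + b * ipM MO w z"
    if "v \<in> sq_int MO" "w \<in> sq_int MO" "z \<in> sq_int MO" for v w z :: "real^'n \<Rightarrow> real" and a b
    using sq.ip_lincomb[OF that] by simp
  show "\<exists>w\<in>sq_int MO. (\<lambda>n. sqrt (ipM MO (\<lambda>x. X n x - w x) (\<lambda>x. X n x - w x))) \<longlonglongrightarrow> 0"
    if "(\<forall>n. X n \<in> sq_int MO) \<and> (\<forall>e>0. \<exists>N. \<forall>m\<ge>N. \<forall>n\<ge>N.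
      sqrt (ipM MO (\<lambda>x. X m x - X n x) (\<lambda>x. X m x - X n x)) < e)" for X :: "nat \<Rightarrow> real^'n \<Rightarrow> real"
    using MO.sq_int_complete[of X] that unfolding sq.nrm_def by blast
  show "\<exists>C. \<forall>w\<in>sq_int MO. nrmM MO w \<le> C * sqrt (ipM MO w w)"
    by (rule exI[of _ 1]) (simp add: sq.nrm_def)
qed (auto simp: sq.ip_nonneg ipM_self_eq_0_iff sq.zero_mem intro: sq.ip_sym)

text \<open>For unit weights the weighted norm is \<open>H1norm\<close>, so the facts on weighted
  inner products apply to the unweighted space.\<close>

sublocale U: weighted_domain Om "\<lambda>_. 1" "\<lambda>_. 1" 1 1 1 1
  by unfold_locales auto

lemma H1norm_eq: "H1norm Om w = U.H1.nrm w"
  by (simp add: H1norm_def U.H1.nrm_def L2norm_eq U.H1ip_eq nrmM_power2)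

lemma nrmM_le_H1norm:
  "w \<in> H1 Om \<Longrightarrow> nrmM MO w \<le> H1norm Om w"
  "w \<in> H1 Om \<Longrightarrow> nrmM MO (wgrad Om w) \<le> H1norm Om w"
  using U.nrmM_le_H1_nrm[of w] by (simp_all add: H1norm_eq)

lemma H1norm_cong_AE:
  assumes "AE x in MO. w x = w' x" "w \<in> borel_measurable MO" "w' \<in> borel_measurable MO"
  shows "H1norm Om w = H1norm Om w'"
  using wgrad_cong_AE[OF assms] nrmM_cong_AE[OF assms] by (simp add: H1norm_def L2norm_eq)

lemma H1norm_AE_0: "AE x in MO. w x = 0 \<Longrightarrow> w \<in> borel_measurable MO \<Longrightarrow> H1norm Om w = 0"
  using H1norm_cong_AE[of w "\<lambda>x. 0"] U.hilbert_H1
  by (simp add: H1norm_eq U.H1.nrm_def hilbert_in_L2_def)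

section \<open>The closure of the test functions in H1\<close>

lemma H01_H1: "w \<in> H01 Om \<Longrightarrow> w \<in> H1 Om"
  by (simp add: H01_def)

lemma H01_lincomb:
  assumes v: "v \<in> H01 Om" and w: "w \<in> H01 Om"
  shows "(\<lambda>x. a * v x + b * w x) \<in> H01 Om"
proof -
  obtain \<phi> :: "nat \<Rightarrow> _" where \<phi>: "\<And>n. \<phi> n \<in> test_fun Om" "(\<lambda>n. H1norm Om (\<lambda>x. \<phi> n x - v x)) \<longlonglongrightarrow> 0"
    using v by (auto simp: H01_def)
  obtain \<psi> :: "nat \<Rightarrow> _" where \<psi>: "\<And>n. \<psi> n \<in> test_fun Om" "(\<lambda>n. H1norm Om (\<lambda>x. \<psi> n x - w x)) \<longlonglongrightarrow> 0"
    using w by (auto simp: H01_def)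
  have H: "(\<lambda>x. \<phi> n x - v x) \<in> H1 Om" "(\<lambda>x. \<psi> n x - w x) \<in> H1 Om" for n
    by (intro U.H1.diff_mem test_fun_H1 H01_H1 \<phi> \<psi> v w)+
  have le: "H1norm Om (\<lambda>x. (a * \<phi> n x + b * \<psi> n x) - (a * v x + b * w x)) \<le>
      \<bar>a\<bar> * H1norm Om (\<lambda>x. \<phi> n x - v x) + \<bar>b\<bar> * H1norm Om (\<lambda>x. \<psi> n x - w x)" for n
    using U.H1.nrm_lincomb_le[OF H(1)[of n] H(2)[of n], of a b] by (simp add: H1norm_eq algebra_simps)
  have "(\<lambda>n. H1norm Om (\<lambda>x. (a * \<phi> n x + b * \<psi> n x) - (a * v x + b * w x))) \<longlonglongrightarrow> 0"
  proof (rule tendsto_sandwich[OF _ _ tendsto_const])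
    have "(\<lambda>n. \<bar>a\<bar> * H1norm Om (\<lambda>x. \<phi> n x - v x) + \<bar>b\<bar> * H1norm Om (\<lambda>x. \<psi> n x - w x)) \<longlonglongrightarrow> \<bar>a\<bar> * 0 + \<bar>b\<bar> * 0"
      by (intro tendsto_intros \<phi> \<psi>)
    then show "(\<lambda>n. \<bar>a\<bar> * H1norm Om (\<lambda>x. \<phi> n x - v x) + \<bar>b\<bar> * H1norm Om (\<lambda>x. \<psi> n x - w x)) \<longlonglongrightarrow> 0" by simp
    show "\<forall>\<^sub>F n in sequentially. 0 \<le> H1norm Om (\<lambda>x. (a * \<phi> n x + b * \<psi> n x) - (a * v x + b * w x))"
      unfolding H1norm_eq
      by (intro always_eventually allI U.H1.nrm_nonneg U.H1.diff_mem H1_lincomb test_fun_H1 H01_H1 \<phi> \<psi> v w)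
  qed (use le in simp)
  moreover have "(\<lambda>x. a * \<phi> n x + b * \<psi> n x) \<in> test_fun Om" for n by (intro test_fun_lincomb \<phi> \<psi>)
  ultimately show ?thesis unfolding H01_def
    using H1_lincomb[OF H01_H1[OF v] H01_H1[OF w]]
    by (intro CollectI conjI exI[of _ "\<lambda>n x. a * \<phi> n x + b * \<psi> n x"]) auto
qed

end

section \<open>Square-integrable functions of time and space\<close>

lemma (in pair_sigma_finite) integrable_mult_fst_snd:
  fixes f :: "'a \<Rightarrow> real" and g :: "'b \<Rightarrow> real"
  assumes f: "integrable M1 f" and g: "integrable M2 g"
  shows "integrable (M1 \<Otimes>\<^sub>M M2) (\<lambda>p. f (fst p) * g (snd p))"
proof (rule Fubini_integrable)
  show "(\<lambda>p. f (fst p) * g (snd p)) \<in> borel_measurable (M1 \<Otimes>\<^sub>M M2)"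
    using f g by (intro borel_measurable_times measurable_compose[OF measurable_fst] measurable_compose[OF measurable_snd]) auto
  show "integrable M1 (\<lambda>x. LINT y|M2. norm (f (fst (x, y)) * g (snd (x, y))))"
    using f by (simp add: abs_mult)
qed (use g in simp)

locale time_domain = bounded_domain Om for Om :: "(real^'n) set" +
  fixes T :: real
  assumes T_pos: "0 < T"
begin

abbreviation "MT \<equiv> lebesgue_on {0..T}"

sublocale MT: finite_measure MT by (intro finite_measure_lebesgue_on) simp
sublocale P: pair_sigma_finite MT MO ..
sublocale TT: pair_sigma_finite MT MT ..
sublocale PM: finite_measure "MT \<Otimes>\<^sub>M MO"
  by (intro finite_measure_pair_measure MT.finite_measure_axioms MO.finite_measure_axioms)

text \<open>Square integrability over the product measure, hence directly accessible to Fubini;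
  \<open>L2_L2_iff\<close> identifies it with \<open>L2_L2\<close>.\<close>

definition ST :: "(real \<Rightarrow> real^'n \<Rightarrow> 'b::euclidean_space) set" where
  "ST = {z. case_prod z \<in> sq_int (MT \<Otimes>\<^sub>M MO)}"

lemma jmeas_iff: "jmeas T Om z \<longleftrightarrow> case_prod z \<in> borel_measurable (MT \<Otimes>\<^sub>M MO)"
  by (simp add: jmeas_def)

lemma ST_jmeas: "z \<in> ST \<Longrightarrow> jmeas T Om z"
  by (simp add: ST_def jmeas_iff sq_int_measurable)

lemma jmeas_slice_t: "jmeas T Om z \<Longrightarrow> t \<in> {0..T} \<Longrightarrow> z t \<in> borel_measurable MO"
  using measurable_compose[OF measurable_Pair1', of t MT "case_prod z" MO borel] by (simp add: jmeas_iff)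

lemma jmeas_slice_x: "jmeas T Om z \<Longrightarrow> x \<in> Om \<Longrightarrow> (\<lambda>t. z t x) \<in> borel_measurable MT"
  using measurable_compose[OF measurable_Pair2', of x MO "case_prod z" MT borel] by (simp add: jmeas_iff)

lemma ST_norm_integrable: "z \<in> ST \<Longrightarrow> integrable (MT \<Otimes>\<^sub>M MO) (\<lambda>(t, x). (norm (z t x))\<^sup>2)"
  using sq_int_integrable[of "case_prod z"] by (simp add: ST_def case_prod_unfold)

lemma nrmM_slice_measurable:
  assumes "jmeas T Om z"
  shows "(\<lambda>t. (nrmM MO (z t))\<^sup>2) \<in> borel_measurable MT"
proof -
  have "(\<lambda>t. LINT x|MO. (norm (z t x))\<^sup>2) \<in> borel_measurable MT"
    using assms unfolding jmeas_iff by measurable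
  then show ?thesis by (simp add: nrmM_eq)
qed

lemma ST_slice_t: "z \<in> ST \<Longrightarrow> AE t in MT. z t \<in> sq_int MO"
proof -
  assume z: "z \<in> ST"
  from P.AE_integrable_fst[OF ST_norm_integrable[OF z]] AE_space show ?thesis
    by eventually_elim (use jmeas_slice_t[OF ST_jmeas[OF z]] in \<open>simp add: sq_int_def\<close>)
qed

lemma ST_slice_x: "z \<in> ST \<Longrightarrow> AE x in MO. (\<lambda>t. z t x) \<in> sq_int MT"
proof -
  assume z: "z \<in> ST"
  from P.AE_integrable_snd[OF ST_norm_integrable[OF z]] AE_space show ?thesis
    by eventually_elim (use jmeas_slice_x[OF ST_jmeas[OF z]] in \<open>simp add: sq_int_def\<close>)
qed

lemma ST_lincomb:
  assumes "z \<in> ST" "w \<in> ST"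
  shows "(\<lambda>t x. a *\<^sub>R z t x + b *\<^sub>R w t x) \<in> ST"
proof -
  have "(\<lambda>p. a *\<^sub>R case_prod z p + b *\<^sub>R case_prod w p) \<in> sq_int (MT \<Otimes>\<^sub>M MO)"
    using assms by (intro sq_int_lincomb) (auto simp: ST_def)
  then show ?thesis by (simp add: ST_def case_prod_unfold)
qed

text \<open>Tonelli, in the direction converse to \<open>ST_slice_t\<close> and
  \<open>ST_integrable_nrm\<close>.\<close>

lemma ST_I:
  assumes m: "jmeas T Om z" and t: "AE t in MT. z t \<in> sq_int MO" and i: "integrable MT (\<lambda>t. (nrmM MO (z t))\<^sup>2)"
  shows "z \<in> ST"
proof -
  have "integrable (MT \<Otimes>\<^sub>M MO) (\<lambda>p. (norm (case_prod z p))\<^sup>2)"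
  proof (rule P.Fubini_integrable)
    show "(\<lambda>p. (norm (case_prod z p))\<^sup>2) \<in> borel_measurable (MT \<Otimes>\<^sub>M MO)"
      using m unfolding jmeas_iff by measurable
    have "(LINT x|MO. norm ((norm (case_prod z (t, x)))\<^sup>2)) = (nrmM MO (z t))\<^sup>2" for t
      by (simp add: nrmM_eq)
    then show "integrable MT (\<lambda>t. LINT x|MO. norm ((norm (case_prod z (t, x)))\<^sup>2))" using i by simp
    show "AE t in MT. integrable MO (\<lambda>x. (norm (case_prod z (t, x)))\<^sup>2)"
      using t by eventually_elim (simp add: sq_int_integrable)
  qed
  then show ?thesis using m by (simp add: ST_def sq_int_def jmeas_iff)
qed

lemma ST_integrable_nrm:
  assumes "z \<in> ST"
  shows "integrable MT (\<lambda>t. (nrmM MO (z t))\<^sup>2)"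
  using P.integrable_fst[OF ST_norm_integrable[OF assms]] by (simp add: nrmM_eq)

lemma L2_L2_iff: "L2_L2 T Om z \<longleftrightarrow> z \<in> ST"
  using ST_I[of z] ST_integrable_nrm[of z] ST_jmeas[of z] ST_slice_t[of z]
  by (auto simp: L2_L2_def L2_eq L2norm_eq)

lemma ST_inner:
  assumes "z \<in> ST" "w \<in> ST"
  shows "integrable (MT \<Otimes>\<^sub>M MO) (\<lambda>(t, x). z t x \<bullet> w t x)"
  using integrable_inner[of "case_prod z" "MT \<Otimes>\<^sub>M MO" "case_prod w"] assms
  by (simp add: ST_def case_prod_unfold)

lemma ST_ip_integrable:
  assumes "z \<in> ST" "w \<in> ST"
  shows "integrable MT (\<lambda>t. ipM MO (z t) (w t))" "integrable MO (\<lambda>x. ipM MT (\<lambda>t. z t x) (\<lambda>t. w t x))"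
  using P.integrable_fst[OF ST_inner[OF assms]] P.integrable_snd[OF ST_inner[OF assms]]
  by (simp_all add: ipM_def)

lemma ST_Fubini:
  assumes "z \<in> ST" "w \<in> ST"
  shows "(LINT t|MT. ipM MO (z t) (w t)) = (LINT x|MO. ipM MT (\<lambda>t. z t x) (\<lambda>t. w t x))"
  unfolding ipM_def by (rule P.Fubini_integral[symmetric]) (rule ST_inner[OF assms])

lemma ST_const_t:
  assumes "\<phi> \<in> sq_int MO"
  shows "(\<lambda>t. \<phi>) \<in> ST"
proof (rule ST_I)
  show "jmeas T Om (\<lambda>t. \<phi>)" unfolding jmeas_iff using sq_int_measurable[OF assms] by measurable
qed (use assms in auto)

lemma ST_cong_AE:
  assumes z: "z \<in> ST" and w: "jmeas T Om w" and eq: "AE t in MT. AE x in MO. z t x = w t x"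
  shows "w \<in> ST"
proof (rule ST_I[OF w])
  note sl = jmeas_slice_t[OF ST_jmeas[OF z]] jmeas_slice_t[OF w]
  have *: "AE t in MT. w t \<in> sq_int MO \<and> (nrmM MO (w t))\<^sup>2 = (nrmM MO (z t))\<^sup>2"
    using eq ST_slice_t[OF z] AE_space
  proof eventually_elim
    case (elim t)
    then show ?case using sq_int_cong_AE[of "z t" MO "w t"] nrmM_cong_AE[of "z t" "w t" MO] sl[of t] by simp
  qed
  then show "AE t in MT. w t \<in> sq_int MO" by eventually_elim simp
  have "AE t in MT. (nrmM MO (z t))\<^sup>2 = (nrmM MO (w t))\<^sup>2" using * by eventually_elim simp
  then show "integrable MT (\<lambda>t. (nrmM MO (w t))\<^sup>2)"
    by (rule integrable_cong_AE_imp[OF ST_integrable_nrm[OF z] nrmM_slice_measurable[OF w]])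
qed

text \<open>Fubini for null sets, which needs the coincidence set to be measurable in the product;
  joint measurability provides this.\<close>

lemma AE_swap:
  assumes "jmeas T Om z" "jmeas T Om w"
  shows "(AE t in MT. AE x in MO. z t x = w t x) \<longleftrightarrow> (AE x in MO. AE t in MT. z t x = w t x)"
proof (rule P.AE_commute)
  have "(\<lambda>p. case_prod z p - case_prod w p) \<in> borel_measurable (MT \<Otimes>\<^sub>M MO)"
    using assms unfolding jmeas_iff by measurable
  then have "{p \<in> space (MT \<Otimes>\<^sub>M MO). case_prod z p - case_prod w p = 0} \<in> sets (MT \<Otimes>\<^sub>M MO)"
    by measurable
  then show "{p \<in> space (MT \<Otimes>\<^sub>M MO). z (fst p) (snd p) = w (fst p) (snd p)} \<in> sets (MT \<Otimes>\<^sub>M MO)"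
    by (simp add: case_prod_unfold)
qed

section \<open>Integral operators in time\<close>

text \<open>Bounded measurable kernels cover every time operation of the problem: the convolution
  and its adjoint, integration over \<open>[0,t]\<close> and \<open>[t,T]\<close>, and weighted
  integrals over \<open>[0,T]\<close>.\<close>

definition kernel :: "(real \<Rightarrow> real \<Rightarrow> real) \<Rightarrow> bool" where
  "kernel K \<longleftrightarrow> case_prod K \<in> borel_measurable (MT \<Otimes>\<^sub>M MT) \<and>
     (\<exists>B. \<forall>t\<in>{0..T}. \<forall>s\<in>{0..T}. \<bar>K t s\<bar> \<le> B)"

definition iop :: "(real \<Rightarrow> real \<Rightarrow> real) \<Rightarrow> (real \<Rightarrow> real^'n \<Rightarrow> 'b::euclidean_space) \<Rightarrow> real \<Rightarrow> real^'n \<Rightarrow> 'b" where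
  "iop K z t x = (LINT s|MT. K t s *\<^sub>R z s x)"

lemma kernel_measurable: "kernel K \<Longrightarrow> case_prod K \<in> borel_measurable (MT \<Otimes>\<^sub>M MT)"
  by (simp add: kernel_def)

lemma kernel_slice: "kernel K \<Longrightarrow> t \<in> {0..T} \<Longrightarrow> K t \<in> borel_measurable MT"
  using measurable_compose[OF measurable_Pair1', of t MT "case_prod K" MT borel] by (simp add: kernel_def)

lemma kernel_bound:
  assumes "kernel K"
  obtains B where "\<And>t s. t \<in> {0..T} \<Longrightarrow> s \<in> {0..T} \<Longrightarrow> \<bar>K t s\<bar> \<le> B" "0 \<le> B"
proof -
  obtain B where B: "\<And>t s. t \<in> {0..T} \<Longrightarrow> s \<in> {0..T} \<Longrightarrow> \<bar>K t s\<bar> \<le> B"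
    using assms unfolding kernel_def by blast
  show ?thesis by (rule that[OF B]) (use B[of 0 0] T_pos in auto)
qed

lemma kernel_transpose: "kernel K \<Longrightarrow> kernel (\<lambda>s t. K t s)"
proof -
  assume K: "kernel K"
  have "(\<lambda>p. case_prod K (snd p, fst p)) \<in> borel_measurable (MT \<Otimes>\<^sub>M MT)"
    by (rule measurable_compose[OF _ kernel_measurable[OF K]]) measurable
  then show ?thesis using K unfolding kernel_def by (auto simp: case_prod_unfold)
qed

text \<open>With such a kernel, \<open>iop\<close> evaluated at the arbitrary time 0 is the integral
  over \<open>[0,T]\<close> with weight \<open>f\<close>. Test functions, \<open>g\<close> and the
  constant 1 enter in this way.\<close>

lemma kernel_const: "f \<in> borel_measurable MT \<Longrightarrow> (\<And>t. t \<in> {0..T} \<Longrightarrow> \<bar>f t\<bar> \<le> B) \<Longrightarrow> kernel (\<lambda>t. f)"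
  unfolding kernel_def
  using measurable_compose[OF measurable_snd, of f MT borel MT] by (auto simp: case_prod_unfold intro!: exI[of _ B])

lemma kernel_mult_sq_int:
  assumes K: "kernel K" and t: "t \<in> {0..T}" and z: "z \<in> sq_int MT"
  shows "(\<lambda>s. K t s *\<^sub>R z s) \<in> sq_int MT"
proof -
  obtain B where B: "\<And>t s. t \<in> {0..T} \<Longrightarrow> s \<in> {0..T} \<Longrightarrow> \<bar>K t s\<bar> \<le> B" "0 \<le> B"
    by (rule kernel_bound[OF K]) blast
  show ?thesis by (rule sq_int_scaleR_bounded[OF kernel_slice[OF K t] _ z]) (use B t in auto)
qed

lemma kernel_mult_ST:
  assumes K: "kernel K" and t: "t \<in> {0..T}" and z: "z \<in> ST"
  shows "(\<lambda>s x. K t s *\<^sub>R z s x) \<in> ST"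
proof -
  obtain B where B: "\<And>t s. t \<in> {0..T} \<Longrightarrow> s \<in> {0..T} \<Longrightarrow> \<bar>K t s\<bar> \<le> B" "0 \<le> B"
    by (rule kernel_bound[OF K]) blast
  have "(\<lambda>p. K t (fst p)) \<in> borel_measurable (MT \<Otimes>\<^sub>M MO)"
    by (rule measurable_compose[OF measurable_fst kernel_slice[OF K t]])
  then have "(\<lambda>p. K t (fst p) *\<^sub>R case_prod z p) \<in> sq_int (MT \<Otimes>\<^sub>M MO)"
    by (rule sq_int_scaleR_bounded[where C = B])
      (use B t z in \<open>auto simp: ST_def space_pair_measure\<close>)
  then show ?thesis by (simp add: ST_def case_prod_unfold)
qed

lemma iop_jmeas:
  assumes K: "kernel K" and z: "jmeas T Om z"
  shows "jmeas T Om (iop K z)"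
proof -
  have 1: "(\<lambda>q. K (fst (fst q)) (snd q)) \<in> borel_measurable ((MT \<Otimes>\<^sub>M MO) \<Otimes>\<^sub>M MT)"
    using measurable_compose[OF _ kernel_measurable[OF K], of "\<lambda>q. (fst (fst q), snd q)" "(MT \<Otimes>\<^sub>M MO) \<Otimes>\<^sub>M MT"] by simp
  have 2: "(\<lambda>q. z (snd q) (snd (fst q))) \<in> borel_measurable ((MT \<Otimes>\<^sub>M MO) \<Otimes>\<^sub>M MT)"
    using measurable_compose[OF _ z[unfolded jmeas_iff], of "\<lambda>q. (snd q, snd (fst q))" "(MT \<Otimes>\<^sub>M MO) \<Otimes>\<^sub>M MT"] by simp
  have "(\<lambda>p. LINT s|MT. K (fst p) s *\<^sub>R z s (snd p)) \<in> borel_measurable (MT \<Otimes>\<^sub>M MO)"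
    by (rule MT.borel_measurable_lebesgue_integral)
      (use borel_measurable_scaleR[OF 1 2] in \<open>simp add: case_prod_unfold\<close>)
  then show ?thesis by (simp add: jmeas_iff iop_def case_prod_unfold)
qed

text \<open>Cauchy-Schwarz in time at a fixed point \<open>x\<close>; the factor \<open>T\<close> is
  the length of the interval. The bound is uniform in \<open>t\<close> and valid at every
  \<open>t\<close>, so that \<open>iop_slice\<close> has no exceptional times.\<close>

lemma iop_norm_le:
  assumes K: "kernel K" and B: "\<And>t s. t \<in> {0..T} \<Longrightarrow> s \<in> {0..T} \<Longrightarrow> \<bar>K t s\<bar> \<le> B" "0 \<le> B"
    and t: "t \<in> {0..T}" and z: "(\<lambda>s. z s x) \<in> sq_int MT"
  shows "(norm (iop K z t x))\<^sup>2 \<le> B\<^sup>2 * T * (LINT s|MT. (norm (z s x))\<^sup>2)"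
proof -
  have i: "integrable MT (\<lambda>s. K t s *\<^sub>R z s x)" "integrable MT (\<lambda>s. z s x)"
    using MT.sq_int_imp_integrable[OF kernel_mult_sq_int[OF K t z]] MT.sq_int_imp_integrable[OF z] by auto
  have "norm (iop K z t x) \<le> (LINT s|MT. norm (K t s *\<^sub>R z s x))"
    unfolding iop_def by (rule integral_norm_bound)
  also have "\<dots> \<le> (LINT s|MT. B * norm (z s x))"
    by (rule integral_mono) (use i integrable_norm[OF i(1)] B(1) t in \<open>auto intro!: mult_right_mono\<close>)
  also have "\<dots> = B * (LINT s|MT. norm (z s x))" by simp
  also have "\<dots> \<le> B * (nrmM MT (\<lambda>s. z s x) * sqrt (measure MT (space MT)))"
    by (intro mult_left_mono MT.L1_le_nrmM z B)
  also have "measure MT (space MT) = T" using T_pos by (simp add: measure_restrict_space)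
  finally have "(norm (iop K z t x))\<^sup>2 \<le> (B * (nrmM MT (\<lambda>s. z s x) * sqrt T))\<^sup>2" by (intro power_mono) auto
  also have "\<dots> = B\<^sup>2 * T * (LINT s|MT. (norm (z s x))\<^sup>2)"
    using T_pos by (simp add: power_mult_distrib nrmM_eq)
  finally show ?thesis .
qed

lemma iop_slice:
  assumes K: "kernel K" and z: "z \<in> ST" and t: "t \<in> {0..T}"
  shows "iop K z t \<in> sq_int MO"
proof -
  obtain B where B: "\<And>t s. t \<in> {0..T} \<Longrightarrow> s \<in> {0..T} \<Longrightarrow> \<bar>K t s\<bar> \<le> B" "0 \<le> B"
    by (rule kernel_bound[OF K]) blast
  have m: "iop K z t \<in> borel_measurable MO" by (rule jmeas_slice_t[OF iop_jmeas[OF K ST_jmeas[OF z]] t])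
  from P.integrable_snd[OF ST_norm_integrable[OF z]] have "integrable MO (\<lambda>x. B\<^sup>2 * T * (LINT s|MT. (norm (z s x))\<^sup>2))" by simp
  then have "integrable MO (\<lambda>x. (norm (iop K z t x))\<^sup>2)"
  proof (rule Bochner_Integration.integrable_bound)
    show "AE x in MO. norm ((norm (iop K z t x))\<^sup>2) \<le> norm (B\<^sup>2 * T * (LINT s|MT. (norm (z s x))\<^sup>2))"
      using ST_slice_x[OF z] by eventually_elim (use iop_norm_le[OF K B t] in \<open>auto intro: order_trans[OF _ abs_ge_self]\<close>)
  qed (use m in measurable)
  then show ?thesis using m by (simp add: sq_int_def)
qed

lemma iop_ST:
  assumes K: "kernel K" and z: "z \<in> ST"
  shows "iop K z \<in> ST"
proof (rule ST_I)
  obtain B where B: "\<And>t s. t \<in> {0..T} \<Longrightarrow> s \<in> {0..T} \<Longrightarrow> \<bar>K t s\<bar> \<le> B" "0 \<le> B"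
    by (rule kernel_bound[OF K]) blast
  show j: "jmeas T Om (iop K z)" by (rule iop_jmeas[OF K ST_jmeas[OF z]])
  show "AE t in MT. iop K z t \<in> sq_int MO" by (rule AE_I2) (use iop_slice[OF K z] in simp)
  from P.integrable_snd[OF ST_norm_integrable[OF z]] have int: "integrable MO (\<lambda>x. B\<^sup>2 * T * (LINT s|MT. (norm (z s x))\<^sup>2))" by simp
  show "integrable MT (\<lambda>t. (nrmM MO (iop K z t))\<^sup>2)"
  proof (rule MT.integrable_const_bound[OF _ nrmM_slice_measurable[OF j]])
    show "AE t in MT. norm ((nrmM MO (iop K z t))\<^sup>2) \<le> (LINT x|MO. B\<^sup>2 * T * (LINT s|MT. (norm (z s x))\<^sup>2))"
    proof (rule AE_I2)
      fix t assume "t \<in> space MT"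
      then have t: "t \<in> {0..T}" by simp
      have "(LINT x|MO. (norm (iop K z t x))\<^sup>2) \<le> (LINT x|MO. B\<^sup>2 * T * (LINT s|MT. (norm (z s x))\<^sup>2))"
      proof (rule integral_mono_AE[OF sq_int_integrable[OF iop_slice[OF K z t]] int])
        show "AE x in MO. (norm (iop K z t x))\<^sup>2 \<le> B\<^sup>2 * T * (LINT s|MT. (norm (z s x))\<^sup>2)"
          using ST_slice_x[OF z] by eventually_elim (rule iop_norm_le[OF K B t])
      qed
      then show "norm ((nrmM MO (iop K z t))\<^sup>2) \<le> (LINT x|MO. B\<^sup>2 * T * (LINT s|MT. (norm (z s x))\<^sup>2))"
        by (simp add: nrmM_eq)
    qed
  qed
qed

text \<open>Fubini against a function that is constant in time; it reduces statements about
  \<open>iop\<close> to scalar kernel integrals.\<close>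

lemma iop_ip:
  assumes K: "kernel K" and z: "z \<in> ST" and t: "t \<in> {0..T}" and \<phi>: "\<phi> \<in> sq_int MO"
  shows "ipM MO (iop K z t) \<phi> = (LINT s|MT. K t s * ipM MO (z s) \<phi>)"
proof -
  let ?z = "\<lambda>s x. K t s *\<^sub>R z s x"
  have st: "?z \<in> ST" by (rule kernel_mult_ST[OF K t z])
  have "(LINT s|MT. K t s * ipM MO (z s) \<phi>) = (LINT s|MT. ipM MO (?z s) \<phi>)" by (simp add: ipM_def)
  also have "\<dots> = (LINT x|MO. ipM MT (\<lambda>s. ?z s x) (\<lambda>s. \<phi> x))" by (rule ST_Fubini[OF st ST_const_t[OF \<phi>]])
  also have "\<dots> = (LINT x|MO. iop K z t x \<bullet> \<phi> x)"
  proof (rule integral_cong_AE)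
    show "(\<lambda>x. ipM MT (\<lambda>s. ?z s x) (\<lambda>s. \<phi> x)) \<in> borel_measurable MO"
      using ST_ip_integrable(2)[OF st ST_const_t[OF \<phi>]] by (rule borel_measurable_integrable)
    show "(\<lambda>x. iop K z t x \<bullet> \<phi> x) \<in> borel_measurable MO"
      using integrable_inner[OF iop_slice[OF K z t] \<phi>] by (rule borel_measurable_integrable)
    show "AE x in MO. ipM MT (\<lambda>s. ?z s x) (\<lambda>s. \<phi> x) = iop K z t x \<bullet> \<phi> x"
      using ST_slice_x[OF st]
    proof eventually_elim
      case (elim x)
      from integral_inner_left[OF MT.sq_int_imp_integrable[OF this], of "\<phi> x"]
      show ?case by (simp add: ipM_def iop_def)
    qed
  qed
  finally show ?thesis by (simp add: ipM_def)
qed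

lemma kernel_mult_integrable:
  fixes f :: "real \<Rightarrow> 'b::euclidean_space"
  assumes K: "kernel K" and t: "t \<in> {0..T}" and f: "integrable MT f"
  shows "integrable MT (\<lambda>s. K t s *\<^sub>R f s)"
proof -
  obtain B where B: "\<And>t s. t \<in> {0..T} \<Longrightarrow> s \<in> {0..T} \<Longrightarrow> \<bar>K t s\<bar> \<le> B" "0 \<le> B"
    by (rule kernel_bound[OF K]) blast
  show ?thesis
  proof (rule Bochner_Integration.integrable_bound)
    show "integrable MT (\<lambda>s. B *\<^sub>R f s)" using f by simp
    show "(\<lambda>s. K t s *\<^sub>R f s) \<in> borel_measurable MT"
      using f by (intro borel_measurable_scaleR kernel_slice[OF K t]) auto
    show "AE s in MT. norm (K t s *\<^sub>R f s) \<le> norm (B *\<^sub>R f s)"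
      using B t by (intro AE_I2) (auto intro!: mult_right_mono)
  qed
qed

text \<open>Fubini, with \<open>B\<close> times the product of the norms of \<open>w t\<close> and
  \<open>z s\<close> as integrable bound.\<close>

lemma kernel_adjoint:
  fixes z w :: "real \<Rightarrow> 'b::euclidean_space"
  assumes K: "kernel K" and z: "integrable MT z" and w: "integrable MT w"
  shows "(LINT t|MT. (LINT s|MT. K t s *\<^sub>R z s) \<bullet> w t) = (LINT s|MT. z s \<bullet> (LINT t|MT. K t s *\<^sub>R w t))"
proof -
  obtain B where B: "\<And>t s. t \<in> {0..T} \<Longrightarrow> s \<in> {0..T} \<Longrightarrow> \<bar>K t s\<bar> \<le> B" "0 \<le> B"
    by (rule kernel_bound[OF K]) blast
  let ?f = "\<lambda>t s. K t s * (z s \<bullet> w t)"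
  have bnd: "integrable (MT \<Otimes>\<^sub>M MT) (\<lambda>p. B * (norm (w (fst p)) * norm (z (snd p))))"
    by (intro integrable_mult_right TT.integrable_mult_fst_snd integrable_norm w z)
  have int: "integrable (MT \<Otimes>\<^sub>M MT) (\<lambda>(t, s). ?f t s)"
  proof (rule Bochner_Integration.integrable_bound[OF bnd])
    have "(\<lambda>p. z (snd p)) \<in> borel_measurable (MT \<Otimes>\<^sub>M MT)" "(\<lambda>p. w (fst p)) \<in> borel_measurable (MT \<Otimes>\<^sub>M MT)"
      using z w by (auto intro: measurable_compose[OF measurable_snd] measurable_compose[OF measurable_fst])
    then have "(\<lambda>p. case_prod K p * (z (snd p) \<bullet> w (fst p))) \<in> borel_measurable (MT \<Otimes>\<^sub>M MT)"
      using kernel_measurable[OF K] by (intro borel_measurable_times borel_measurable_inner)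
    then show "(\<lambda>(t, s). ?f t s) \<in> borel_measurable (MT \<Otimes>\<^sub>M MT)" by (simp add: case_prod_unfold)
    show "AE p in MT \<Otimes>\<^sub>M MT. norm (case p of (t, s) \<Rightarrow> ?f t s) \<le> norm (B * (norm (w (fst p)) * norm (z (snd p))))"
    proof (rule AE_I2)
      fix p assume "p \<in> space (MT \<Otimes>\<^sub>M MT)"
      then have "\<bar>K (fst p) (snd p)\<bar> \<le> B" using B(1) by (auto simp: space_pair_measure)
      moreover have "\<bar>z (snd p) \<bullet> w (fst p)\<bar> \<le> norm (w (fst p)) * norm (z (snd p))"
        using Cauchy_Schwarz_ineq2[of "z (snd p)" "w (fst p)"] by (simp add: mult.commute)
      ultimately have "\<bar>K (fst p) (snd p)\<bar> * \<bar>z (snd p) \<bullet> w (fst p)\<bar> \<le> B * (norm (w (fst p)) * norm (z (snd p)))"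
        using B(2) by (intro mult_mono) auto
      then show "norm (case p of (t, s) \<Rightarrow> ?f t s) \<le> norm (B * (norm (w (fst p)) * norm (z (snd p))))"
        using B(2) by (simp add: case_prod_unfold abs_mult)
    qed
  qed
  have "(LINT t|MT. (LINT s|MT. K t s *\<^sub>R z s) \<bullet> w t) = (LINT t|MT. LINT s|MT. ?f t s)"
  proof (rule Bochner_Integration.integral_cong[OF refl])
    fix t assume "t \<in> space MT"
    then have "integrable MT (\<lambda>s. K t s *\<^sub>R z s)" using kernel_mult_integrable[OF K _ z] by simp
    from integral_inner_left[OF this, of "w t"]
    show "(LINT s|MT. K t s *\<^sub>R z s) \<bullet> w t = (LINT s|MT. ?f t s)" by simp
  qed
  also have "\<dots> = (LINT s|MT. LINT t|MT. ?f t s)" by (rule TT.Fubini_integral[symmetric, OF int])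
  also have "\<dots> = (LINT s|MT. z s \<bullet> (LINT t|MT. K t s *\<^sub>R w t))"
  proof (rule Bochner_Integration.integral_cong[OF refl])
    fix s assume "s \<in> space MT"
    then have "integrable MT (\<lambda>t. K t s *\<^sub>R w t)"
      using kernel_mult_integrable[OF kernel_transpose[OF K] _ w] by simp
    from integral_inner_right[OF this, of "z s"]
    show "(LINT t|MT. ?f t s) = z s \<bullet> (LINT t|MT. K t s *\<^sub>R w t)" by simp
  qed
  finally show ?thesis .
qed

text \<open>Fubini to fix the point \<open>x\<close>, \<open>kernel_adjoint\<close> there, and
  Fubini back. With \<open>V\<close> this yields integration by parts in time, with
  \<open>volt k\<close> the passage from \<open>conv\<close> to \<open>conv_adj\<close>.\<close>

theorem iop_adjoint:
  assumes K: "kernel K" and z: "z \<in> ST" and w: "w \<in> ST"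
  shows "(LINT t|MT. ipM MO (iop K z t) (w t)) = (LINT s|MT. ipM MO (z s) (iop (\<lambda>s t. K t s) w s))"
proof -
  let ?L = "\<lambda>s t. K t s"
  have L: "kernel ?L" by (rule kernel_transpose[OF K])
  have st: "iop K z \<in> ST" "iop ?L w \<in> ST" by (intro iop_ST K L z w)+
  have "(LINT t|MT. ipM MO (iop K z t) (w t)) = (LINT x|MO. ipM MT (\<lambda>t. iop K z t x) (\<lambda>t. w t x))"
    by (rule ST_Fubini[OF st(1) w])
  also have "\<dots> = (LINT x|MO. ipM MT (\<lambda>s. z s x) (\<lambda>s. iop ?L w s x))"
  proof (rule integral_cong_AE)
    show "(\<lambda>x. ipM MT (\<lambda>t. iop K z t x) (\<lambda>t. w t x)) \<in> borel_measurable MO"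
      "(\<lambda>x. ipM MT (\<lambda>s. z s x) (\<lambda>s. iop ?L w s x)) \<in> borel_measurable MO"
      using ST_ip_integrable(2)[OF st(1) w] ST_ip_integrable(2)[OF z st(2)] by auto
    show "AE x in MO. ipM MT (\<lambda>t. iop K z t x) (\<lambda>t. w t x) = ipM MT (\<lambda>s. z s x) (\<lambda>s. iop ?L w s x)"
      using ST_slice_x[OF z] ST_slice_x[OF w]
    proof eventually_elim
      case (elim x)
      then show ?case unfolding ipM_def iop_def
        by (intro kernel_adjoint K MT.sq_int_imp_integrable)
    qed
  qed
  also have "\<dots> = (LINT s|MT. ipM MO (z s) (iop ?L w s))" by (rule ST_Fubini[symmetric, OF z st(2)])
  finally show ?thesis .
qed

text \<open>Exchanging the two almost-everywhere quantifiers first yields one null set that serves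
  all \<open>t\<close>.\<close>

lemma iop_cong_AE:
  assumes "jmeas T Om z" "jmeas T Om w" "AE t in MT. AE x in MO. z t x = w t x"
    and K: "kernel K"
  shows "AE x in MO. \<forall>t\<in>{0..T}. iop K z t x = iop K w t x"
proof -
  have "AE x in MO. AE t in MT. z t x = w t x" using AE_swap[OF assms(1,2)] assms(3) by simp
  then show ?thesis using AE_space
  proof eventually_elim
    case (elim x)
    have m: "(\<lambda>s. z s x) \<in> borel_measurable MT" "(\<lambda>s. w s x) \<in> borel_measurable MT"
      using assms(1,2) elim(2) jmeas_slice_x by auto
    show ?case
    proof
      fix t assume t: "t \<in> {0..T}"
      show "iop K z t x = iop K w t x" unfolding iop_def
      proof (rule integral_cong_AE)
        show "AE s in MT. K t s *\<^sub>R z s x = K t s *\<^sub>R w s x" using elim(1) by eventually_elim simp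
      qed (intro borel_measurable_scaleR kernel_slice[OF K t] m)+
    qed
  qed
qed

lemma iop_lincomb:
  assumes K: "kernel K" and z: "z \<in> ST" and w: "w \<in> ST"
  shows "AE x in MO. \<forall>t\<in>{0..T}.
    iop K (\<lambda>t x. a *\<^sub>R z t x + b *\<^sub>R w t x) t x = a *\<^sub>R iop K z t x + b *\<^sub>R iop K w t x"
  using ST_slice_x[OF z] ST_slice_x[OF w]
proof eventually_elim
  case (elim x)
  show ?case
  proof
    fix t assume t: "t \<in> {0..T}"
    note i = MT.sq_int_imp_integrable[OF kernel_mult_sq_int[OF K t elim(1)]]
      MT.sq_int_imp_integrable[OF kernel_mult_sq_int[OF K t elim(2)]]
    have "iop K (\<lambda>t x. a *\<^sub>R z t x + b *\<^sub>R w t x) t x =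
        (LINT s|MT. a *\<^sub>R (K t s *\<^sub>R z s x) + b *\<^sub>R (K t s *\<^sub>R w s x))"
      unfolding iop_def by (simp add: scaleR_add_right mult.commute)
    also have "\<dots> = (LINT s|MT. a *\<^sub>R (K t s *\<^sub>R z s x)) + (LINT s|MT. b *\<^sub>R (K t s *\<^sub>R w s x))"
      by (rule Bochner_Integration.integral_add) (intro integrable_scaleR_right i)+
    also have "\<dots> = a *\<^sub>R iop K z t x + b *\<^sub>R iop K w t x"
      unfolding iop_def by (simp only: integral_scaleR_right)
    finally show "iop K (\<lambda>t x. a *\<^sub>R z t x + b *\<^sub>R w t x) t x = a *\<^sub>R iop K z t x + b *\<^sub>R iop K w t x" .
  qed
qed

text \<open>Test functions do not depend on time, so the defining identity can be integrated against
  the kernel. An identity for almost every time thereby gives one for every time.\<close>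

lemma iop_weak_grad:
  assumes K: "kernel K" and z: "z \<in> ST" and q: "q \<in> ST" and g: "AE t in MT. is_weak_grad Om (z t) (q t)"
    and t: "t \<in> {0..T}"
  shows "is_weak_grad Om (iop K z t) (iop K q t)"
proof -
  have "ipM MO (iop K z t) (pd (axis i 1) \<phi>) = - ipM MO (iop K q t) (\<lambda>x. \<phi> x *\<^sub>R axis i 1)"
    if \<phi>: "\<phi> \<in> test_fun Om" for \<phi> i
  proof -
    let ?\<psi> = "pd (axis i 1) \<phi>" and ?\<chi> = "\<lambda>x. \<phi> x *\<^sub>R axis i (1::real)"
    have \<psi>: "?\<psi> \<in> sq_int MO" and \<chi>: "?\<chi> \<in> sq_int MO"
      using test_fun_sq_int(1)[OF pd_test_fun[OF \<phi>]] test_fun_sq_int(2)[OF \<phi>] by auto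
    have m: "(\<lambda>s. K t s * ipM MO (z s) ?\<psi>) \<in> borel_measurable MT" "(\<lambda>s. K t s * ipM MO (q s) ?\<chi>) \<in> borel_measurable MT"
      by (intro borel_measurable_times kernel_slice[OF K t] borel_measurable_integrable
          ST_ip_integrable z q ST_const_t \<psi> \<chi>)+
    have "(LINT s|MT. K t s * ipM MO (z s) ?\<psi>) = (LINT s|MT. - (K t s * ipM MO (q s) ?\<chi>))"
    proof (rule integral_cong_AE)
      show "AE s in MT. K t s * ipM MO (z s) ?\<psi> = - (K t s * ipM MO (q s) ?\<chi>)"
        using g by eventually_elim (use \<phi> in \<open>simp add: is_weak_grad_iff\<close>)
    qed (use m in auto)
    then show ?thesis using iop_ip[OF K z t \<psi>] iop_ip[OF K q t \<chi>] by simp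
  qed
  then show ?thesis using iop_slice[OF K q t] by (simp add: is_weak_grad_iff)
qed

end

section \<open>Distributional derivatives on an interval\<close>

text \<open>The integral from 0 vanishes to the left of the support in any case; zero total integral
  makes it vanish to the right as well.\<close>

lemma test_fun_antiderivative:
  fixes \<zeta> :: "real \<Rightarrow> real"
  assumes \<zeta>: "\<zeta> \<in> test_fun {0<..<T}" and zero: "integral {0..T} \<zeta> = 0" and T: "0 < T"
  shows "\<exists>\<eta>\<in>test_fun {0<..<T}. pd 1 \<eta> = \<zeta>"
proof -
  obtain K where K: "\<And>n. Ck n \<zeta>" "\<And>x. x \<notin> K \<Longrightarrow> \<zeta> x = 0" "compact K" "K \<subseteq> {0<..<T}"
    by (rule test_funE[OF \<zeta>]) blast
  \<comment> \<open>The support keeps a positive distance from both endpoints; if it is empty, any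
    interior point serves.\<close>
  obtain a b where ab: "0 < a" "a \<le> b" "b < T" "K \<subseteq> {a..b}"
  proof (cases "K = {}")
    case True
    then show ?thesis using that[of "T / 2" "T / 2"] T by simp
  next
    case False
    obtain a where a: "a \<in> K" "\<And>x. x \<in> K \<Longrightarrow> a \<le> x" using compact_attains_inf[OF K(3) False] by blast
    obtain b where b: "b \<in> K" "\<And>x. x \<in> K \<Longrightarrow> x \<le> b" using compact_attains_sup[OF K(3) False] by blast
    show ?thesis by (rule that[of a b]) (use a b K(4) in auto)
  qed
  have z: "\<zeta> x = 0" if "x \<notin> {a..b}" for x using K(2) ab(4) that by blast
  have cont: "continuous_on A \<zeta>" for A by (rule test_fun_continuous[OF \<zeta>])
  define \<eta> where "\<eta> t = integral {0..t} \<zeta>" for t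
  have int: "(\<zeta> has_integral 0) {0..t}" if t: "b \<le> t" for t
  proof -
    obtain i where i: "(\<zeta> has_integral i) {a..b}"
      using integrable_continuous_interval[OF cont] by (auto simp: integrable_on_def)
    have sup: "(\<zeta> has_integral i) {0..t}" if "b \<le> t" for t
      by (rule has_integral_on_superset[OF i]) (use z ab that in auto)
    have "i = 0" using integral_unique[OF sup[of T]] ab zero by simp
    then show ?thesis using sup[OF t] by simp
  qed
  have lo: "\<eta> t = 0" if "t < a" for t
  proof -
    have "integral {0..t} \<zeta> = integral {0..t} (\<lambda>x. 0)"
      by (rule Henstock_Kurzweil_Integration.integral_cong) (use z that in auto)
    then show ?thesis by (simp add: \<eta>_def)
  qed
  have hi: "\<eta> t = 0" if "b \<le> t" for t
    unfolding \<eta>_def using int[OF that] by (rule integral_unique)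
  have D: "(\<eta> has_real_derivative \<zeta> t) (at t)" for t
  proof (cases "t < a")
    case True
    have "((\<lambda>t. 0) has_derivative (\<lambda>h. 0)) (at t)" by simp
    then have "(\<eta> has_derivative (\<lambda>h. 0)) (at t)"
      by (rule has_derivative_transform_within_open[of _ _ _ "UNIV" "{..<a}"]) (use lo True in auto)
    then show ?thesis using z[of t] True by (simp add: has_field_derivative_def lambda_zero)
  next
    case False
    \<comment> \<open>For \<open>t \<ge> a\<close> the point is interior to
      \<open>[0, t + 1]\<close>, so the derivative of the indefinite integral within this interval
      is a full derivative.\<close>
    then have t: "0 < t" using ab by simp
    have "(\<eta> has_real_derivative \<zeta> t) (at t within {0..t + 1})"
      unfolding \<eta>_def by (rule integral_has_real_derivative[OF cont]) (use t in auto)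
    moreover have "at t within {0..t + 1} = at t" by (rule at_within_interior) (use t in auto)
    ultimately show ?thesis by simp
  qed
  have pd: "pd 1 \<eta> = \<zeta>"
  proof
    fix t show "pd 1 \<eta> t = \<zeta> t" using pd_eq[OF D[of t, unfolded has_field_derivative_def], of 1] by simp
  qed
  have "Ck n \<eta>" for n
  proof -
    have "\<eta> differentiable (at t)" for t using D real_differentiable_def by blast
    then have "Ck (Suc n) \<eta>" using K(1)[of n] pd by simp
    then show ?thesis by (rule Ck_Suc_imp_Ck)
  qed
  then have "\<eta> \<in> test_fun {0<..<T}"
    by (rule test_funI[of _ "{a..b}"]) (use lo hi ab in \<open>auto simp: not_le\<close>)
  then show ?thesis using pd by blast
qed

context time_domain
begin

lemma integral_MT_eq: "integrable MT f \<Longrightarrow> (LINT t|MT. f t) = integral {0..T} f" for f :: "real \<Rightarrow> real"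
  by (rule lebesgue_integral_eq_integral) auto

lemma continuous_bounded_T:
  fixes f :: "real \<Rightarrow> real"
  assumes "continuous_on {0..T} f"
  obtains B where "\<And>t. t \<in> {0..T} \<Longrightarrow> \<bar>f t\<bar> \<le> B"
proof -
  have "bounded (f ` {0..T})" using assms compact_continuous_image compact_imp_bounded compact_Icc by blast
  then obtain B where "\<forall>y\<in>f ` {0..T}. norm y \<le> B" unfolding bounded_iff by blast
  then show ?thesis by (intro that[of B]) auto
qed

lemma continuous_integrable_MT:
  fixes f :: "real \<Rightarrow> real"
  assumes "continuous_on {0..T} f"
  shows "integrable MT f"
proof -
  obtain B where "\<And>t. t \<in> {0..T} \<Longrightarrow> \<bar>f t\<bar> \<le> B" by (rule continuous_bounded_T[OF assms]) blast
  moreover have "f \<in> borel_measurable MT"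
    by (rule continuous_imp_measurable_on_sets_lebesgue[OF assms]) simp
  ultimately show ?thesis by (intro MT.integrable_const_bound[of _ B]) auto
qed

lemma test_fun_T_sq_int: "\<eta> \<in> test_fun {0<..<T} \<Longrightarrow> \<eta> \<in> sq_int MT"
proof -
  assume \<eta>: "\<eta> \<in> test_fun {0<..<T}"
  obtain B where B: "\<And>x. \<bar>\<eta> x\<bar> \<le> B" by (rule test_fun_bounded[OF \<eta>]) blast
  show ?thesis by (rule MT.sq_int_bounded[OF test_fun_measurable[OF \<eta>]]) (use B in auto)
qed

lemma test_fun_pd_real: "\<eta> \<in> test_fun S \<Longrightarrow> pd 1 \<eta> \<in> test_fun S" for \<eta> :: "real \<Rightarrow> real"
  by (rule test_fun_pd) auto

lemma kernel_test_fun: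
  assumes \<zeta>: "\<zeta> \<in> test_fun {0<..<T}"
  shows "kernel (\<lambda>t. \<zeta>)"
proof -
  obtain B where B: "\<And>x. \<bar>\<zeta> x\<bar> \<le> B" by (rule test_fun_bounded[OF \<zeta>]) blast
  show ?thesis by (rule kernel_const[OF test_fun_measurable[OF \<zeta>] B])
qed

lemma test_fun_mult_integrable:
  fixes f :: "real \<Rightarrow> real"
  assumes \<eta>: "\<eta> \<in> test_fun {0<..<T}" and f: "integrable MT f"
  shows "integrable MT (\<lambda>t. \<eta> t * f t)"
proof -
  obtain B where B: "\<And>x. \<bar>\<eta> x\<bar> \<le> B" by (rule test_fun_bounded[OF \<eta>]) blast
  show ?thesis
  proof (rule Bochner_Integration.integrable_bound)
    show "integrable MT (\<lambda>t. B * f t)" using f by simp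
    show "(\<lambda>t. \<eta> t * f t) \<in> borel_measurable MT"
      using f test_fun_measurable[OF \<eta>] by (intro borel_measurable_times) auto
    have "\<bar>\<eta> t\<bar> * \<bar>f t\<bar> \<le> \<bar>B\<bar> * \<bar>f t\<bar>" for t
      using B[of t] by (intro mult_right_mono) auto
    then show "AE t in MT. norm (\<eta> t * f t) \<le> norm (B * f t)" by (simp add: abs_mult)
  qed
qed

lemma test_fun_endpoints: "\<eta> \<in> test_fun {0<..<T} \<Longrightarrow> t \<notin> {0<..<T} \<Longrightarrow> \<eta> t = 0"
  using closure_subset[of "{x. \<eta> x \<noteq> 0}"] by (auto simp: test_fun_def)

lemma integral_test_fun_open:
  assumes \<eta>: "\<eta> \<in> test_fun {0<..<T}"
  shows "(LINT t|lebesgue_on {0<..<T}. f t * \<eta> t) = (LINT t|MT. f t * \<eta> t :: real)"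
proof -
  have "(\<lambda>t. indicator {0<..<T} t *\<^sub>R (f t * \<eta> t)) = (\<lambda>t. indicator {0..T} t *\<^sub>R (f t * \<eta> t))"
    using test_fun_endpoints[OF \<eta>] by (auto simp: fun_eq_iff indicator_def)
  then show ?thesis by (simp add: integral_restrict_space)
qed

text \<open>Subtracting from a test function a multiple of one with non-zero integral leaves the derivative of a test
  function, so that \<open>Y\<close> minus a constant annihilates all test functions.\<close>

lemma du_Bois_Reymond:
  assumes Y: "continuous_on {0..T} Y"
    and zero: "\<And>\<eta>. \<eta> \<in> test_fun {0<..<T} \<Longrightarrow> (LINT t|MT. pd 1 \<eta> t * Y t) = 0"
    and t: "t \<in> {0..T}"
  shows "Y t = Y 0"
proof -
  let ?S = "{0<..<T}"
  have Yi: "integrable MT Y" by (rule continuous_integrable_MT[OF Y])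
  \<comment> \<open>If all these integrals were zero, the fundamental lemma applied to the constant
    1 would give \<open>1 = 0\<close> almost everywhere.\<close>
  have "\<exists>\<zeta>\<in>test_fun ?S. (LINT t|MT. \<zeta> t) \<noteq> 0"
  proof (rule ccontr)
    assume "\<not> ?thesis"
    then have "AE t in lebesgue_on ?S. (1::real) = 0"
      using integral_test_fun_open[of _ "\<lambda>_. 1"]
      by (intro fundamental_lemma) (auto intro: finite_measure.integrable_const finite_measure_lebesgue_on)
    then have "AE t in lebesgue. t \<notin> ?S" by (subst (asm) AE_restrict_space_iff) auto
    then have "?S \<in> null_sets lebesgue" by (subst (asm) AE_iff_null_sets[symmetric]) auto
    then have "negligible ?S" by (simp add: negligible_iff_null_sets)
    then show False using open_not_negligible[of ?S] T_pos by auto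
  qed
  then obtain \<zeta>1 where \<zeta>1: "\<zeta>1 \<in> test_fun ?S" "(LINT t|MT. \<zeta>1 t) \<noteq> 0" by blast
  define p where "p = (LINT t|MT. \<zeta>1 t)"
  \<comment> \<open>The value that the constant must have, read off by testing \<open>Y\<close> with
    \<open>\<zeta>1\<close>.\<close>
  define c where "c = (LINT t|MT. \<zeta>1 t * Y t) / p"
  have "AE t in lebesgue_on ?S. Y t - c = 0"
  proof (rule fundamental_lemma)
    have "integrable MT (\<lambda>t. Y t - c)" using Yi by simp
    then have "integrable lebesgue (\<lambda>t. indicator {0..T} t *\<^sub>R (Y t - c))" by (simp add: integrable_restrict_space)
    then have "integrable lebesgue (\<lambda>t. indicator ?S t *\<^sub>R (indicator {0..T} t *\<^sub>R (Y t - c)))"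
      by (rule integrable_mult_indicator[rotated]) simp
    moreover have "(\<lambda>t. indicator ?S t *\<^sub>R (indicator {0..T} t *\<^sub>R (Y t - c))) = (\<lambda>t. indicator ?S t *\<^sub>R (Y t - c))"
      by (auto simp: fun_eq_iff indicator_def)
    ultimately show "integrable (lebesgue_on ?S) (\<lambda>t. Y t - c)" by (simp add: integrable_restrict_space)
    show "(LINT t|lebesgue_on ?S. (Y t - c) * \<zeta> t) = 0" if \<zeta>: "\<zeta> \<in> test_fun ?S" for \<zeta>
    proof -
      define m where "m = (LINT t|MT. \<zeta> t) / p"
      define \<xi> where "\<xi> = (\<lambda>t. 1 * \<zeta> t + (- m) * \<zeta>1 t)"
      note i = MT.sq_int_imp_integrable[OF test_fun_T_sq_int[OF \<zeta>]] MT.sq_int_imp_integrable[OF test_fun_T_sq_int[OF \<zeta>1(1)]]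
      note iY = test_fun_mult_integrable[OF \<zeta> Yi] test_fun_mult_integrable[OF \<zeta>1(1) Yi]
      have \<xi>: "\<xi> \<in> test_fun ?S" unfolding \<xi>_def by (rule test_fun_lincomb[OF \<zeta> \<zeta>1(1)])
      have "(LINT t|MT. \<xi> t) = (LINT t|MT. \<zeta> t) - m * p" unfolding \<xi>_def p_def using i by simp
      then have "(LINT t|MT. \<xi> t) = 0" using \<zeta>1(2) by (simp add: m_def p_def)
      then have "integral {0..T} \<xi> = 0"
        using integral_MT_eq[OF MT.sq_int_imp_integrable[OF test_fun_T_sq_int[OF \<xi>]]] by simp
      then obtain \<eta> where "\<eta> \<in> test_fun ?S" "pd 1 \<eta> = \<xi>" using test_fun_antiderivative[OF \<xi> _ T_pos] by blast
      then have "(LINT t|MT. \<xi> t * Y t) = 0" using zero by auto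
      also have "(\<lambda>t. \<xi> t * Y t) = (\<lambda>t. \<zeta> t * Y t - m * (\<zeta>1 t * Y t))" by (simp add: \<xi>_def algebra_simps)
      finally have "(LINT t|MT. \<zeta> t * Y t) = m * (LINT t|MT. \<zeta>1 t * Y t)" using iY by simp
      also have "\<dots> = c * (LINT t|MT. \<zeta> t)" by (simp add: m_def c_def)
      finally have "(LINT t|MT. \<zeta> t * Y t) = c * (LINT t|MT. \<zeta> t)" .
      moreover have "(LINT t|MT. (Y t - c) * \<zeta> t) = (LINT t|MT. \<zeta> t * Y t - c * \<zeta> t)"
        by (simp add: algebra_simps)
      ultimately have "(LINT t|MT. (Y t - c) * \<zeta> t) = 0" using iY i by simp
      then show ?thesis by (simp add: integral_test_fun_open[OF \<zeta>])
    qed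
  qed simp
  then have "AE t in lebesgue. t \<in> ?S \<longrightarrow> Y t = c" by (subst (asm) AE_restrict_space_iff) auto
  \<comment> \<open>From almost everywhere to everywhere: the set where \<open>Y\<close> differs
    from \<open>c\<close> is open by continuity and negligible, hence empty. The endpoints follow by
    passing to the closure.\<close>
  then have ae: "AE t in lebesgue. t \<notin> {t \<in> ?S. Y t - c \<noteq> 0}" by eventually_elim simp
  have op: "open {t \<in> ?S. Y t - c \<noteq> 0}"
  proof -
    have "open (?S \<inter> (\<lambda>t. Y t - c) -` (- {0}))"
      by (rule continuous_open_preimage)
        (use Y in \<open>auto intro!: continuous_intros intro: continuous_on_subset\<close>)
    moreover have "?S \<inter> (\<lambda>t. Y t - c) -` (- {0}) = {t \<in> ?S. Y t - c \<noteq> 0}" by auto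
    ultimately show ?thesis by simp
  qed
  have "{t \<in> ?S. Y t - c \<noteq> 0} \<in> null_sets lebesgue"
    using ae by (subst (asm) AE_iff_null_sets[symmetric]) (use op in auto)
  then have "negligible {t \<in> ?S. Y t - c \<noteq> 0}" by (simp add: negligible_iff_null_sets)
  then have "{t \<in> ?S. Y t - c \<noteq> 0} = {}" using open_not_negligible[OF op] by blast
  then have in_S: "Y t = c" if "t \<in> ?S" for t using that by auto
  have "Y t = c" if "t \<in> {0..T}" for t
  proof (rule continuous_constant_on_closure[of ?S Y])
    show "continuous_on (closure ?S) Y" using Y T_pos by simp
    show "t \<in> closure ?S" using that T_pos by simp
  qed (rule in_S)
  from this[OF t] this[of 0] show ?thesis using T_pos by simp
qed

section \<open>Volterra operators\<close>

text \<open>Setting the kernel to 0 for \<open>s > t\<close> moves the variable limit of the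
  convolution into the kernel, which then acts over the fixed interval \<open>[0,T]\<close>; its
  transpose gives \<open>conv_adj\<close>.\<close>

definition volt :: "(real \<Rightarrow> real) \<Rightarrow> real \<Rightarrow> real \<Rightarrow> real" where
  "volt k t s = (if s \<le> t then k (t - s) else 0)"

lemma kernel_volt:
  assumes k: "continuous_on {0..T} k"
  shows "kernel (volt k)"
proof -
  \<comment> \<open>\<open>k\<close> is known to be continuous on \<open>[0,T]\<close> only.
    Clamping the argument gives a function continuous on the whole line that agrees with
    \<open>k\<close> wherever \<open>volt\<close> evaluates it for times in
    \<open>[0,T]\<close>.\<close>
  define k' where "k' u = k (max 0 (min T u))" for u
  have "continuous_on UNIV (\<lambda>u. k (max 0 (min T u)))"
    by (rule continuous_on_compose2[OF k]) (use T_pos in \<open>auto intro!: continuous_intros\<close>)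
  then have k'c: "k' \<in> borel_measurable borel"
    unfolding k'_def by (rule borel_measurable_continuous_onI)
  have id: "(\<lambda>t. t) \<in> borel_measurable MT"
    by (rule continuous_imp_measurable_on_sets_lebesgue) (auto intro: continuous_intros)
  have f[measurable]: "fst \<in> borel_measurable (MT \<Otimes>\<^sub>M MT)" "snd \<in> borel_measurable (MT \<Otimes>\<^sub>M MT)"
    using measurable_compose[OF measurable_fst id] measurable_compose[OF measurable_snd id] by auto
  have "(\<lambda>p. k' (fst p - snd p)) \<in> borel_measurable (MT \<Otimes>\<^sub>M MT)"
    by (rule measurable_compose[OF _ k'c]) measurable
  then have m: "(\<lambda>p. if snd p \<le> fst p then k' (fst p - snd p) else 0) \<in> borel_measurable (MT \<Otimes>\<^sub>M MT)"
    by (rule measurable_If) measurable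
  have "case_prod (volt k) \<in> borel_measurable (MT \<Otimes>\<^sub>M MT)"
    by (rule measurable_cong[THEN iffD1, OF _ m]) (auto simp: space_pair_measure volt_def k'_def)
  moreover have "\<exists>B. \<forall>t\<in>{0..T}. \<forall>s\<in>{0..T}. \<bar>volt k t s\<bar> \<le> B"
  proof -
    obtain B where "\<And>t. t \<in> {0..T} \<Longrightarrow> \<bar>k t\<bar> \<le> B" by (rule continuous_bounded_T[OF k]) blast
    then have "\<bar>volt k t s\<bar> \<le> max B 0" if "t \<in> {0..T}" "s \<in> {0..T}" for t s
      using that by (auto simp: volt_def le_max_iff_disj)
    then show ?thesis by blast
  qed
  ultimately show ?thesis by (simp add: kernel_def)
qed

lemma conv_eq_iop:
  assumes "t \<in> {0..T}"
  shows "conv k z t x = iop (volt k) z t x"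
proof -
  have "(\<lambda>s. indicator {0..t} s *\<^sub>R (k (t - s) *\<^sub>R z s x)) = (\<lambda>s. indicator {0..T} s *\<^sub>R (volt k t s *\<^sub>R z s x))"
    using assms by (auto simp: fun_eq_iff indicator_def volt_def)
  then show ?thesis by (simp add: conv_def iop_def integral_restrict_space)
qed

lemma conv_adj_eq_iop:
  assumes "s \<in> {0..T}"
  shows "conv_adj T k z s x = iop (\<lambda>s t. volt k t s) z s x"
proof -
  have "(\<lambda>t. indicator {s..T} t *\<^sub>R (k (t - s) *\<^sub>R z t x)) = (\<lambda>t. indicator {0..T} t *\<^sub>R (volt k t s *\<^sub>R z t x))"
    using assms by (auto simp: fun_eq_iff indicator_def volt_def)
  then show ?thesis by (simp add: conv_adj_def iop_def integral_restrict_space)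
qed

text \<open>\<open>iop V\<close> integrates over \<open>[0,t]\<close> and \<open>iop V'\<close> over \<open>[t,T]\<close>.\<close>

abbreviation V :: "real \<Rightarrow> real \<Rightarrow> real" where "V \<equiv> volt (\<lambda>_. 1)"
abbreviation V' :: "real \<Rightarrow> real \<Rightarrow> real" where "V' \<equiv> \<lambda>s t. V t s"

lemma kernel_V: "kernel V" "kernel V'"
  using kernel_volt[of "\<lambda>_. 1"] kernel_transpose[of V] by (auto intro: continuous_intros)

text \<open>The indefinite integral \<open>L\<close> of \<open>m\<close> has the same distributional
  derivative as \<open>y\<close>, so \<open>y - L\<close> is constant by
  \<open>du_Bois_Reymond\<close>. The backward form follows since \<open>[0,t]\<close> and
  \<open>[t,T]\<close> make up \<open>[0,T]\<close>.\<close>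

theorem weak_derivative_FTC:
  assumes y: "continuous_on {0..T} y" and m: "integrable MT m"
    and eq: "\<And>\<eta>. \<eta> \<in> test_fun {0<..<T} \<Longrightarrow> (LINT t|MT. pd 1 \<eta> t * y t) = - (LINT t|MT. \<eta> t * m t)"
    and t: "t \<in> {0..T}"
  shows "y t = y 0 + (LINT s|MT. V t s * m s)" "y t = y T - (LINT s|MT. V' t s * m s)"
proof -
  define L where "L t = (LINT s|MT. V t s * m s)" for t
  have mH: "m integrable_on {0..T}" by (rule integrable_on_lebesgue_on[OF m]) simp
  have L: "L t = integral {0..t} m" if "t \<in> {0..T}" for t
  proof -
    have "(\<lambda>s. indicator {0..T} s *\<^sub>R (V t s * m s)) = (\<lambda>s. indicator {0..t} s *\<^sub>R m s)"
      using that by (auto simp: fun_eq_iff indicator_def volt_def)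
    then have "L t = (LINT s|lebesgue_on {0..t}. m s)" by (simp add: L_def integral_restrict_space)
    also have "\<dots> = integral {0..t} m"
    proof (rule lebesgue_integral_eq_integral)
      have "integrable lebesgue (\<lambda>s. indicator {0..T} s *\<^sub>R m s)" using m by (simp add: integrable_restrict_space)
      then have "integrable lebesgue (\<lambda>s. indicator {0..t} s *\<^sub>R (indicator {0..T} s *\<^sub>R m s))"
        by (rule integrable_mult_indicator[rotated]) simp
      moreover have "(\<lambda>s. indicator {0..t} s *\<^sub>R (indicator {0..T} s *\<^sub>R m s)) = (\<lambda>s. indicator {0..t} s *\<^sub>R m s)"
        using that by (auto simp: fun_eq_iff indicator_def)
      ultimately show "integrable (lebesgue_on {0..t}) m" by (simp add: integrable_restrict_space)
    qed simp
    finally show ?thesis .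
  qed
  have Lc: "continuous_on {0..T} L"
    by (rule continuous_on_eq[OF indefinite_integral_continuous_1[OF mH]]) (use L in simp)
  have L0: "L 0 = 0" using L[of 0] T_pos by simp
  \<comment> \<open>Adjointness moves \<open>V\<close> onto the derivative of the test function,
    whose integral over \<open>[s,T]\<close> is \<open>- \<eta> s\<close> because
    \<open>\<eta>\<close> vanishes at \<open>T\<close>.\<close>
  have test: "(LINT t|MT. pd 1 \<eta> t * L t) = - (LINT t|MT. \<eta> t * m t)" if \<eta>: "\<eta> \<in> test_fun {0<..<T}" for \<eta>
  proof -
    note pd = test_fun_pd_real[OF \<eta>]
    have "(LINT t|MT. (LINT s|MT. V t s *\<^sub>R m s) \<bullet> pd 1 \<eta> t) = (LINT s|MT. m s \<bullet> (LINT t|MT. V t s *\<^sub>R pd 1 \<eta> t))"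
      by (rule kernel_adjoint[OF kernel_V(1) m MT.sq_int_imp_integrable[OF test_fun_T_sq_int[OF pd]]])
    moreover have "(LINT t|MT. V t s *\<^sub>R pd 1 \<eta> t) = - \<eta> s" if s: "s \<in> {0..T}" for s
    proof -
      have "(\<lambda>t. indicator {0..T} t *\<^sub>R (V t s *\<^sub>R pd 1 \<eta> t)) = (\<lambda>t. indicator {s..T} t *\<^sub>R pd 1 \<eta> t)"
        using s by (auto simp: fun_eq_iff indicator_def volt_def)
      then have "(LINT t|MT. V t s *\<^sub>R pd 1 \<eta> t) = (LINT t|lebesgue_on {s..T}. pd 1 \<eta> t)"
        by (simp add: integral_restrict_space)
      also have "\<dots> = integral {s..T} (pd 1 \<eta>)"
      proof (rule lebesgue_integral_eq_integral)
        obtain B where B: "\<And>x. \<bar>pd 1 \<eta> x\<bar> \<le> B" by (rule test_fun_bounded[OF pd]) blast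
        show "integrable (lebesgue_on {s..T}) (pd 1 \<eta>)"
          by (rule finite_measure.integrable_const_bound[of _ _ B])
            (use B test_fun_measurable[OF pd] in \<open>auto intro: finite_measure_lebesgue_on\<close>)
      qed simp
      also have "\<dots> = \<eta> T - \<eta> s"
      proof (rule integral_unique[OF fundamental_theorem_of_calculus])
        fix x
        have d: "(\<eta> has_derivative (\<lambda>h. pd h \<eta> x)) (at x)"
          by (rule has_derivative_pd[OF test_fun_differentiable[OF \<eta>]])
        have eq: "(\<lambda>h. pd h \<eta> x) = (\<lambda>h. h *\<^sub>R pd 1 \<eta> x)"
        proof
          fix h show "pd h \<eta> x = h *\<^sub>R pd 1 \<eta> x"
            using linear_scale[OF has_derivative_linear[OF d], of h 1] by simp
        qed
        have "(\<eta> has_vector_derivative pd 1 \<eta> x) (at x)"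
          unfolding has_vector_derivative_def eq[symmetric] by (rule d)
        then show "(\<eta> has_vector_derivative pd 1 \<eta> x) (at x within {s..T})"
          by (rule has_vector_derivative_at_within)
      qed (use s in simp)
      finally show ?thesis using test_fun_endpoints[OF \<eta>, of T] by simp
    qed
    then have "(LINT s|MT. m s \<bullet> (LINT t|MT. V t s *\<^sub>R pd 1 \<eta> t)) = (LINT s|MT. - (\<eta> s * m s))"
      by (intro Bochner_Integration.integral_cong) (auto simp: mult.commute)
    ultimately show ?thesis by (simp add: L_def mult.commute)
  qed
  have main: "y t - L t = y 0" if t: "t \<in> {0..T}" for t
  proof -
    have "y t - L t = y 0 - L 0"
    proof (rule du_Bois_Reymond[OF _ _ t])
      show "continuous_on {0..T} (\<lambda>t. y t - L t)" by (intro continuous_intros y Lc)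
      fix \<eta> assume \<eta>: "\<eta> \<in> test_fun {0<..<T}"
      note pd = test_fun_pd_real[OF \<eta>]
      have "(LINT t|MT. pd 1 \<eta> t * (y t - L t)) = (LINT t|MT. pd 1 \<eta> t * y t) - (LINT t|MT. pd 1 \<eta> t * L t)"
        unfolding right_diff_distrib
        by (intro Bochner_Integration.integral_diff test_fun_mult_integrable pd continuous_integrable_MT y Lc)
      then show "(LINT t|MT. pd 1 \<eta> t * (y t - L t)) = 0" using eq[OF \<eta>] test[OF \<eta>] by simp
    qed
    then show ?thesis using L0 by simp
  qed
  show 1: "y t = y 0 + (LINT s|MT. V t s * m s)" using main[OF t] by (simp add: L_def)
  have "y T = y 0 + L T" using main[of T] T_pos by simp
  moreover have "L T = L t + (LINT s|MT. V' t s * m s)"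
  proof -
    have i: "integrable MT (\<lambda>s. V t s * m s)" "integrable MT (\<lambda>s. V' t s * m s)"
      using kernel_mult_integrable[OF kernel_V(1) t m] kernel_mult_integrable[OF kernel_V(2) t m] by simp_all
    \<comment> \<open>Both kernels are 1 at \<open>s = t\<close>, so this point is counted twice; it
      is a null set.\<close>
    have "L T = (LINT s|MT. V t s * m s + V' t s * m s)" unfolding L_def
    proof (rule integral_cong_AE)
      have "AE s in lebesgue. s \<notin> {t}" by (rule AE_not_in) simp
      then have "AE s in MT. s \<noteq> t" by (subst AE_restrict_space_iff) (auto elim: eventually_mono)
      then show "AE s in MT. V T s * m s = V t s * m s + V' t s * m s" using AE_space
        by eventually_elim (auto simp: volt_def)
      have "T \<in> {0..T}" using T_pos by simp
      from kernel_mult_integrable[OF kernel_V(1) this m]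
      show "(\<lambda>s. V T s * m s) \<in> borel_measurable MT" by simp
    qed (use i in simp)
    then show ?thesis using i by (simp add: L_def)
  qed
  ultimately show "y t = y T - (LINT s|MT. V' t s * m s)" using 1 by (simp add: L_def)
qed

section \<open>Functions of time with values in \<open>L\<^sup>2\<close>\<close>

lemma C_L2_slice: "C_L2 T Om z \<Longrightarrow> t \<in> {0..T} \<Longrightarrow> z t \<in> sq_int MO"
  by (simp add: C_L2_def L2_eq)

lemma C_L2_ip_continuous:
  assumes z: "C_L2 T Om z" and w: "w \<in> sq_int MO"
  shows "continuous_on {0..T} (\<lambda>t. ipM MO (z t) w)"
  unfolding continuous_on_def
proof
  fix t assume t: "t \<in> {0..T}"
  show "((\<lambda>t. ipM MO (z t) w) \<longlongrightarrow> ipM MO (z t) w) (at t within {0..T})"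
  proof (rule sq.tendsto_ip[OF _ C_L2_slice[OF z t] w])
    show "\<forall>\<^sub>F s in at t within {0..T}. z s \<in> sq_int MO"
      unfolding eventually_at_filter using C_L2_slice[OF z] by (auto intro: always_eventually)
    show "((\<lambda>s. nrmM MO (\<lambda>x. z s x - z t x)) \<longlongrightarrow> 0) (at t within {0..T})"
      using z t by (simp add: C_L2_def L2norm_eq)
  qed
qed

lemma C_L2_bounded:
  assumes z: "C_L2 T Om z"
  shows "\<exists>B. \<forall>t\<in>{0..T}. nrmM MO (z t) \<le> B"
proof -
  have "continuous_on {0..T} (\<lambda>t. nrmM MO (z t))"
    unfolding continuous_on_def
  proof
    fix t assume t: "t \<in> {0..T}"
    have "((\<lambda>s. nrmM MO (z s) - nrmM MO (z t)) \<longlongrightarrow> 0) (at t within {0..T})"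
    proof (rule Lim_null_comparison)
      show "((\<lambda>s. nrmM MO (\<lambda>x. z s x - z t x)) \<longlongrightarrow> 0) (at t within {0..T})"
        using z t by (simp add: C_L2_def L2norm_eq)
      show "\<forall>\<^sub>F s in at t within {0..T}. norm (nrmM MO (z s) - nrmM MO (z t)) \<le> nrmM MO (\<lambda>x. z s x - z t x)"
        unfolding eventually_at_filter
        using sq.nrm_diff_le[OF C_L2_slice[OF z] C_L2_slice[OF z t]] by (auto intro: always_eventually)
    qed
    from tendsto_add[OF this tendsto_const[of "nrmM MO (z t)"]]
    show "((\<lambda>s. nrmM MO (z s)) \<longlongrightarrow> nrmM MO (z t)) (at t within {0..T})" by simp
  qed
  then have "bounded ((\<lambda>t. nrmM MO (z t)) ` {0..T})"
    using compact_continuous_image compact_imp_bounded compact_Icc by blast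
  then show ?thesis unfolding bounded_iff by (auto intro: order_trans[OF abs_ge_self])
qed

lemma ST_I_bounded:
  assumes j: "jmeas T Om z" and s: "\<And>t. t \<in> {0..T} \<Longrightarrow> z t \<in> sq_int MO" and B: "\<And>t. t \<in> {0..T} \<Longrightarrow> nrmM MO (z t) \<le> B"
  shows "z \<in> ST"
proof (rule ST_I[OF j])
  show "AE t in MT. z t \<in> sq_int MO" using s by (intro AE_I2) simp
  show "integrable MT (\<lambda>t. (nrmM MO (z t))\<^sup>2)"
  proof (rule MT.integrable_const_bound[of _ "B\<^sup>2"])
    show "AE t in MT. norm ((nrmM MO (z t))\<^sup>2) \<le> B\<^sup>2"
      using B sq.nrm_nonneg[OF s] by (intro AE_I2) (simp add: power_mono)
  qed (rule nrmM_slice_measurable[OF j])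
qed

lemma C_L2_ST: "C_L2 T Om z \<Longrightarrow> z \<in> ST"
  using C_L2_bounded[of z] by (auto intro!: ST_I_bounded C_L2_slice simp: C_L2_def[of T Om z])

text \<open>The derivative is given pointwise in \<open>x\<close>; pairing with a fixed
  \<open>w\<close> makes it a scalar distributional derivative. The time integrals are read as
  \<open>iop\<close> with a kernel constant in its first argument, so that \<open>iop_ip\<close>
  applies.\<close>

lemma has_tderiv_ip:
  assumes z: "z \<in> ST" and v: "v \<in> ST" and d: "has_tderiv T Om z v" and w: "w \<in> sq_int MO"
    and \<eta>: "\<eta> \<in> test_fun {0<..<T}"
  shows "(LINT t|MT. pd 1 \<eta> t * ipM MO (z t) w) = - (LINT t|MT. \<eta> t * ipM MO (v t) w)"
proof -
  note pd = test_fun_pd_real[OF \<eta>]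
  have t0: "0 \<in> {0..T}" using T_pos by simp
  have "AE x in MO. iop (\<lambda>t. pd 1 \<eta>) z 0 x = - iop (\<lambda>t. \<eta>) v 0 x"
    using d \<eta> by (simp add: has_tderiv_def iop_def)
  then have "ipM MO (iop (\<lambda>t. pd 1 \<eta>) z 0) w = ipM MO (\<lambda>x. - iop (\<lambda>t. \<eta>) v 0 x) w"
    using iop_slice[OF kernel_test_fun[OF pd] z t0] iop_slice[OF kernel_test_fun[OF \<eta>] v t0] sq_int_measurable[OF w]
    by (intro ipM_cong_AE) (auto dest: sq_int_measurable)
  also have "\<dots> = - ipM MO (iop (\<lambda>t. \<eta>) v 0) w" by (simp add: ipM_def)
  finally show ?thesis
    by (simp add: iop_ip[OF kernel_test_fun[OF pd] z t0 w] iop_ip[OF kernel_test_fun[OF \<eta>] v t0 w])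
qed

lemma sq_int_eqI:
  assumes "v \<in> sq_int MO" "v' \<in> sq_int MO" "\<And>w. w \<in> sq_int MO \<Longrightarrow> ipM MO v w = ipM MO v' w"
  shows "AE x in MO. v x = v' x"
proof -
  have d: "(\<lambda>x. v x - v' x) \<in> sq_int MO" by (rule sq.diff_mem[OF assms(1,2)])
  have "ipM MO (\<lambda>x. v x - v' x) (\<lambda>x. v x - v' x) = 0"
    using assms(3)[OF d] by (simp add: sq.ip_diff[OF assms(1,2) d])
  then show ?thesis by (simp add: ipM_self_eq_0_iff[OF d])
qed

text \<open>Pairing with an arbitrary \<open>w\<close> reduces the claim to
  \<open>weak_derivative_FTC\<close>, and the pairings determine the function. The representation
  holds at every \<open>t\<close>, so that gradients can later be compared at individual
  times.\<close>

theorem tderiv_integral: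
  assumes z: "C_L2 T Om z" and v: "v \<in> ST" and d: "has_tderiv T Om z v" and t: "t \<in> {0..T}"
  shows "(AE x in MO. z 0 x = 0) \<Longrightarrow> AE x in MO. z t x = iop V v t x"
    and "(AE x in MO. z T x = 0) \<Longrightarrow> AE x in MO. z t x = - iop V' v t x"
proof -
  have ftc: "ipM MO (z t) w = ipM MO (z 0) w + ipM MO (iop V v t) w"
      "ipM MO (z t) w = ipM MO (z T) w - ipM MO (iop V' v t) w" if w: "w \<in> sq_int MO" for w
    using weak_derivative_FTC[OF C_L2_ip_continuous[OF z w] ST_ip_integrable(1)[OF v ST_const_t[OF w]]
        has_tderiv_ip[OF C_L2_ST[OF z] v d w] t]
    by (simp_all add: iop_ip[OF kernel_V(1) v t w] iop_ip[OF kernel_V(2) v t w])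
  have 0: "ipM MO f w = 0" if "AE x in MO. f x = 0" for f w :: "real^'n \<Rightarrow> 'a"
    unfolding ipM_def by (rule integral_eq_zero_AE) (use that in \<open>auto elim: eventually_mono\<close>)
  show "AE x in MO. z t x = iop V v t x" if "AE x in MO. z 0 x = 0"
    by (rule sq_int_eqI[OF C_L2_slice[OF z t] iop_slice[OF kernel_V(1) v t]]) (use ftc(1) 0[OF that] in simp)
  show "AE x in MO. z t x = - iop V' v t x" if "AE x in MO. z T x = 0"
  proof (rule sq_int_eqI[OF C_L2_slice[OF z t]])
    show "(\<lambda>x. - iop V' v t x) \<in> sq_int MO"
      using sq_int_cmult[OF iop_slice[OF kernel_V(2) v t], of "-1"] by simp
    show "ipM MO (z t) w = ipM MO (\<lambda>x. - iop V' v t x) w" if w: "w \<in> sq_int MO" for w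
      using ftc(2)[OF w] 0[OF \<open>AE x in MO. z T x = 0\<close>] by (simp add: ipM_def)
  qed
qed

end

section \<open>Vector fields\<close>

lemma borel_measurable_vecI:
  fixes f :: "'a \<Rightarrow> 'b::euclidean_space^'m"
  assumes "\<And>i. (\<lambda>x. f x $ i) \<in> borel_measurable M"
  shows "f \<in> borel_measurable M"
proof -
  have "(\<lambda>x. f x \<bullet> b) \<in> borel_measurable M" if b: "b \<in> Basis" for b
  proof -
    obtain i c where "b = axis i c" using b unfolding Basis_vec_def by blast
    then have "(\<lambda>x. f x \<bullet> b) = (\<lambda>x. f x $ i \<bullet> c)" by (simp add: inner_axis)
    then show ?thesis using assms[of i] by simp
  qed
  then show ?thesis by (subst borel_measurable_euclidean_space) blast
qed

lemma norm_vec_square: "(norm (v :: 'b::real_normed_vector^'m))\<^sup>2 = (\<Sum>i\<in>UNIV. (norm (v $ i))\<^sup>2)"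
  by (simp add: norm_vec_def L2_set_def sum_nonneg)

lemma sq_int_vecI:
  fixes f :: "'a \<Rightarrow> 'b::euclidean_space^'m"
  assumes "\<And>i. (\<lambda>x. f x $ i) \<in> sq_int M"
  shows "f \<in> sq_int M"
proof -
  have "f \<in> borel_measurable M" by (intro borel_measurable_vecI sq_int_measurable assms)
  moreover have "integrable M (\<lambda>x. \<Sum>i\<in>UNIV. (norm (f x $ i))\<^sup>2)"
    by (intro Bochner_Integration.integrable_sum sq_int_integrable assms)
  ultimately show ?thesis by (simp add: sq_int_def norm_vec_square)
qed

lemma nrmM_vec_le:
  fixes f :: "'a \<Rightarrow> 'b::euclidean_space^'m"
  assumes "f \<in> sq_int M"
  shows "nrmM M f \<le> (\<Sum>i\<in>UNIV. nrmM M (\<lambda>x. f x $ i))"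
proof -
  have "(LINT x|M. (norm (f x))\<^sup>2) = (\<Sum>i\<in>UNIV. LINT x|M. (norm (f x $ i))\<^sup>2)"
    unfolding norm_vec_square
    by (rule Bochner_Integration.integral_sum) (intro sq_int_integrable sq_int_nth assms)
  also have "\<dots> = (\<Sum>i\<in>UNIV. (nrmM M (\<lambda>x. f x $ i))\<^sup>2)" by (simp add: nrmM_eq)
  finally have "nrmM M f = L2_set (\<lambda>i. nrmM M (\<lambda>x. f x $ i)) UNIV" by (simp add: nrmM_eq[of M f] L2_set_def)
  also have "\<dots> \<le> (\<Sum>i\<in>UNIV. nrmM M (\<lambda>x. f x $ i))"
    by (rule L2_set_le_sum) (intro sq.nrm_nonneg sq_int_nth assms)
  finally show ?thesis .
qed

context time_domain
begin

lemma jmeas_vecI: "(\<And>i. jmeas T Om (\<lambda>t x. u t x $ i)) \<Longrightarrow> jmeas T Om u"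
  unfolding jmeas_iff by (rule borel_measurable_vecI) (simp add: case_prod_unfold)

lemma ST_vecI:
  fixes u :: "real \<Rightarrow> real^'n \<Rightarrow> 'b::euclidean_space^'m"
  assumes "\<And>i. (\<lambda>t x. u t x $ i) \<in> ST"
  shows "u \<in> ST"
proof -
  have "case_prod u \<in> sq_int (MT \<Otimes>\<^sub>M MO)"
    by (rule sq_int_vecI) (use assms in \<open>simp add: ST_def case_prod_unfold\<close>)
  then show ?thesis by (simp add: ST_def)
qed

lemma ST_nth: "u \<in> ST \<Longrightarrow> (\<lambda>t x. u t x $ i) \<in> ST"
  using sq_int_nth[of "case_prod u" "MT \<Otimes>\<^sub>M MO" i] by (simp add: ST_def case_prod_unfold)

lemma eventually_within_I: "(\<And>s. s \<in> {0..T} \<Longrightarrow> P s) \<Longrightarrow> \<forall>\<^sub>F s in at t within {0..T}. P s"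
  unfolding eventually_at_filter by (auto intro: always_eventually)

lemma C_H01_slice: "C_H01 T Om z \<Longrightarrow> t \<in> {0..T} \<Longrightarrow> z t \<in> H01 Om"
  by (simp add: C_H01_def)

lemma C_H01_C_L2:
  assumes z: "C_H01 T Om z"
  shows "C_L2 T Om z"
proof -
  have H: "z t \<in> H1 Om" if "t \<in> {0..T}" for t using H01_H1[OF C_H01_slice[OF z that]] .
  have "((\<lambda>s. nrmM MO (\<lambda>x. z s x - z t x)) \<longlongrightarrow> 0) (at t within {0..T})" if t: "t \<in> {0..T}" for t
  proof (rule Lim_null_comparison)
    show "((\<lambda>s. H1norm Om (\<lambda>x. z s x - z t x)) \<longlongrightarrow> 0) (at t within {0..T})"
      using z t by (simp add: C_H01_def)
    show "\<forall>\<^sub>F s in at t within {0..T}. norm (nrmM MO (\<lambda>x. z s x - z t x)) \<le> H1norm Om (\<lambda>x. z s x - z t x)"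
    proof (rule eventually_within_I)
      fix s assume s: "s \<in> {0..T}"
      have D: "(\<lambda>x. z s x - z t x) \<in> H1 Om" by (rule U.H1.diff_mem[OF H[OF s] H[OF t]])
      show "norm (nrmM MO (\<lambda>x. z s x - z t x)) \<le> H1norm Om (\<lambda>x. z s x - z t x)"
        using nrmM_le_H1norm(1)[OF D] sq.nrm_nonneg[OF H1_sq_int[OF D]] by simp
    qed
  qed
  then show ?thesis using z H1_sq_int[OF H] by (simp add: C_L2_def L2_eq L2norm_eq C_H01_def)
qed

lemma C_H01v_C_L2:
  assumes u: "C_H01v T Om u"
  shows "C_L2 T Om u"
proof -
  have c: "C_L2 T Om (\<lambda>t x. u t x $ i)" for i using u C_H01_C_L2 by (simp add: C_H01v_def)
  have s: "u t \<in> sq_int MO" if "t \<in> {0..T}" for t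
    by (rule sq_int_vecI) (rule C_L2_slice[OF c that])
  have "((\<lambda>s. nrmM MO (\<lambda>x. u s x - u t x)) \<longlongrightarrow> 0) (at t within {0..T})" if t: "t \<in> {0..T}" for t
  proof (rule Lim_null_comparison)
    have "((\<lambda>s. \<Sum>i\<in>UNIV. nrmM MO (\<lambda>x. u s x $ i - u t x $ i)) \<longlongrightarrow> (\<Sum>i\<in>(UNIV::'n set). 0)) (at t within {0..T})"
      using c t by (intro tendsto_sum) (simp add: C_L2_def L2norm_eq)
    then show "((\<lambda>s. \<Sum>i\<in>UNIV. nrmM MO (\<lambda>x. u s x $ i - u t x $ i)) \<longlongrightarrow> 0) (at t within {0..T})" by simp
    show "\<forall>\<^sub>F s' in at t within {0..T}. norm (nrmM MO (\<lambda>x. u s' x - u t x)) \<le> (\<Sum>i\<in>UNIV. nrmM MO (\<lambda>x. u s' x $ i - u t x $ i))"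
    proof (rule eventually_within_I)
      fix s' assume s': "s' \<in> {0..T}"
      have D: "(\<lambda>x. u s' x - u t x) \<in> sq_int MO" by (rule sq.diff_mem[OF s[OF s'] s[OF t]])
      show "norm (nrmM MO (\<lambda>x. u s' x - u t x)) \<le> (\<Sum>i\<in>UNIV. nrmM MO (\<lambda>x. u s' x $ i - u t x $ i))"
        using nrmM_vec_le[OF D] sq.nrm_nonneg[OF D] by simp
    qed
  qed
  moreover have "jmeas T Om u" by (rule jmeas_vecI) (use c in \<open>simp add: C_L2_def\<close>)
  ultimately show ?thesis using s by (simp add: C_L2_def L2_eq L2norm_eq)
qed

section \<open>Jointly measurable versions\<close>

text \<open>Heine-Cantor by sequential compactness of \<open>[0,T]\<close>, redone for
  \<open>nrmM\<close>, which is a seminorm on functions and not the metric of their type.\<close>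

lemma uniformly_continuous_L2:
  fixes G :: "real \<Rightarrow> real^'n \<Rightarrow> 'b::euclidean_space"
  assumes G: "\<And>t. t \<in> {0..T} \<Longrightarrow> G t \<in> sq_int MO"
    and cont: "\<And>t. t \<in> {0..T} \<Longrightarrow> ((\<lambda>s. nrmM MO (\<lambda>x. G s x - G t x)) \<longlongrightarrow> 0) (at t within {0..T})"
    and e: "0 < e"
  shows "\<exists>d>0. \<forall>s\<in>{0..T}. \<forall>t\<in>{0..T}. \<bar>s - t\<bar> < d \<longrightarrow> nrmM MO (\<lambda>x. G s x - G t x) < e"
proof (rule ccontr)
  assume c: "\<not> ?thesis"
  define bad where "bad n p \<longleftrightarrow> fst p \<in> {0..T} \<and> snd p \<in> {0..T} \<and> \<bar>fst p - snd p\<bar> < 1 / real (Suc n) \<and>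
      e \<le> nrmM MO (\<lambda>x. G (fst p) x - G (snd p) x)" for n p
  have "\<exists>p. bad n p" for n
  proof -
    have "0 < 1 / real (Suc n)" by simp
    then obtain s t where "s \<in> {0..T}" "t \<in> {0..T}" "\<bar>s - t\<bar> < 1 / real (Suc n)" "\<not> nrmM MO (\<lambda>x. G s x - G t x) < e"
      using c by blast
    then have "bad n (s, t)" by (simp add: bad_def)
    then show ?thesis by blast
  qed
  then have "\<forall>n. \<exists>p. bad n p" by blast
  from choice[OF this] obtain P where P: "\<And>n. bad n (P n)" by blast
  define s t where "s n = fst (P n)" and "t n = snd (P n)" for n
  have st: "s n \<in> {0..T}" "t n \<in> {0..T}" "\<bar>s n - t n\<bar> < 1 / real (Suc n)"
    "e \<le> nrmM MO (\<lambda>x. G (s n) x - G (t n) x)" for n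
    using P[of n] by (simp_all add: bad_def s_def t_def)
  obtain l r where l: "l \<in> {0..T}" and r: "strict_mono r" and lim: "(s \<circ> r) \<longlonglongrightarrow> l"
    using compact_Icc[of 0 T, unfolded compact_def] st(1) by blast
  have "(\<lambda>n. s n - t n) \<longlonglongrightarrow> 0"
  proof (rule Lim_null_comparison)
    show "\<forall>\<^sub>F n in sequentially. norm (s n - t n) \<le> 1 / Suc n" 
      by (intro always_eventually allI) (use st(3) in \<open>simp only: real_norm_def less_imp_le\<close>)
    show "(\<lambda>n. 1 / real (Suc n)) \<longlonglongrightarrow> 0" by (rule LIMSEQ_Suc[OF lim_1_over_n])
  qed
  then have "((\<lambda>n. s n - t n) \<circ> r) \<longlonglongrightarrow> 0" using LIMSEQ_subseq_LIMSEQ r by blast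
  from tendsto_diff[OF lim this] have limt: "(t \<circ> r) \<longlonglongrightarrow> l" by (simp add: o_def)
  obtain d where d: "0 < d" and dl: "\<And>s. s \<in> {0..T} \<Longrightarrow> \<bar>s - l\<bar> < d \<Longrightarrow> s \<noteq> l \<Longrightarrow> nrmM MO (\<lambda>x. G s x - G l x) < e / 2"
  proof -
    have "\<forall>\<^sub>F s in at l within {0..T}. nrmM MO (\<lambda>x. G s x - G l x) < e / 2"
      by (rule order_tendstoD(2)[OF cont[OF l]]) (use e in simp)
    then show ?thesis using that unfolding eventually_at by (auto simp: dist_real_def)
  qed
  \<comment> \<open>The limit at \<open>l\<close> ignores the point \<open>l\<close> itself, where
    the difference is zero.\<close>
  have near: "nrmM MO (\<lambda>x. G s x - G l x) < e / 2" if "s \<in> {0..T}" "\<bar>s - l\<bar> < d" for s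
  proof (cases "s = l")
    case True
    then have "nrmM MO (\<lambda>x. G s x - G l x) = 0" by (simp add: nrmM_eq)
    then show ?thesis using e by simp
  qed (use dl that in blast)
  have "\<forall>\<^sub>F n in sequentially. \<bar>(s \<circ> r) n - l\<bar> < d" "\<forall>\<^sub>F n in sequentially. \<bar>(t \<circ> r) n - l\<bar> < d"
    using tendstoD[OF lim d] tendstoD[OF limt d] by (simp_all add: dist_real_def)
  then have "\<forall>\<^sub>F n in sequentially. \<bar>s (r n) - l\<bar> < d \<and> \<bar>t (r n) - l\<bar> < d" by eventually_elim simp
  then obtain n where n: "\<bar>s (r n) - l\<bar> < d" "\<bar>t (r n) - l\<bar> < d"
    using eventually_happens[of _ sequentially] trivial_limit_sequentially by blast
  note m = G[OF st(1)[of "r n"]] G[OF st(2)[of "r n"]] G[OF l]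
  have "nrmM MO (\<lambda>x. G (s (r n)) x - G (t (r n)) x) \<le>
      nrmM MO (\<lambda>x. G (s (r n)) x - G l x) + nrmM MO (\<lambda>x. G l x - G (t (r n)) x)"
    by (rule sq.nrm_triangle[OF m])
  also have "nrmM MO (\<lambda>x. G l x - G (t (r n)) x) = nrmM MO (\<lambda>x. G (t (r n)) x - G l x)"
    by (rule sq.nrm_minus_commute[OF m(3,2)])
  also have "nrmM MO (\<lambda>x. G (s (r n)) x - G l x) + nrmM MO (\<lambda>x. G (t (r n)) x - G l x) < e"
    using near[OF st(1) n(1)] near[OF st(2) n(2)] by simp
  finally show False using st(4)[of "r n"] by simp
qed

text \<open>The version is a pointwise limit of functions that are piecewise constant in time.\<close>

theorem continuous_version:
  fixes G :: "real \<Rightarrow> real^'n \<Rightarrow> 'b::euclidean_space"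
  assumes G: "\<And>t. t \<in> {0..T} \<Longrightarrow> G t \<in> sq_int MO"
    and cont: "\<And>t. t \<in> {0..T} \<Longrightarrow> ((\<lambda>s. nrmM MO (\<lambda>x. G s x - G t x)) \<longlongrightarrow> 0) (at t within {0..T})"
  shows "\<exists>q. C_L2 T Om q \<and> (\<forall>t\<in>{0..T}. AE x in MO. q t x = G t x)"
proof -
  \<comment> \<open>The rate \<open>(1/2) ^ k\<close>, uniform in time, is what
    \<open>AE_tendsto_if_nrmM_summable\<close> asks for.\<close>
  define good where "good k N \<longleftrightarrow> 0 < N \<and> (\<forall>s\<in>{0..T}. \<forall>t\<in>{0..T}. \<bar>s - t\<bar> < 1 / real N \<longrightarrow>
      nrmM MO (\<lambda>x. G s x - G t x) < (1/2) ^ k)" for k N :: nat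
  have "\<exists>N. good k N" for k
  proof -
    obtain d where d: "0 < d" "\<And>s t. s \<in> {0..T} \<Longrightarrow> t \<in> {0..T} \<Longrightarrow> \<bar>s - t\<bar> < d \<Longrightarrow> nrmM MO (\<lambda>x. G s x - G t x) < (1/2) ^ k"
      using uniformly_continuous_L2[OF G cont, of "(1/2) ^ k"] by auto
    obtain n :: nat where n: "1 / d < n" using reals_Archimedean2 by blast
    have "0 < 1 / d" using d(1) by simp
    with n have n0: "0 < real n" by linarith
    then have "1 / n < d" using n d(1) by (simp add: field_simps)
    then show ?thesis unfolding good_def using d(2) n0 by (intro exI[of _ n]) auto
  qed
  then have "\<forall>k. \<exists>N. good k N" by blast
  from choice[OF this] obtain N where NN: "\<And>k. good k (N k)" by blast
  then have N: "0 < N k" for k by (simp add: good_def)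
  have ND: "nrmM MO (\<lambda>x. G s x - G t x) < (1/2) ^ k" if "s \<in> {0..T}" "t \<in> {0..T}" "\<bar>s - t\<bar> < 1 / N k" for k s t
    using NN[of k] that unfolding good_def by blast
  \<comment> \<open>Rounds \<open>t\<close> down to the grid of mesh \<open>1 / N k\<close>;
    rounding down keeps the value in \<open>[0,T]\<close>.\<close>
  define \<tau> where "\<tau> k t = real_of_int \<lfloor>t * N k\<rfloor> / N k" for k and t :: real
  have \<tau>: "\<tau> k t \<in> {0..T}" "\<bar>\<tau> k t - t\<bar> < 1 / N k" if t: "t \<in> {0..T}" for k t
  proof -
    have le: "real_of_int \<lfloor>t * N k\<rfloor> \<le> t * N k" and gt: "t * N k < real_of_int \<lfloor>t * N k\<rfloor> + 1" by linarith+
    have 1: "\<tau> k t \<le> t" using le N[of k] by (simp add: \<tau>_def pos_divide_le_eq)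
    have "0 \<le> real_of_int \<lfloor>t * N k\<rfloor>" using t by simp
    then have "0 \<le> \<tau> k t" by (simp add: \<tau>_def)
    then show "\<tau> k t \<in> {0..T}" using 1 t by simp
    have "t < (real_of_int \<lfloor>t * N k\<rfloor> + 1) / N k" using gt N[of k] by (simp add: pos_less_divide_eq)
    then have "t - \<tau> k t < 1 / N k" by (simp add: \<tau>_def add_divide_distrib)
    then show "\<bar>\<tau> k t - t\<bar> < 1 / N k" using 1 by simp
  qed
  define Q where "Q k t x = G (\<tau> k t) x" for k t x
  have Qm: "case_prod (Q k) \<in> borel_measurable (MT \<Otimes>\<^sub>M MO)" for k
  proof -
    \<comment> \<open>Indexed by the grid point, so that \<open>Q k\<close> is a selection among
      countably many measurable functions. At grid points outside \<open>[0,T]\<close>, where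
      nothing is known about \<open>G\<close>, the value is 0.\<close>
    define F where "F i p = (if real_of_int i / N k \<in> {0..T} then G (real_of_int i / N k) (snd p) else 0)"
      for i and p :: "real \<times> (real^'n)"
    have F: "F i \<in> borel_measurable (MT \<Otimes>\<^sub>M MO)" for i
    proof (cases "real_of_int i / N k \<in> {0..T}")
      case True
      then show ?thesis unfolding F_def
        using measurable_compose[OF measurable_snd sq_int_measurable[OF G[OF True]]] by simp
    next
      case False
      then have "F i = (\<lambda>p. 0)" unfolding F_def by (intro ext if_not_P)
      then show ?thesis by simp
    qed
    have id: "(\<lambda>t. t * N k) \<in> borel_measurable MT"
      by (rule continuous_imp_measurable_on_sets_lebesgue) (auto intro!: continuous_intros)
    have g: "(\<lambda>p. \<lfloor>fst p * N k\<rfloor>) \<in> measurable (MT \<Otimes>\<^sub>M MO) (count_space UNIV)"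
      using measurable_compose[OF measurable_compose[OF measurable_fst id] measurable_real_floor] .
    have m: "(\<lambda>p. F \<lfloor>fst p * N k\<rfloor> p) \<in> borel_measurable (MT \<Otimes>\<^sub>M MO)"
      by (rule measurable_compose_countable[OF F g])
    show ?thesis
      by (rule measurable_cong[THEN iffD1, OF _ m])
        (use \<tau>(1) in \<open>auto simp: space_pair_measure F_def Q_def \<tau>_def\<close>)
  qed
  define q where "q t x = lim (\<lambda>k. Q k t x)" for t x
  have "(\<lambda>p. lim (\<lambda>k. case_prod (Q k) p)) \<in> borel_measurable (MT \<Otimes>\<^sub>M MO)"
    by (rule borel_measurable_lim_metric) (rule Qm)
  then have qj: "jmeas T Om q" by (simp add: jmeas_iff q_def case_prod_unfold)
  have eq: "AE x in MO. q t x = G t x" if t: "t \<in> {0..T}" for t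
  proof -
    \<comment> \<open>\<open>q\<close> is one pointwise limit for all times; only the exceptional
      null set depends on \<open>t\<close>.\<close>
    have "AE x in MO. (\<lambda>k. Q k t x) \<longlonglongrightarrow> G t x"
    proof (rule MO.AE_tendsto_if_nrmM_summable[OF _ G[OF t]])
      show "Q k t \<in> sq_int MO" for k unfolding Q_def using G[OF \<tau>(1)[OF t]] .
      show "nrmM MO (\<lambda>x. Q k t x - G t x) \<le> (1/2) ^ k" for k
        unfolding Q_def using ND[OF \<tau>(1)[OF t] t \<tau>(2)[OF t]] by (rule less_imp_le)
    qed
    then show ?thesis by eventually_elim (simp add: q_def limI)
  qed
  have qs: "q t \<in> sq_int MO" if t: "t \<in> {0..T}" for t
  proof (rule sq_int_cong_AE[OF G[OF t] _ jmeas_slice_t[OF qj t]])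
    show "AE x in MO. G t x = q t x" using eq[OF t] by eventually_elim simp
  qed
  have "((\<lambda>s. nrmM MO (\<lambda>x. q s x - q t x)) \<longlongrightarrow> 0) (at t within {0..T})" if t: "t \<in> {0..T}" for t
  proof (rule Lim_transform_eventually[OF cont[OF t]], rule eventually_within_I)
    fix s assume s: "s \<in> {0..T}"
    show "nrmM MO (\<lambda>x. G s x - G t x) = nrmM MO (\<lambda>x. q s x - q t x)"
    proof (rule nrmM_cong_AE)
      show "AE x in MO. G s x - G t x = q s x - q t x" using eq[OF s] eq[OF t] by eventually_elim simp
    qed (intro sq_int_measurable sq.diff_mem G qs s t)+
  qed
  then have "C_L2 T Om q" using qj qs by (simp add: C_L2_def L2_eq L2norm_eq)
  then show ?thesis using eq by blast
qed

text \<open>\<open>wgrad\<close> chooses a representative separately at each time, so joint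
  measurability of the gradient is not automatic; it is gained from continuity in time through
  \<open>continuous_version\<close>.\<close>

lemma C_H01_grad:
  assumes z: "C_H01 T Om z"
  shows "\<exists>q. C_L2 T Om q \<and> (\<forall>t\<in>{0..T}. is_weak_grad Om (z t) (q t))"
proof -
  have H: "z t \<in> H1 Om" if "t \<in> {0..T}" for t using H01_H1[OF C_H01_slice[OF z that]] .
  have G: "wgrad Om (z t) \<in> sq_int MO" if "t \<in> {0..T}" for t by (rule wgrad_sq_int[OF H[OF that]])
  have "\<exists>q. C_L2 T Om q \<and> (\<forall>t\<in>{0..T}. AE x in MO. q t x = wgrad Om (z t) x)"
  proof (rule continuous_version[OF G])
    fix t assume t: "t \<in> {0..T}"
    show "((\<lambda>s. nrmM MO (\<lambda>x. wgrad Om (z s) x - wgrad Om (z t) x)) \<longlongrightarrow> 0) (at t within {0..T})"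
    proof (rule Lim_null_comparison)
      show "((\<lambda>s. H1norm Om (\<lambda>x. z s x - z t x)) \<longlongrightarrow> 0) (at t within {0..T})"
        using z t by (simp add: C_H01_def)
      show "\<forall>\<^sub>F s in at t within {0..T}. norm (nrmM MO (\<lambda>x. wgrad Om (z s) x - wgrad Om (z t) x)) \<le> H1norm Om (\<lambda>x. z s x - z t x)"
      proof (rule eventually_within_I)
        fix s assume s: "s \<in> {0..T}"
        have D: "(\<lambda>x. z s x - z t x) \<in> H1 Om" by (rule U.H1.diff_mem[OF H[OF s] H[OF t]])
        have "nrmM MO (\<lambda>x. wgrad Om (z s) x - wgrad Om (z t) x) = nrmM MO (wgrad Om (\<lambda>x. z s x - z t x))"
        proof (rule nrmM_cong_AE)
          show "AE x in MO. wgrad Om (z s) x - wgrad Om (z t) x = wgrad Om (\<lambda>x. z s x - z t x) x"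
            using wgrad_lincomb[OF H[OF s] H[OF t], of 1 "-1"] by eventually_elim simp
        qed (intro sq_int_measurable sq.diff_mem wgrad_sq_int H s t D)+
        then show "norm (nrmM MO (\<lambda>x. wgrad Om (z s) x - wgrad Om (z t) x)) \<le> H1norm Om (\<lambda>x. z s x - z t x)"
          using nrmM_le_H1norm(2)[OF D] sq.nrm_nonneg[OF wgrad_sq_int[OF D]] by simp
      qed
    qed
  qed
  then obtain q where q: "C_L2 T Om q" "\<And>t. t \<in> {0..T} \<Longrightarrow> AE x in MO. q t x = wgrad Om (z t) x" by blast
  have "is_weak_grad Om (z t) (q t)" if t: "t \<in> {0..T}" for t
  proof (rule is_weak_grad_cong_AE[OF wgrad_weak_grad[OF H[OF t]]])
    show "AE x in MO. wgrad Om (z t) x = q t x" using q(2)[OF t] by eventually_elim simp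
    show "q t \<in> borel_measurable MO" by (rule sq_int_measurable[OF C_L2_slice[OF q(1) t]])
  qed (use sq_int_measurable[OF H1_sq_int[OF H[OF t]]] in auto)
  then show ?thesis using q(1) by blast
qed

lemma grad_field_AE_eq:
  assumes "grad_field T Om z q" "grad_field T Om z q'"
  shows "AE t in MT. AE x in MO. q t x = q' t x"
  using assms is_weak_grad_unique unfolding grad_field_def by (auto elim!: eventually_elim2)

text \<open>Any two gradient fields agree almost everywhere, so square integrability carries over
  from the time-continuous version.\<close>

lemma C_H01_grad_field_ST:
  assumes z: "C_H01 T Om z" and q: "grad_field T Om z q"
  shows "q \<in> ST"
proof -
  obtain q' where q': "C_L2 T Om q'" "\<And>t. t \<in> {0..T} \<Longrightarrow> is_weak_grad Om (z t) (q' t)" using C_H01_grad[OF z] by blast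
  have "grad_field T Om z q'" unfolding grad_field_def using q' by (auto simp: C_L2_def intro!: AE_I2)
  from grad_field_AE_eq[OF this q] show ?thesis
    by (rule ST_cong_AE[OF C_L2_ST[OF q'(1)], rotated]) (use q in \<open>simp add: grad_field_def\<close>)
qed

lemma L2_H01_grad:
  assumes z: "L2_H01 T Om z"
  shows "z \<in> ST" "\<exists>q\<in>ST. AE t in MT. is_weak_grad Om (z t) (q t)"
proof -
  obtain q where q: "jmeas T Om q" "AE t in MT. is_weak_grad Om (z t) (q t)"
    using z by (auto simp: L2_H01_def grad_field_def)
  have j: "jmeas T Om z" and H: "AE t in MT. z t \<in> H01 Om" and i: "integrable MT (\<lambda>t. (H1norm Om (z t))\<^sup>2)"
    using z by (auto simp: L2_H01_def)
  show "z \<in> ST"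
  proof (rule ST_I[OF j])
    show "AE t in MT. z t \<in> sq_int MO" using H by eventually_elim (intro H1_sq_int H01_H1)
    show "integrable MT (\<lambda>t. (nrmM MO (z t))\<^sup>2)"
    proof (rule Bochner_Integration.integrable_bound[OF i nrmM_slice_measurable[OF j]])
      show "AE t in MT. norm ((nrmM MO (z t))\<^sup>2) \<le> norm ((H1norm Om (z t))\<^sup>2)"
        using H
      proof eventually_elim
        case (elim t)
        show ?case using nrmM_le_H1norm(1)[OF H01_H1[OF elim]] sq.nrm_nonneg[OF H1_sq_int[OF H01_H1[OF elim]]]
          by (simp add: power_mono)
      qed
    qed
  qed
  have "q \<in> ST"
  proof (rule ST_I[OF q(1)])
    show "AE t in MT. q t \<in> sq_int MO" using q(2) by eventually_elim (rule is_weak_grad_sq_int)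
    show "integrable MT (\<lambda>t. (nrmM MO (q t))\<^sup>2)"
    proof (rule Bochner_Integration.integrable_bound[OF i nrmM_slice_measurable[OF q(1)]])
      show "AE t in MT. norm ((nrmM MO (q t))\<^sup>2) \<le> norm ((H1norm Om (z t))\<^sup>2)"
        using H q(2)
      proof eventually_elim
        case (elim t)
        have "nrmM MO (q t) = nrmM MO (wgrad Om (z t))"
          by (rule nrmM_cong_AE[symmetric, OF wgrad_AE_eq[OF elim(2)]])
            (intro sq_int_measurable wgrad_sq_int H01_H1 elim is_weak_grad_sq_int[OF elim(2)])+
        then show ?case using nrmM_le_H1norm(2)[OF H01_H1[OF elim(1)]] sq.nrm_nonneg[OF wgrad_sq_int[OF H01_H1[OF elim(1)]]]
          by (simp add: power_mono)
      qed
    qed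
  qed
  then show "\<exists>q\<in>ST. AE t in MT. is_weak_grad Om (z t) (q t)" using q(2) by blast
qed

text \<open>A relation in place of the function \<open>wjac\<close>: it admits jointly measurable
  versions of the Jacobian instead of the representatives chosen at each time.\<close>

definition vgrad :: "(real^'n \<Rightarrow> real^'n) \<Rightarrow> (real^'n \<Rightarrow> real^'n^'n) \<Rightarrow> bool" where
  "vgrad u J \<longleftrightarrow> (\<forall>i. is_weak_grad Om (\<lambda>x. u x $ i) (\<lambda>x. J x $ i))"

lemma C_H01v_grad:
  assumes u: "C_H01v T Om u"
  shows "\<exists>J\<in>ST. \<forall>t\<in>{0..T}. vgrad (u t) (J t)"
proof -
  have "\<exists>q. C_L2 T Om q \<and> (\<forall>t\<in>{0..T}. is_weak_grad Om (\<lambda>x. u t x $ i) (q t))" for i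
    using C_H01_grad[of "\<lambda>t x. u t x $ i"] u by (simp add: C_H01v_def)
  then obtain q where q: "\<And>i. C_L2 T Om (q i)" "\<And>i t. t \<in> {0..T} \<Longrightarrow> is_weak_grad Om (\<lambda>x. u t x $ i) (q i t)" by metis
  have "(\<lambda>t x. \<chi> i. q i t x) \<in> ST" by (rule ST_vecI) (use C_L2_ST[OF q(1)] in simp)
  then show ?thesis using q(2) by (intro bexI[of _ "\<lambda>t x. \<chi> i. q i t x"]) (simp_all add: vgrad_def)
qed

lemma L2_H01v_grad:
  assumes u: "L2_H01v T Om u"
  shows "u \<in> ST" "\<exists>J\<in>ST. AE t in MT. vgrad (u t) (J t)"
proof -
  have c: "L2_H01 T Om (\<lambda>t x. u t x $ i)" for i using u by (simp add: L2_H01v_def)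
  show "u \<in> ST" by (rule ST_vecI) (rule L2_H01_grad(1)[OF c])
  have "\<forall>i. \<exists>q. q \<in> ST \<and> (AE t in MT. is_weak_grad Om (\<lambda>x. u t x $ i) (q t))"
    using L2_H01_grad(2)[OF c] by blast
  from choice[OF this] obtain q where q: "\<And>i. q i \<in> ST" "\<And>i. AE t in MT. is_weak_grad Om (\<lambda>x. u t x $ i) (q i t)"
    by blast
  have "(\<lambda>t x. \<chi> i. q i t x) \<in> ST" by (rule ST_vecI) (use q(1) in simp)
  moreover have "AE t in MT. \<forall>i\<in>UNIV. is_weak_grad Om (\<lambda>x. u t x $ i) (q i t)"
    by (intro AE_finite_allI q) simp
  ultimately show "\<exists>J\<in>ST. AE t in MT. vgrad (u t) (J t)"
    by (intro bexI[of _ "\<lambda>t x. \<chi> i. q i t x"]) (simp_all add: vgrad_def)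
qed

section \<open>The elastic bilinear form\<close>

text \<open>Not the physical stress: this tensor represents the integrand of
  \<open>elastic_form\<close>, which thereby becomes one inner product with a linear image of the
  gradient, accessible to kernel operators and Fubini.\<close>

definition stress :: "real \<Rightarrow> real \<Rightarrow> real^'n^'n \<Rightarrow> real^'n^'n" where
  "stress lam mu A = mu *\<^sub>R A + ((lam + mu) * trace A) *\<^sub>R mat 1"

lemma inner_mat_1: "mat 1 \<bullet> (B :: real^'n^'n) = trace B"
  by (simp add: inner_vec_def mat_def trace_def if_distrib[of "\<lambda>c. c * _"] cong: if_cong)

lemma stress_inner: "stress lam mu A \<bullet> B = mu * (A \<bullet> B) + (lam + mu) * (trace A * trace B)"
  by (simp add: stress_def inner_add_left inner_mat_1)

lemma stress_sym: "stress lam mu A \<bullet> B = stress lam mu B \<bullet> A"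
  by (simp only: stress_inner inner_commute[of A B] mult.commute[of "trace A"])

lemma bounded_linear_stress: "bounded_linear (stress lam mu)"
proof -
  have "linear (stress lam mu)"
    by (rule linearI) (simp_all add: stress_def trace_def sum.distrib sum_distrib_left[symmetric] algebra_simps)
  then show ?thesis by (simp add: linear_conv_bounded_linear)
qed

lemma sq_int_linear:
  assumes L: "bounded_linear L" and f: "f \<in> sq_int M"
  shows "(\<lambda>x. L (f x)) \<in> sq_int M"
proof -
  obtain C where C: "\<And>v. norm (L v) \<le> norm v * C" using bounded_linear.bounded[OF L] by blast
  have "L \<in> borel_measurable borel"
    using bounded_linear.continuous_on[OF L continuous_on_id] by (intro borel_measurable_continuous_onI) simp
  from measurable_compose[OF sq_int_measurable[OF f] this] show ?thesis
    by (rule sq_int_bound[OF _ f, where C = C]) (use C in \<open>simp add: mult.commute\<close>)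
qed

lemma ST_linear:
  assumes L: "bounded_linear L" and z: "z \<in> ST"
  shows "(\<lambda>t x. L (z t x)) \<in> ST"
  using sq_int_linear[OF L, of "case_prod z"] z by (simp add: ST_def case_prod_unfold)

lemma vgrad_sq_int: "vgrad u J \<Longrightarrow> J \<in> sq_int MO"
  by (rule sq_int_vecI) (auto simp: vgrad_def intro: is_weak_grad_sq_int)

lemma elastic_form_eq:
  assumes u: "vgrad u J" and \<phi>: "vgrad \<phi> F"
  shows "elastic_form Om lam mu u \<phi> = ipM MO (\<lambda>x. stress lam mu (J x)) F"
proof -
  have J: "J \<in> sq_int MO" and F: "F \<in> sq_int MO" using assms vgrad_sq_int by auto
  have tr: "bounded_linear (trace :: real^'n^'n \<Rightarrow> real)"
    by (simp add: linear_conv_bounded_linear[symmetric] linearI trace_def sum.distrib sum_distrib_left)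
  have ae: "AE x in MO. \<forall>i. wgrad Om (\<lambda>y. w y $ i) x = W x $ i" if "vgrad w W" for w W
  proof -
    have "AE x in MO. \<forall>i\<in>UNIV. wgrad Om (\<lambda>y. w y $ i) x = W x $ i"
      by (intro AE_finite_allI wgrad_AE_eq) (use that in \<open>auto simp: vgrad_def\<close>)
    then show ?thesis by simp
  qed
  have wm: "(\<lambda>x. wgrad Om (\<lambda>y. w y $ i) x) \<in> borel_measurable MO" if "vgrad w W" for w W i
  proof -
    have "is_weak_grad Om (\<lambda>x. w x $ i) (wgrad Om (\<lambda>y. w y $ i))"
      by (rule is_weak_grad_wgrad) (use that in \<open>auto simp: vgrad_def\<close>)
    then show ?thesis by (intro sq_int_measurable is_weak_grad_sq_int)
  qed
  have jac: "AE x in MO. wjac Om w x = W x" "wjac Om w \<in> borel_measurable MO"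
    and div: "AE x in MO. wdiv Om w x = trace (W x)" "wdiv Om w \<in> borel_measurable MO"
    if "vgrad w W" for w W
  proof -
    show "AE x in MO. wjac Om w x = W x" using ae[OF that] by eventually_elim (simp add: wjac_def vec_eq_iff)
    show "AE x in MO. wdiv Om w x = trace (W x)" using ae[OF that] by eventually_elim (simp add: wdiv_def trace_def)
    show "wjac Om w \<in> borel_measurable MO" by (rule borel_measurable_vecI) (simp add: wjac_def wm[OF that])
    have "(\<lambda>x. wgrad Om (\<lambda>y. w y $ i) x \<bullet> axis i 1) \<in> borel_measurable MO" for i
      using wm[OF that, of i] by (intro borel_measurable_inner) auto
    then have "(\<lambda>x. wgrad Om (\<lambda>y. w y $ i) x $ i) \<in> borel_measurable MO" for i by (simp add: inner_axis)
    then show "wdiv Om w \<in> borel_measurable MO" unfolding wdiv_def[abs_def] by (intro borel_measurable_sum)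
  qed
  have "elastic_form Om lam mu u \<phi> = mu * ipM MO J F + (lam + mu) * ipM MO (\<lambda>x. trace (J x)) (\<lambda>x. trace (F x))"
    unfolding elastic_form_def L2ip_eq
    using ipM_cong_AE[OF jac(1)[OF u] jac(1)[OF \<phi>] jac(2)[OF u] _ jac(2)[OF \<phi>]]
      ipM_cong_AE[OF div(1)[OF u] div(1)[OF \<phi>] div(2)[OF u] _ div(2)[OF \<phi>]]
      sq_int_measurable[OF J] sq_int_measurable[OF F]
      sq_int_measurable[OF sq_int_linear[OF tr J]] sq_int_measurable[OF sq_int_linear[OF tr F]] by simp
  also have "\<dots> = ipM MO (\<lambda>x. stress lam mu (J x)) F"
    unfolding ipM_def stress_inner
    using integrable_inner[OF J F] integrable_inner[OF sq_int_linear[OF tr J] sq_int_linear[OF tr F]] by simp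
  finally show ?thesis .
qed

lemma vgrad_lincomb:
  assumes "vgrad u J" "vgrad w W" "u \<in> sq_int MO" "w \<in> sq_int MO"
  shows "vgrad (\<lambda>x. a *\<^sub>R u x + b *\<^sub>R w x) (\<lambda>x. a *\<^sub>R J x + b *\<^sub>R W x)"
  unfolding vgrad_def
  using is_weak_grad_lincomb[OF _ _ sq_int_nth[OF assms(3)] sq_int_nth[OF assms(4)]] assms(1,2)
  by (simp add: vgrad_def)

lemma iop_nth:
  fixes z :: "real \<Rightarrow> real^'n \<Rightarrow> 'b::euclidean_space^'m"
  assumes K: "kernel K" and z: "z \<in> ST"
  shows "AE x in MO. \<forall>t\<in>{0..T}. iop K z t x $ i = iop K (\<lambda>t x. z t x $ i) t x"
  using ST_slice_x[OF z]
proof eventually_elim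
  case (elim x)
  show ?case
  proof
    fix t assume t: "t \<in> {0..T}"
    have "integrable MT (\<lambda>s. K t s *\<^sub>R z s x)"
      by (rule kernel_mult_integrable[OF K t MT.sq_int_imp_integrable[OF elim]])
    from integral_bounded_linear[OF bounded_linear_vec_nth this, of i]
    show "iop K z t x $ i = iop K (\<lambda>t x. z t x $ i) t x" by (simp add: iop_def)
  qed
qed

lemma iop_vgrad:
  assumes K: "kernel K" and u: "u \<in> ST" and J: "J \<in> ST" and g: "AE t in MT. vgrad (u t) (J t)"
    and t: "t \<in> {0..T}"
  shows "vgrad (iop K u t) (iop K J t)"
  unfolding vgrad_def
proof
  fix i
  have "AE t in MT. is_weak_grad Om (\<lambda>x. u t x $ i) (\<lambda>x. J t x $ i)"
    using g by eventually_elim (simp add: vgrad_def)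
  from iop_weak_grad[OF K ST_nth[OF u] ST_nth[OF J] this t]
  show "is_weak_grad Om (\<lambda>x. iop K u t x $ i) (\<lambda>x. iop K J t x $ i)"
  proof (rule is_weak_grad_cong_AE)
    show "AE x in MO. iop K (\<lambda>t x. u t x $ i) t x = iop K u t x $ i"
      using iop_nth[OF K u, of i] by eventually_elim (use t in simp)
    show "AE x in MO. iop K (\<lambda>t x. J t x $ i) t x = iop K J t x $ i"
      using iop_nth[OF K J, of i] by eventually_elim (use t in simp)
  qed (intro sq_int_measurable sq_int_nth iop_slice K t ST_nth u J)+
qed

end

section \<open>Linearity of the forward problem\<close>

lemma (in complete_measure) borel_measurable_cong_AE:
  fixes f g :: "'a \<Rightarrow> 'b::topological_space"
  assumes f: "f \<in> borel_measurable M" and eq: "AE x in M. f x = g x"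
  shows "g \<in> borel_measurable M"
proof (rule measurableI)
  fix S :: "'b set" assume S: "S \<in> sets borel"
  show "g -` S \<inter> space M \<in> sets M"
  proof (rule in_sets_AE)
    show "AE x in M. x \<in> f -` S \<inter> space M \<longleftrightarrow> x \<in> g -` S \<inter> space M"
      using eq by eventually_elim simp
    show "f -` S \<inter> space M \<in> sets M" by (rule measurable_sets[OF f S])
  qed simp
qed simp

context time_domain
begin

lemma complete_MT: "complete_measure MT"
proof
  fix A B assume AB: "A \<subseteq> B" "B \<in> null_sets MT"
  then have B: "B \<subseteq> {0..T}" "B \<in> null_sets lebesgue" by (simp_all add: null_sets_restrict_space)
  then have "A \<in> null_sets lebesgue" using completion.complete2[OF AB(1)] by simp
  then show "A \<in> sets MT" using B AB(1) by (simp add: sets_restrict_space_iff null_setsD2)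
qed

section \<open>Linear combinations in the solution spaces\<close>

lemma jmeas_lincomb:
  assumes "jmeas T Om z" "jmeas T Om w"
  shows "jmeas T Om (\<lambda>t x. a *\<^sub>R z t x + b *\<^sub>R w t x)"
proof -
  have "(\<lambda>p. a *\<^sub>R case_prod z p + b *\<^sub>R case_prod w p) \<in> borel_measurable (MT \<Otimes>\<^sub>M MO)"
    using assms unfolding jmeas_iff by measurable
  then show ?thesis by (simp add: jmeas_iff case_prod_unfold)
qed

lemma C_L2_lincomb:
  assumes z: "C_L2 T Om z" and w: "C_L2 T Om w"
  shows "C_L2 T Om (\<lambda>t x. a *\<^sub>R z t x + b *\<^sub>R w t x)"
proof -
  note s = C_L2_slice[OF z] C_L2_slice[OF w]
  have "((\<lambda>s. nrmM MO (\<lambda>x. (a *\<^sub>R z s x + b *\<^sub>R w s x) - (a *\<^sub>R z t x + b *\<^sub>R w t x))) \<longlongrightarrow> 0) (at t within {0..T})"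
    if t: "t \<in> {0..T}" for t
  proof (rule Lim_null_comparison)
    have "((\<lambda>s. \<bar>a\<bar> * nrmM MO (\<lambda>x. z s x - z t x) + \<bar>b\<bar> * nrmM MO (\<lambda>x. w s x - w t x)) \<longlongrightarrow> \<bar>a\<bar> * 0 + \<bar>b\<bar> * 0) (at t within {0..T})"
      using z w t by (intro tendsto_intros) (simp_all add: C_L2_def L2norm_eq)
    then show "((\<lambda>s. \<bar>a\<bar> * nrmM MO (\<lambda>x. z s x - z t x) + \<bar>b\<bar> * nrmM MO (\<lambda>x. w s x - w t x)) \<longlongrightarrow> 0) (at t within {0..T})"
      by simp
    show "\<forall>\<^sub>F s in at t within {0..T}. norm (nrmM MO (\<lambda>x. (a *\<^sub>R z s x + b *\<^sub>R w s x) - (a *\<^sub>R z t x + b *\<^sub>R w t x)))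
        \<le> \<bar>a\<bar> * nrmM MO (\<lambda>x. z s x - z t x) + \<bar>b\<bar> * nrmM MO (\<lambda>x. w s x - w t x)"
    proof (rule eventually_within_I)
      fix r assume r: "r \<in> {0..T}"
      have D: "(\<lambda>x. z r x - z t x) \<in> sq_int MO" "(\<lambda>x. w r x - w t x) \<in> sq_int MO"
        by (intro sq.diff_mem s r t)+
      have eq: "(\<lambda>x. (a *\<^sub>R z r x + b *\<^sub>R w r x) - (a *\<^sub>R z t x + b *\<^sub>R w t x)) =
          (\<lambda>x. a *\<^sub>R (z r x - z t x) + b *\<^sub>R (w r x - w t x))" by (simp add: algebra_simps)
      show "norm (nrmM MO (\<lambda>x. (a *\<^sub>R z r x + b *\<^sub>R w r x) - (a *\<^sub>R z t x + b *\<^sub>R w t x)))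
          \<le> \<bar>a\<bar> * nrmM MO (\<lambda>x. z r x - z t x) + \<bar>b\<bar> * nrmM MO (\<lambda>x. w r x - w t x)"
        unfolding eq using sq.nrm_lincomb_le[OF D, of a b] sq.nrm_nonneg[OF sq_int_lincomb[OF D, of a b]] by simp
    qed
  qed
  then show ?thesis
    using jmeas_lincomb[of z w a b] z w sq_int_lincomb[OF s, of _ _ a b] by (simp add: C_L2_def L2_eq L2norm_eq)
qed

lemma C_H01_lincomb:
  assumes z: "C_H01 T Om z" and w: "C_H01 T Om w"
  shows "C_H01 T Om (\<lambda>t x. a * z t x + b * w t x)"
proof -
  note s = C_H01_slice[OF z] C_H01_slice[OF w]
  have "((\<lambda>s. H1norm Om (\<lambda>x. (a * z s x + b * w s x) - (a * z t x + b * w t x))) \<longlongrightarrow> 0) (at t within {0..T})"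
    if t: "t \<in> {0..T}" for t
  proof (rule Lim_null_comparison)
    have "((\<lambda>s. \<bar>a\<bar> * H1norm Om (\<lambda>x. z s x - z t x) + \<bar>b\<bar> * H1norm Om (\<lambda>x. w s x - w t x)) \<longlongrightarrow> \<bar>a\<bar> * 0 + \<bar>b\<bar> * 0) (at t within {0..T})"
      using z w t by (intro tendsto_intros) (simp_all add: C_H01_def)
    then show "((\<lambda>s. \<bar>a\<bar> * H1norm Om (\<lambda>x. z s x - z t x) + \<bar>b\<bar> * H1norm Om (\<lambda>x. w s x - w t x)) \<longlongrightarrow> 0) (at t within {0..T})"
      by simp
    show "\<forall>\<^sub>F s in at t within {0..T}. norm (H1norm Om (\<lambda>x. (a * z s x + b * w s x) - (a * z t x + b * w t x)))
        \<le> \<bar>a\<bar> * H1norm Om (\<lambda>x. z s x - z t x) + \<bar>b\<bar> * H1norm Om (\<lambda>x. w s x - w t x)"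
    proof (rule eventually_within_I)
      fix r assume r: "r \<in> {0..T}"
      have D: "(\<lambda>x. z r x - z t x) \<in> H1 Om" "(\<lambda>x. w r x - w t x) \<in> H1 Om"
        by (intro U.H1.diff_mem H01_H1 s r t)+
      have eq: "(\<lambda>x. (a * z r x + b * w r x) - (a * z t x + b * w t x)) =
          (\<lambda>x. a *\<^sub>R (z r x - z t x) + b *\<^sub>R (w r x - w t x))" by (simp add: algebra_simps)
      show "norm (H1norm Om (\<lambda>x. (a * z r x + b * w r x) - (a * z t x + b * w t x)))
          \<le> \<bar>a\<bar> * H1norm Om (\<lambda>x. z r x - z t x) + \<bar>b\<bar> * H1norm Om (\<lambda>x. w r x - w t x)"
        unfolding eq H1norm_eq
        using U.H1.nrm_lincomb_le[OF D, of a b] U.H1.nrm_nonneg[OF U.H1.lincomb_mem[OF D, of a b]] by simp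
    qed
  qed
  then show ?thesis
    using jmeas_lincomb[of z w a b] z w H01_lincomb[OF s, of _ _ a b] by (simp add: C_H01_def)
qed

lemma C_H01v_lincomb:
  assumes "C_H01v T Om z" "C_H01v T Om w"
  shows "C_H01v T Om (\<lambda>t x. a *\<^sub>R z t x + b *\<^sub>R w t x)"
  using assms C_H01_lincomb by (simp add: C_H01v_def)

text \<open>\<open>L2_H01\<close> asks for integrability of a function of time built from chosen
  gradients, whose measurability is not evident. It agrees almost everywhere with the measurable
  function built from \<open>q\<close>, and \<open>MT\<close> is complete.\<close>

lemma L2_H01_I:
  assumes z: "z \<in> ST" and q: "q \<in> ST" and g: "AE t in MT. is_weak_grad Om (z t) (q t)"
    and H: "AE t in MT. z t \<in> H01 Om"
  shows "L2_H01 T Om z"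
proof -
  interpret C: complete_measure MT by (rule complete_MT)
  have i: "integrable MT (\<lambda>t. (nrmM MO (z t))\<^sup>2 + (nrmM MO (q t))\<^sup>2)"
    using ST_integrable_nrm[OF z] ST_integrable_nrm[OF q] by simp
  have eq: "AE t in MT. (nrmM MO (z t))\<^sup>2 + (nrmM MO (q t))\<^sup>2 = (H1norm Om (z t))\<^sup>2"
    using g
  proof eventually_elim
    case (elim t)
    have "is_weak_grad Om (z t) (wgrad Om (z t))" by (rule is_weak_grad_wgrad[OF elim])
    then have "nrmM MO (wgrad Om (z t)) = nrmM MO (q t)"
      by (intro nrmM_cong_AE[OF wgrad_AE_eq[OF elim]] sq_int_measurable is_weak_grad_sq_int[OF elim] is_weak_grad_sq_int)
    then show ?case by (simp add: H1norm_def L2norm_eq)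
  qed
  have "integrable MT (\<lambda>t. (H1norm Om (z t))\<^sup>2)"
    by (rule integrable_cong_AE_imp[OF i C.borel_measurable_cong_AE[OF borel_measurable_integrable[OF i] eq] eq])
  then show ?thesis using ST_jmeas[OF z] ST_jmeas[OF q] g H by (auto simp: L2_H01_def grad_field_def)
qed

lemma L2_H01_lincomb:
  assumes z: "L2_H01 T Om z" and w: "L2_H01 T Om w"
  shows "L2_H01 T Om (\<lambda>t x. a * z t x + b * w t x)"
proof -
  obtain q where q: "q \<in> ST" "AE t in MT. is_weak_grad Om (z t) (q t)" using L2_H01_grad(2)[OF z] by blast
  obtain r where r: "r \<in> ST" "AE t in MT. is_weak_grad Om (w t) (r t)" using L2_H01_grad(2)[OF w] by blast
  note st = L2_H01_grad(1)[OF z] L2_H01_grad(1)[OF w]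
  show ?thesis
  proof (rule L2_H01_I)
    show "(\<lambda>t x. a * z t x + b * w t x) \<in> ST" using ST_lincomb[OF st, of a b] by simp
    show "(\<lambda>t x. a *\<^sub>R q t x + b *\<^sub>R r t x) \<in> ST" by (rule ST_lincomb[OF q(1) r(1)])
    show "AE t in MT. is_weak_grad Om (\<lambda>x. a * z t x + b * w t x) (\<lambda>x. a *\<^sub>R q t x + b *\<^sub>R r t x)"
      using q(2) r(2) ST_slice_t[OF st(1)] ST_slice_t[OF st(2)] by eventually_elim (rule is_weak_grad_lincomb)
    have "AE t in MT. z t \<in> H01 Om" "AE t in MT. w t \<in> H01 Om" using z w by (auto simp: L2_H01_def)
    then show "AE t in MT. (\<lambda>x. a * z t x + b * w t x) \<in> H01 Om" by eventually_elim (rule H01_lincomb)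
  qed
qed

lemma L2_H01v_lincomb:
  assumes "L2_H01v T Om z" "L2_H01v T Om w"
  shows "L2_H01v T Om (\<lambda>t x. a *\<^sub>R z t x + b *\<^sub>R w t x)"
  using assms L2_H01_lincomb by (simp add: L2_H01v_def)

lemma has_tderiv_lincomb:
  assumes z: "z \<in> ST" "v \<in> ST" "has_tderiv T Om z v" and w: "w \<in> ST" "y \<in> ST" "has_tderiv T Om w y"
  shows "has_tderiv T Om (\<lambda>t x. a *\<^sub>R z t x + b *\<^sub>R w t x) (\<lambda>t x. a *\<^sub>R v t x + b *\<^sub>R y t x)"
  unfolding has_tderiv_def
proof
  fix \<eta> assume \<eta>: "\<eta> \<in> test_fun {0<..<T}"
  note pd = test_fun_pd_real[OF \<eta>]
  have 1: "AE x in MO. iop (\<lambda>t. pd 1 \<eta>) z 0 x = - iop (\<lambda>t. \<eta>) v 0 x" "AE x in MO. iop (\<lambda>t. pd 1 \<eta>) w 0 x = - iop (\<lambda>t. \<eta>) y 0 x"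
    using z(3) w(3) \<eta> by (simp_all add: has_tderiv_def iop_def)
  have "AE x in MO. iop (\<lambda>t. pd 1 \<eta>) (\<lambda>t x. a *\<^sub>R z t x + b *\<^sub>R w t x) 0 x = - iop (\<lambda>t. \<eta>) (\<lambda>t x. a *\<^sub>R v t x + b *\<^sub>R y t x) 0 x"
    using 1 iop_lincomb[OF kernel_test_fun[OF pd] z(1) w(1), of a b] iop_lincomb[OF kernel_test_fun[OF \<eta>] z(2) w(2), of a b]
  proof eventually_elim
    case (elim x)
    have "0 \<in> {0..T}" using T_pos by simp
    then show ?case using elim by simp
  qed
  then show "AE x in MO. (LINT t|MT. pd 1 \<eta> t *\<^sub>R (a *\<^sub>R z t x + b *\<^sub>R w t x)) = - (LINT t|MT. \<eta> t *\<^sub>R (a *\<^sub>R v t x + b *\<^sub>R y t x))"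
    by (simp add: iop_def)
qed

lemma grad_field_lincomb:
  assumes "grad_field T Om z q" "grad_field T Om w r" "z \<in> ST" "w \<in> ST"
  shows "grad_field T Om (\<lambda>t x. a * z t x + b * w t x) (\<lambda>t x. a *\<^sub>R q t x + b *\<^sub>R r t x)"
proof -
  have "AE t in MT. is_weak_grad Om (z t) (q t)" "AE t in MT. is_weak_grad Om (w t) (r t)"
    using assms by (auto simp: grad_field_def)
  then have "AE t in MT. is_weak_grad Om (\<lambda>x. a * z t x + b * w t x) (\<lambda>x. a *\<^sub>R q t x + b *\<^sub>R r t x)"
    using ST_slice_t[OF assms(3)] ST_slice_t[OF assms(4)] by eventually_elim (rule is_weak_grad_lincomb)
  then show ?thesis using assms(1,2) jmeas_lincomb[of q r a b] by (simp add: grad_field_def)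
qed

lemma H01v_vgrad: "\<phi> \<in> H01v Om \<Longrightarrow> vgrad \<phi> (wjac Om \<phi>)"
  unfolding vgrad_def wjac_def H01v_def using wgrad_weak_grad[OF H01_H1] by simp

lemma H01v_sq_int: "\<phi> \<in> H01v Om \<Longrightarrow> \<phi> \<in> sq_int MO"
  by (rule sq_int_vecI) (auto simp: H01v_def intro: H1_sq_int H01_H1)

lemma elastic_form_lincomb:
  assumes "u \<in> H01v Om" "w \<in> H01v Om" "\<phi> \<in> H01v Om"
  shows "elastic_form Om lam mu (\<lambda>x. a *\<^sub>R u x + b *\<^sub>R w x) \<phi> =
    a * elastic_form Om lam mu u \<phi> + b * elastic_form Om lam mu w \<phi>"
proof -
  note g = H01v_vgrad[OF assms(1)] H01v_vgrad[OF assms(2)] H01v_vgrad[OF assms(3)]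
  note L = bounded_linear_stress[of lam mu]
  have "elastic_form Om lam mu (\<lambda>x. a *\<^sub>R u x + b *\<^sub>R w x) \<phi> =
      ipM MO (\<lambda>x. a *\<^sub>R stress lam mu (wjac Om u x) + b *\<^sub>R stress lam mu (wjac Om w x)) (wjac Om \<phi>)"
    unfolding elastic_form_eq[OF vgrad_lincomb[OF g(1,2) H01v_sq_int[OF assms(1)] H01v_sq_int[OF assms(2)]] g(3)]
    by (simp add: linear_simps[OF L])
  also have "\<dots> = a * ipM MO (\<lambda>x. stress lam mu (wjac Om u x)) (wjac Om \<phi>) + b * ipM MO (\<lambda>x. stress lam mu (wjac Om w x)) (wjac Om \<phi>)"
    by (intro sq.ip_lincomb sq_int_linear[OF L] vgrad_sq_int[OF g(1)] vgrad_sq_int[OF g(2)] vgrad_sq_int[OF g(3)])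
  finally show ?thesis by (simp add: elastic_form_eq[OF g(1) g(3)] elastic_form_eq[OF g(2) g(3)])
qed

lemma ipM_wgrad_lincomb:
  assumes "v \<in> H1 Om" "w \<in> H1 Om" "\<phi> \<in> sq_int MO"
  shows "ipM MO (wgrad Om (\<lambda>x. a * v x + b * w x)) \<phi> = a * ipM MO (wgrad Om v) \<phi> + b * ipM MO (wgrad Om w) \<phi>"
proof -
  have "ipM MO (wgrad Om (\<lambda>x. a * v x + b * w x)) \<phi> = ipM MO (\<lambda>x. a *\<^sub>R wgrad Om v x + b *\<^sub>R wgrad Om w x) \<phi>"
    by (rule ipM_cong_AE[OF wgrad_lincomb[OF assms(1,2)] AE_I2[OF refl]])
      (intro sq_int_measurable wgrad_sq_int H1_lincomb sq_int_lincomb assms)+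
  also have "\<dots> = a * ipM MO (wgrad Om v) \<phi> + b * ipM MO (wgrad Om w) \<phi>"
    by (intro sq.ip_lincomb wgrad_sq_int assms)
  finally show ?thesis .
qed

lemma C_H01v_slice: "C_H01v T Om u \<Longrightarrow> t \<in> {0..T} \<Longrightarrow> u t \<in> H01v Om"
  by (simp add: C_H01v_def H01v_def C_H01_def)

text \<open>Time derivatives and gradient field of the combination are the combinations of the given
  ones, and then every term of the weak equations is linear. For the gradient and the convolution
  this holds up to null sets, which the inner products do not see.\<close>

theorem forward_solution_lincomb:
  assumes k: "continuous_on {0..T} k" and f: "f1 \<in> sq_int MO" "f2 \<in> sq_int MO"
    and F1: "forward_solution T Om rho Cs kap T0 lam mu \<gamma> k g f1 u1 \<theta>1"
    and F2: "forward_solution T Om rho Cs kap T0 lam mu \<gamma> k g f2 u2 \<theta>2"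
  shows "forward_solution T Om rho Cs kap T0 lam mu \<gamma> k g (\<lambda>x. a * f1 x + b * f2 x)
    (\<lambda>t x. a *\<^sub>R u1 t x + b *\<^sub>R u2 t x) (\<lambda>t x. a * \<theta>1 t x + b * \<theta>2 t x)"
proof -
  obtain v1 w1 \<omega>1 q1 where 1: "C_H01v T Om u1" "has_tderiv T Om u1 v1" "C_L2 T Om v1" "L2_H01v T Om v1"
      "has_tderiv T Om v1 w1" "L2_L2 T Om w1" "C_H01 T Om \<theta>1" "has_tderiv T Om \<theta>1 \<omega>1" "L2_H01 T Om \<omega>1" "grad_field T Om \<theta>1 q1"
    and E1: "AE t in MT. \<forall>\<phi>\<in>H01v Om. \<forall>\<psi>\<in>H01 Om.
           rho * L2ip Om (w1 t) \<phi> + elastic_form Om lam mu (u1 t) \<phi> + \<gamma> * L2ip Om (wgrad Om (\<theta>1 t)) \<phi> = 0 \<and>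
           rho * Cs * L2ip Om (\<omega>1 t) \<psi> + kap * L2ip Om (wgrad Om (\<theta>1 t)) (wgrad Om \<psi>)
             + L2ip Om (conv k q1 t) (wgrad Om \<psi>) - T0 * \<gamma> * L2ip Om (v1 t) (wgrad Om \<psi>)
             = L2ip Om (\<lambda>x. g t * f1 x) \<psi>"
    and I1: "AE x in MO. u1 0 x = 0 \<and> v1 0 x = 0 \<and> \<theta>1 0 x = 0"
    using F1 unfolding forward_solution_def by blast
  obtain v2 w2 \<omega>2 q2 where 2: "C_H01v T Om u2" "has_tderiv T Om u2 v2" "C_L2 T Om v2" "L2_H01v T Om v2"
      "has_tderiv T Om v2 w2" "L2_L2 T Om w2" "C_H01 T Om \<theta>2" "has_tderiv T Om \<theta>2 \<omega>2" "L2_H01 T Om \<omega>2" "grad_field T Om \<theta>2 q2"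
    and E2: "AE t in MT. \<forall>\<phi>\<in>H01v Om. \<forall>\<psi>\<in>H01 Om.
           rho * L2ip Om (w2 t) \<phi> + elastic_form Om lam mu (u2 t) \<phi> + \<gamma> * L2ip Om (wgrad Om (\<theta>2 t)) \<phi> = 0 \<and>
           rho * Cs * L2ip Om (\<omega>2 t) \<psi> + kap * L2ip Om (wgrad Om (\<theta>2 t)) (wgrad Om \<psi>)
             + L2ip Om (conv k q2 t) (wgrad Om \<psi>) - T0 * \<gamma> * L2ip Om (v2 t) (wgrad Om \<psi>)
             = L2ip Om (\<lambda>x. g t * f2 x) \<psi>"
    and I2: "AE x in MO. u2 0 x = 0 \<and> v2 0 x = 0 \<and> \<theta>2 0 x = 0"
    using F2 unfolding forward_solution_def by blast
  note u_ST = C_L2_ST[OF C_H01v_C_L2[OF 1(1)]] C_L2_ST[OF C_H01v_C_L2[OF 2(1)]]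
  note v_ST = C_L2_ST[OF 1(3)] C_L2_ST[OF 2(3)]
  have w_ST: "w1 \<in> ST" "w2 \<in> ST" using 1(6) 2(6) by (simp_all add: L2_L2_iff)
  note \<theta>_ST = C_L2_ST[OF C_H01_C_L2[OF 1(7)]] C_L2_ST[OF C_H01_C_L2[OF 2(7)]]
  note \<omega>_ST = L2_H01_grad(1)[OF 1(9)] L2_H01_grad(1)[OF 2(9)]
  note q_ST = C_H01_grad_field_ST[OF 1(7,10)] C_H01_grad_field_ST[OF 2(7,10)]
  note K = kernel_volt[OF k]
  let ?v = "\<lambda>t x. a *\<^sub>R v1 t x + b *\<^sub>R v2 t x" and ?w = "\<lambda>t x. a *\<^sub>R w1 t x + b *\<^sub>R w2 t x"
  let ?\<omega> = "\<lambda>t x. a * \<omega>1 t x + b * \<omega>2 t x" and ?q = "\<lambda>t x. a *\<^sub>R q1 t x + b *\<^sub>R q2 t x"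
  have td: "has_tderiv T Om (\<lambda>t x. a * \<theta>1 t x + b * \<theta>2 t x) ?\<omega>"
    using has_tderiv_lincomb[OF \<theta>_ST(1) \<omega>_ST(1) 1(8) \<theta>_ST(2) \<omega>_ST(2) 2(8), of a b] by simp
  have "AE t in MT. \<forall>\<phi>\<in>H01v Om. \<forall>\<psi>\<in>H01 Om.
           rho * L2ip Om (?w t) \<phi> + elastic_form Om lam mu (\<lambda>x. a *\<^sub>R u1 t x + b *\<^sub>R u2 t x) \<phi>
             + \<gamma> * L2ip Om (wgrad Om (\<lambda>x. a * \<theta>1 t x + b * \<theta>2 t x)) \<phi> = 0 \<and>
           rho * Cs * L2ip Om (?\<omega> t) \<psi> + kap * L2ip Om (wgrad Om (\<lambda>x. a * \<theta>1 t x + b * \<theta>2 t x)) (wgrad Om \<psi>)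
             + L2ip Om (conv k ?q t) (wgrad Om \<psi>) - T0 * \<gamma> * L2ip Om (?v t) (wgrad Om \<psi>)
             = L2ip Om (\<lambda>x. g t * (a * f1 x + b * f2 x)) \<psi>"
    using E1 E2 ST_slice_t[OF w_ST(1)] ST_slice_t[OF w_ST(2)] ST_slice_t[OF \<omega>_ST(1)] ST_slice_t[OF \<omega>_ST(2)] AE_space
  proof eventually_elim
    case (elim t)
    then have t: "t \<in> {0..T}" by simp
    show ?case
    proof (intro ballI conjI)
      fix \<phi> \<psi> assume \<phi>: "\<phi> \<in> H01v Om" and \<psi>: "\<psi> \<in> H01 Om"
      note \<phi>2 = H01v_sq_int[OF \<phi>] and \<psi>2 = H1_sq_int[OF H01_H1[OF \<psi>]] and g\<psi> = wgrad_sq_int[OF H01_H1[OF \<psi>]]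
      note e1 = elim(1)[rule_format, OF \<phi> \<psi>, unfolded L2ip_eq] and e2 = elim(2)[rule_format, OF \<phi> \<psi>, unfolded L2ip_eq]
      note H\<theta> = H01_H1[OF C_H01_slice[OF 1(7) t]] H01_H1[OF C_H01_slice[OF 2(7) t]]
      have w: "ipM MO (?w t) \<phi> = a * ipM MO (w1 t) \<phi> + b * ipM MO (w2 t) \<phi>" by (rule sq.ip_lincomb[OF elim(3,4) \<phi>2])
      have v: "ipM MO (?v t) (wgrad Om \<psi>) = a * ipM MO (v1 t) (wgrad Om \<psi>) + b * ipM MO (v2 t) (wgrad Om \<psi>)"
        by (rule sq.ip_lincomb[OF C_L2_slice[OF 1(3) t] C_L2_slice[OF 2(3) t] g\<psi>])
      have \<omega>: "ipM MO (?\<omega> t) \<psi> = a * ipM MO (\<omega>1 t) \<psi> + b * ipM MO (\<omega>2 t) \<psi>"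
        using sq.ip_lincomb[OF elim(5,6) \<psi>2, of a b] by simp
      have el: "elastic_form Om lam mu (\<lambda>x. a *\<^sub>R u1 t x + b *\<^sub>R u2 t x) \<phi> =
          a * elastic_form Om lam mu (u1 t) \<phi> + b * elastic_form Om lam mu (u2 t) \<phi>"
        by (rule elastic_form_lincomb[OF C_H01v_slice[OF 1(1) t] C_H01v_slice[OF 2(1) t] \<phi>])
      have f': "ipM MO (\<lambda>x. g t * (a * f1 x + b * f2 x)) \<psi> = a * ipM MO (\<lambda>x. g t * f1 x) \<psi> + b * ipM MO (\<lambda>x. g t * f2 x) \<psi>"
        using sq.ip_lincomb[OF sq_int_cmult[OF f(1), of "g t"] sq_int_cmult[OF f(2), of "g t"] \<psi>2, of a b] by (simp add: algebra_simps)
      have c: "ipM MO (conv k ?q t) (wgrad Om \<psi>) = a * ipM MO (conv k q1 t) (wgrad Om \<psi>) + b * ipM MO (conv k q2 t) (wgrad Om \<psi>)"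
      proof -
        have eta: "conv k r t = iop (volt k) r t" for r :: "real \<Rightarrow> real^'n \<Rightarrow> real^'n"
          by (rule ext) (rule conv_eq_iop[OF t])
        have "ipM MO (iop (volt k) ?q t) (wgrad Om \<psi>) = ipM MO (\<lambda>x. a *\<^sub>R iop (volt k) q1 t x + b *\<^sub>R iop (volt k) q2 t x) (wgrad Om \<psi>)"
        proof (rule ipM_cong_AE)
          show "AE x in MO. iop (volt k) ?q t x = a *\<^sub>R iop (volt k) q1 t x + b *\<^sub>R iop (volt k) q2 t x"
            using iop_lincomb[OF K q_ST, of a b] by eventually_elim (use t in simp)
          show "iop (volt k) ?q t \<in> borel_measurable MO"
            by (intro sq_int_measurable iop_slice K ST_lincomb q_ST t)
          show "(\<lambda>x. a *\<^sub>R iop (volt k) q1 t x + b *\<^sub>R iop (volt k) q2 t x) \<in> borel_measurable MO"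
            by (intro sq_int_measurable sq_int_lincomb iop_slice K q_ST t)
        qed (use sq_int_measurable[OF g\<psi>] in auto)
        also have "\<dots> = a * ipM MO (iop (volt k) q1 t) (wgrad Om \<psi>) + b * ipM MO (iop (volt k) q2 t) (wgrad Om \<psi>)"
          by (intro sq.ip_lincomb iop_slice K q_ST t g\<psi>)
        finally show ?thesis by (simp add: eta)
      qed
      note gr = ipM_wgrad_lincomb[OF H\<theta>, of _ a b]
      have "a * (rho * ipM MO (w1 t) \<phi> + elastic_form Om lam mu (u1 t) \<phi> + \<gamma> * ipM MO (wgrad Om (\<theta>1 t)) \<phi>) +
          b * (rho * ipM MO (w2 t) \<phi> + elastic_form Om lam mu (u2 t) \<phi> + \<gamma> * ipM MO (wgrad Om (\<theta>2 t)) \<phi>) = 0"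
        using e1 e2 by simp
      then show "rho * L2ip Om (?w t) \<phi> + elastic_form Om lam mu (\<lambda>x. a *\<^sub>R u1 t x + b *\<^sub>R u2 t x) \<phi>
             + \<gamma> * L2ip Om (wgrad Om (\<lambda>x. a * \<theta>1 t x + b * \<theta>2 t x)) \<phi> = 0"
        unfolding L2ip_eq w el gr[OF \<phi>2] by (simp add: algebra_simps)
      have "a * (rho * Cs * ipM MO (\<omega>1 t) \<psi> + kap * ipM MO (wgrad Om (\<theta>1 t)) (wgrad Om \<psi>)
             + ipM MO (conv k q1 t) (wgrad Om \<psi>) - T0 * \<gamma> * ipM MO (v1 t) (wgrad Om \<psi>)) +
          b * (rho * Cs * ipM MO (\<omega>2 t) \<psi> + kap * ipM MO (wgrad Om (\<theta>2 t)) (wgrad Om \<psi>)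
             + ipM MO (conv k q2 t) (wgrad Om \<psi>) - T0 * \<gamma> * ipM MO (v2 t) (wgrad Om \<psi>)) =
          a * ipM MO (\<lambda>x. g t * f1 x) \<psi> + b * ipM MO (\<lambda>x. g t * f2 x) \<psi>"
        using e1 e2 by simp
      then show "rho * Cs * L2ip Om (?\<omega> t) \<psi> + kap * L2ip Om (wgrad Om (\<lambda>x. a * \<theta>1 t x + b * \<theta>2 t x)) (wgrad Om \<psi>)
             + L2ip Om (conv k ?q t) (wgrad Om \<psi>) - T0 * \<gamma> * L2ip Om (?v t) (wgrad Om \<psi>)
             = L2ip Om (\<lambda>x. g t * (a * f1 x + b * f2 x)) \<psi>"
        unfolding L2ip_eq \<omega> gr[OF g\<psi>] c v f' by (simp add: algebra_simps)
    qed
  qed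
  moreover have "AE x in MO. a *\<^sub>R u1 0 x + b *\<^sub>R u2 0 x = 0 \<and> ?v 0 x = 0 \<and> a * \<theta>1 0 x + b * \<theta>2 0 x = 0"
    using I1 I2 by eventually_elim simp
  moreover have "L2_L2 T Om ?w" using ST_lincomb[OF w_ST, of a b] by (simp add: L2_L2_iff)
  ultimately show ?thesis
    unfolding forward_solution_def
    using C_H01v_lincomb[OF 1(1) 2(1), of a b] has_tderiv_lincomb[OF u_ST(1) v_ST(1) 1(2) u_ST(2) v_ST(2) 2(2), of a b]
      C_L2_lincomb[OF 1(3) 2(3), of a b] L2_H01v_lincomb[OF 1(4) 2(4), of a b]
      has_tderiv_lincomb[OF v_ST(1) w_ST(1) 1(5) v_ST(2) w_ST(2) 2(5), of a b]
      C_H01_lincomb[OF 1(7) 2(7), of a b] td L2_H01_lincomb[OF 1(9) 2(9), of a b]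
      grad_field_lincomb[OF 1(10) 2(10) \<theta>_ST, of a b]
    by (intro exI[of _ ?v] exI[of _ ?w] exI[of _ ?\<omega>] exI[of _ ?q] conjI)
qed

end

section \<open>The adjoint identity\<close>

context time_domain
begin

lemma LINT_ip_cong:
  assumes st: "z \<in> ST" "z' \<in> ST" "w \<in> ST" "w' \<in> ST"
    and z: "AE t in MT. AE x in MO. z t x = z' t x" and w: "AE t in MT. AE x in MO. w t x = w' t x"
  shows "(LINT t|MT. ipM MO (z t) (w t)) = (LINT t|MT. ipM MO (z' t) (w' t))"
proof (rule integral_cong_AE)
  show "AE t in MT. ipM MO (z t) (w t) = ipM MO (z' t) (w' t)"
    using z w AE_space
  proof eventually_elim
    case (elim t)
    then have t: "t \<in> {0..T}" by simp
    show ?case by (rule ipM_cong_AE[OF elim(1,2)]) (intro jmeas_slice_t[OF ST_jmeas t] st)+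
  qed
qed (use ST_ip_integrable(1)[OF st(1,3)] ST_ip_integrable(1)[OF st(2,4)] in auto)

lemma ipM_commute: "ipM M f g = ipM M g f"
  by (simp add: ipM_def inner_commute)

lemma LINT_ip_commute: "(LINT t|MT. ipM MO (z t) (w t)) = (LINT t|MT. ipM MO (w t) (z t))"
  by (simp add: ipM_def inner_commute)

lemma AE_MT_I: "(\<And>t. t \<in> {0..T} \<Longrightarrow> P t) \<Longrightarrow> AE t in MT. P t"
  by (rule AE_I2) simp

lemma LINT_ip_minus: "(LINT t|MT. ipM MO (z t) (\<lambda>x. - w t x)) = - (LINT t|MT. ipM MO (z t) (w t))"
  by (simp add: ipM_def)

lemma LINT_ip_minus_left: "(LINT t|MT. ipM MO (\<lambda>x. - z t x) (w t)) = - (LINT t|MT. ipM MO (z t) (w t))"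
  by (simp add: ipM_def)

lemma ST_minus: "z \<in> ST \<Longrightarrow> (\<lambda>t x. - z t x) \<in> ST"
  using ST_lincomb[of z z "-1" 0] by simp

text \<open>The vanishing values at 0 and \<open>T\<close> give \<open>z = iop V v\<close> and
  \<open>w = - iop V' y\<close>, and \<open>iop V'\<close> is the adjoint of
  \<open>iop V\<close>.\<close>

lemma integration_by_parts:
  assumes z: "C_L2 T Om z" "v \<in> ST" "has_tderiv T Om z v" "AE x in MO. z 0 x = 0"
    and w: "C_L2 T Om w" "y \<in> ST" "has_tderiv T Om w y" "AE x in MO. w T x = 0"
  shows "(LINT t|MT. ipM MO (v t) (w t)) = - (LINT t|MT. ipM MO (z t) (y t))"
proof -
  have ez: "AE t in MT. AE x in MO. z t x = iop V v t x"
    by (rule AE_MT_I) (rule tderiv_integral(1)[OF z(1-3) _ z(4)])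
  have ew: "AE t in MT. AE x in MO. w t x = - iop V' y t x"
    by (rule AE_MT_I) (rule tderiv_integral(2)[OF w(1-3) _ w(4)])
  note st = iop_ST[OF kernel_V(1) z(2)] iop_ST[OF kernel_V(2) w(2)]
  have "(LINT t|MT. ipM MO (z t) (y t)) = (LINT t|MT. ipM MO (iop V v t) (y t))"
    by (rule LINT_ip_cong[OF C_L2_ST[OF z(1)] st(1) w(2) w(2) ez]) simp
  also have "\<dots> = (LINT t|MT. ipM MO (v t) (iop V' y t))" by (rule iop_adjoint[OF kernel_V(1) z(2) w(2)])
  also have "\<dots> = - (LINT t|MT. ipM MO (v t) (\<lambda>x. - iop V' y t x))" by (simp add: LINT_ip_minus)
  also have "(LINT t|MT. ipM MO (v t) (\<lambda>x. - iop V' y t x)) = (LINT t|MT. ipM MO (v t) (w t))"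
    by (rule LINT_ip_cong[symmetric, OF z(2) z(2) C_L2_ST[OF w(1)] ST_minus[OF st(2)] _ ew]) simp
  finally show ?thesis by simp
qed

text \<open>The second time derivative of \<open>us\<close> only acts on time-independent test functions. Its equation is
  therefore first integrated over \<open>[t,T]\<close>, tested with \<open>ut t\<close>, and then integrated over \<open>t\<close>.\<close>

lemma dual_equation_integrated:
  assumes us: "AE x in MO. vs T x = 0" "C_L2 T Om vs" "has_tderiv_dual T Om vs F" "L2_Hdual T Om F"
    and rho: "rho \<noteq> 0" and S: "S \<in> ST" and p: "p \<in> ST"
    and eq: "AE t in MT. \<forall>\<phi>\<in>H01v Om. rho * F t \<phi> + ipM MO (S t) (wjac Om \<phi>) + c * ipM MO (p t) \<phi> = 0"
    and ut: "L2_H01v T Om ut" "ut \<in> ST" "J \<in> ST" "AE t in MT. vgrad (ut t) (J t)"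
  shows "rho * (LINT t|MT. ipM MO (vs t) (ut t)) =
    (LINT t|MT. ipM MO (S t) (iop V J t)) + c * (LINT t|MT. ipM MO (iop V' p t) (ut t))"
proof -
  \<comment> \<open>Holds for every time and every test function, with no exceptional set left;
    hence \<open>\<phi>\<close> may be replaced by the time-dependent \<open>ut t\<close>
    below.\<close>
  have pt: "rho * ipM MO (vs t) \<phi> = ipM MO (iop V' S t) (wjac Om \<phi>) + c * ipM MO (iop V' p t) \<phi>"
    if \<phi>: "\<phi> \<in> H01v Om" and t: "t \<in> {0..T}" for \<phi> t
  proof -
    note \<phi>2 = H01v_sq_int[OF \<phi>] and \<Phi> = vgrad_sq_int[OF H01v_vgrad[OF \<phi>]]
    \<comment> \<open>The equation solved for \<open>F t \<phi>\<close>; its integrability is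
      evident from that of the terms with \<open>S\<close> and \<open>p\<close>.\<close>
    let ?m = "\<lambda>t. - (1 / rho) * (ipM MO (S t) (wjac Om \<phi>) + c * ipM MO (p t) \<phi>)"
    have i: "integrable MT (\<lambda>t. ipM MO (S t) (wjac Om \<phi>))" "integrable MT (\<lambda>t. ipM MO (p t) \<phi>)"
      using ST_ip_integrable(1)[OF S ST_const_t[OF \<Phi>]] ST_ip_integrable(1)[OF p ST_const_t[OF \<phi>2]] .
    then have mi: "integrable MT ?m" by (intro integrable_mult_right Bochner_Integration.integrable_add)
    have Fm: "(\<lambda>t. F t \<phi>) \<in> borel_measurable MT" using us(4) \<phi> by (simp add: L2_Hdual_def)
    have ae: "AE t in MT. ?m t = F t \<phi>"
      using eq
    proof eventually_elim
      case (elim t)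
      then have "rho * F t \<phi> = - (ipM MO (S t) (wjac Om \<phi>) + c * ipM MO (p t) \<phi>)" using \<phi> by fastforce
      then show ?case using rho by (simp add: field_simps)
    qed
    have Fi: "integrable MT (\<lambda>t. F t \<phi>)" by (rule integrable_cong_AE_imp[OF mi Fm ae])
    have "ipM MO (vs t) \<phi> = ipM MO (vs T) \<phi> - (LINT s|MT. V' t s * F s \<phi>)"
    proof (rule weak_derivative_FTC(2)[OF C_L2_ip_continuous[OF us(2) \<phi>2] Fi _ t])
      fix \<eta> assume "\<eta> \<in> test_fun {0<..<T}"
      then show "(LINT t|MT. pd 1 \<eta> t * ipM MO (vs t) \<phi>) = - (LINT t|MT. \<eta> t * F t \<phi>)"
        using us(3) \<phi> by (simp add: has_tderiv_dual_def L2ip_eq)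
    qed
    moreover have "ipM MO (vs T) \<phi> = 0"
      unfolding ipM_def by (rule integral_eq_zero_AE) (use us(1) in \<open>auto elim: eventually_mono\<close>)
    moreover have "(LINT s|MT. V' t s * F s \<phi>) = (LINT s|MT. V' t s * ?m s)"
    proof (rule integral_cong_AE)
      show "AE s in MT. V' t s * F s \<phi> = V' t s * ?m s" using ae by eventually_elim simp
      show "(\<lambda>s. V' t s * F s \<phi>) \<in> borel_measurable MT" "(\<lambda>s. V' t s * ?m s) \<in> borel_measurable MT"
        by (intro borel_measurable_times kernel_slice[OF kernel_V(2) t] Fm borel_measurable_integrable[OF mi])+
    qed
    moreover have "(LINT s|MT. V' t s * ?m s) =
        - (1 / rho) * (ipM MO (iop V' S t) (wjac Om \<phi>) + c * ipM MO (iop V' p t) \<phi>)"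
    proof -
      have "(\<lambda>s. V' t s * ?m s) = (\<lambda>s. - (1 / rho) * (V' t s * ipM MO (S s) (wjac Om \<phi>) + c * (V' t s * ipM MO (p s) \<phi>)))"
        by (simp add: fun_eq_iff algebra_simps)
      moreover have "integrable MT (\<lambda>s. V' t s * ipM MO (S s) (wjac Om \<phi>))" "integrable MT (\<lambda>s. V' t s * ipM MO (p s) \<phi>)"
        using kernel_mult_integrable[OF kernel_V(2) t i(1)] kernel_mult_integrable[OF kernel_V(2) t i(2)] by simp_all
      ultimately show ?thesis
        by (simp add: iop_ip[OF kernel_V(2) S t \<Phi>] iop_ip[OF kernel_V(2) p t \<phi>2])
    qed
    ultimately show ?thesis using rho by (simp add: field_simps)
  qed
  have H: "AE t in MT. ut t \<in> H01v Om"
  proof -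
    have "AE t in MT. \<forall>i\<in>UNIV. (\<lambda>x. ut t x $ i) \<in> H01 Om"
      by (rule AE_finite_allI) (use ut(1) in \<open>auto simp: L2_H01v_def L2_H01_def\<close>)
    then show ?thesis by (simp add: H01v_def)
  qed
  note st = iop_ST[OF kernel_V(2) S] iop_ST[OF kernel_V(2) p]
  note int = ST_ip_integrable(1)[OF C_L2_ST[OF us(2)] ut(2)] ST_ip_integrable(1)[OF st(1) ut(3)] ST_ip_integrable(1)[OF st(2) ut(2)]
  have "AE t in MT. rho * ipM MO (vs t) (ut t) = ipM MO (iop V' S t) (J t) + c * ipM MO (iop V' p t) (ut t)"
    using H ut(4) AE_space
  proof eventually_elim
    case (elim t)
    then have t: "t \<in> {0..T}" by simp
    have "AE x in MO. \<forall>i\<in>UNIV. wgrad Om (\<lambda>y. ut t y $ i) x = J t x $ i"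
      by (intro AE_finite_allI wgrad_AE_eq) (use elim(2) in \<open>auto simp: vgrad_def\<close>)
    then have "AE x in MO. wjac Om (ut t) x = J t x" by eventually_elim (simp add: wjac_def vec_eq_iff)
    then have "ipM MO (iop V' S t) (wjac Om (ut t)) = ipM MO (iop V' S t) (J t)"
      by (rule ipM_cong_AE[OF AE_I2[OF refl]])
        (intro sq_int_measurable iop_slice kernel_V S t vgrad_sq_int[OF H01v_vgrad[OF elim(1)]] vgrad_sq_int[OF elim(2)])+
    then show ?case using pt[OF elim(1) t] by simp
  qed
  then have "(LINT t|MT. rho * ipM MO (vs t) (ut t)) = (LINT t|MT. ipM MO (iop V' S t) (J t) + c * ipM MO (iop V' p t) (ut t))"
    by (rule integral_cong_AE[rotated 2]) (use int in auto)
  then have "rho * (LINT t|MT. ipM MO (vs t) (ut t)) =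
      (LINT t|MT. ipM MO (iop V' S t) (J t)) + c * (LINT t|MT. ipM MO (iop V' p t) (ut t))"
    using int by simp
  \<comment> \<open>Adjointness moves the time integral from \<open>S\<close> to \<open>J\<close>;
    for a velocity \<open>ut\<close>, the field \<open>iop V J\<close> is the gradient of the
    displacement with initial value 0.\<close>
  also have "(LINT t|MT. ipM MO (iop V' S t) (J t)) = (LINT t|MT. ipM MO (S t) (iop V J t))"
    by (rule iop_adjoint[OF kernel_V(2) S ut(3)])
  finally show ?thesis .
qed

text \<open>Four equations are integrated over time: the forward heat equation tested with
  \<open>\<theta>s\<close>, the adjoint one with \<open>\<theta>\<close>, the forward elastic
  equation with \<open>us\<close>, and the adjoint elastic equation, after integration over
  \<open>[t,T]\<close>, with the velocity \<open>ut\<close>. The factor \<open>T0\<close> in the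
  latter matches the one in the forward heat equation, so that the coupling terms cancel.\<close>

theorem adjoint_identity:
  assumes k: "continuous_on {0..T} k" and g: "continuous_on {0..T} g" and rho: "rho \<noteq> 0"
    and h: "h \<in> sq_int MO" and A: "A \<in> sq_int MO"
    and fwd: "forward_solution T Om rho Cs kap T0 lam mu \<gamma> k g h u \<theta>"
    and adj: "adjoint_solution T Om rho Cs kap T0 lam mu \<gamma> k A us \<theta>s"
  shows "ipM MO A (\<lambda>x. LINT t|MT. \<theta> t x) = ipM MO (\<lambda>x. LINT t|MT. g t * \<theta>s t x) h"
    and "(\<lambda>x. LINT t|MT. g t * \<theta>s t x) \<in> sq_int MO"
proof -
  obtain ut utt \<theta>t q where f: "C_H01v T Om u" "has_tderiv T Om u ut" "C_L2 T Om ut" "L2_H01v T Om ut"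
      "has_tderiv T Om ut utt" "L2_L2 T Om utt" "C_H01 T Om \<theta>" "has_tderiv T Om \<theta> \<theta>t" "L2_H01 T Om \<theta>t" "grad_field T Om \<theta> q"
    and FE: "AE t in MT. \<forall>\<phi>\<in>H01v Om. \<forall>\<psi>\<in>H01 Om.
           rho * L2ip Om (utt t) \<phi> + elastic_form Om lam mu (u t) \<phi> + \<gamma> * L2ip Om (wgrad Om (\<theta> t)) \<phi> = 0 \<and>
           rho * Cs * L2ip Om (\<theta>t t) \<psi> + kap * L2ip Om (wgrad Om (\<theta> t)) (wgrad Om \<psi>)
             + L2ip Om (conv k q t) (wgrad Om \<psi>) - T0 * \<gamma> * L2ip Om (ut t) (wgrad Om \<psi>)
             = L2ip Om (\<lambda>x. g t * h x) \<psi>"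
    and "AE x in MO. u 0 x = 0 \<and> ut 0 x = 0 \<and> \<theta> 0 x = 0"
    using fwd unfolding forward_solution_def by blast
  then have f0: "AE x in MO. u 0 x = 0" "AE x in MO. ut 0 x = 0" "AE x in MO. \<theta> 0 x = 0"
    by (auto elim: eventually_mono)
  obtain vs F \<omega>s qs where s: "C_H01v T Om us" "has_tderiv T Om us vs" "C_L2 T Om vs" "has_tderiv_dual T Om vs F" "L2_Hdual T Om F"
      "C_H01 T Om \<theta>s" "has_tderiv T Om \<theta>s \<omega>s" "L2_H01 T Om \<omega>s" "grad_field T Om \<theta>s qs"
    and SE: "AE t in MT. \<forall>\<phi>\<in>H01v Om. \<forall>\<psi>\<in>H01 Om.
           rho * F t \<phi> + elastic_form Om lam mu (us t) \<phi> + \<gamma> * T0 * L2ip Om (wgrad Om (\<omega>s t)) \<phi> = 0 \<and>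
           - (rho * Cs * L2ip Om (\<omega>s t) \<psi>) + kap * L2ip Om (wgrad Om (\<theta>s t)) (wgrad Om \<psi>)
             + L2ip Om (conv_adj T k qs t) (wgrad Om \<psi>) + \<gamma> * L2ip Om (us t) (wgrad Om \<psi>)
             = L2ip Om A \<psi>"
    and "AE x in MO. us T x = 0 \<and> vs T x = 0 \<and> \<theta>s T x = 0"
    using adj unfolding adjoint_solution_def by blast
  then have s0: "AE x in MO. us T x = 0" "AE x in MO. vs T x = 0" "AE x in MO. \<theta>s T x = 0"
    by (auto elim: eventually_mono)
  have utt: "utt \<in> ST" using f(6) by (simp add: L2_L2_iff)
  note us_ST = C_L2_ST[OF C_H01v_C_L2[OF s(1)]]
  note ut_ST = C_L2_ST[OF f(3)] and vs_ST = C_L2_ST[OF s(3)]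
  note \<theta>_C = C_H01_C_L2[OF f(7)] and \<theta>s_C = C_H01_C_L2[OF s(6)]
  note \<theta>_ST = C_L2_ST[OF \<theta>_C] and \<theta>s_ST = C_L2_ST[OF \<theta>s_C]
  note \<theta>t_ST = L2_H01_grad(1)[OF f(9)] and \<omega>s_ST = L2_H01_grad(1)[OF s(8)]
  note q_ST = C_H01_grad_field_ST[OF f(7,10)] and qs_ST = C_H01_grad_field_ST[OF s(6,9)]
  note K = kernel_volt[OF k]
  let ?KT = "\<lambda>s t. volt k t s"
  obtain J where J: "J \<in> ST" "AE t in MT. vgrad (ut t) (J t)" using L2_H01v_grad(2)[OF f(4)] by blast
  obtain Js where Js: "Js \<in> ST" "\<And>t. t \<in> {0..T} \<Longrightarrow> vgrad (us t) (Js t)" using C_H01v_grad[OF s(1)] by blast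
  obtain p where p: "p \<in> ST" "AE t in MT. is_weak_grad Om (\<omega>s t) (p t)" using L2_H01_grad(2)[OF s(8)] by blast
  define S where "S t x = stress lam mu (Js t x)" for t x
  have S: "S \<in> ST" unfolding S_def by (rule ST_linear[OF bounded_linear_stress Js(1)])
  have gq: "AE t in MT. is_weak_grad Om (\<theta> t) (q t)" and gqs: "AE t in MT. is_weak_grad Om (\<theta>s t) (qs t)"
    using f(10) s(9) by (auto simp: grad_field_def)

  have us_t: "AE x in MO. u t x = iop V ut t x" if "t \<in> {0..T}" for t
    by (rule tderiv_integral(1)[OF C_H01v_C_L2[OF f(1)] ut_ST f(2) that f0(1)])
  \<comment> \<open>With \<open>iop V J\<close> as gradient of \<open>u\<close>, the elastic terms
    of both elastic equations become the same number \<open>Im S (iop V J)\<close>.\<close>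
  have vu: "vgrad (u t) (iop V J t)" if t: "t \<in> {0..T}" for t
  proof -
    have "vgrad (iop V ut t) (iop V J t)" by (rule iop_vgrad[OF kernel_V(1) ut_ST J t])
    moreover have "is_weak_grad Om (\<lambda>x. u t x $ i) (\<lambda>x. iop V J t x $ i)"
      if w: "is_weak_grad Om (\<lambda>x. iop V ut t x $ i) (\<lambda>x. iop V J t x $ i)" for i
    proof (rule is_weak_grad_cong_AE[OF w])
      show "AE x in MO. iop V ut t x $ i = u t x $ i" using us_t[OF t] by eventually_elim simp
    qed (auto intro!: sq_int_measurable sq_int_nth iop_slice kernel_V ut_ST J t C_L2_slice[OF C_H01v_C_L2[OF f(1)]])
    ultimately show ?thesis by (simp add: vgrad_def)
  qed
  \<comment> \<open>The gradient of \<open>\<theta>s\<close>, expressed by integrating the gradient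
    \<open>p\<close> of its time derivative back from \<open>T\<close>; this identifies the coupling
    term produced by \<open>dual_equation_integrated\<close>.\<close>
  have qs_t: "AE t in MT. AE x in MO. qs t x = - iop V' p t x"
    using gqs AE_space
  proof eventually_elim
    case (elim t)
    then have t: "t \<in> {0..T}" by simp
    have \<omega>: "iop V' \<omega>s t \<in> sq_int MO" by (rule iop_slice[OF kernel_V(2) \<omega>s_ST t])
    have "is_weak_grad Om (iop V' \<omega>s t) (iop V' p t)" by (rule iop_weak_grad[OF kernel_V(2) \<omega>s_ST p t])
    from is_weak_grad_lincomb[OF this this \<omega> \<omega>, of "-1" 0]
    have "is_weak_grad Om (\<lambda>x. - iop V' \<omega>s t x) (\<lambda>x. - iop V' p t x)" by simp
    then have "is_weak_grad Om (\<theta>s t) (\<lambda>x. - iop V' p t x)"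
    proof (rule is_weak_grad_cong_AE)
      show "AE x in MO. - iop V' \<omega>s t x = \<theta>s t x"
        using tderiv_integral(2)[OF \<theta>s_C \<omega>s_ST s(7) t s0(3)] by eventually_elim simp
      show "\<theta>s t \<in> borel_measurable MO" by (rule sq_int_measurable[OF C_L2_slice[OF \<theta>s_C t]])
      show "(\<lambda>x. - iop V' \<omega>s t x) \<in> borel_measurable MO" "(\<lambda>x. - iop V' p t x) \<in> borel_measurable MO"
        using sq_int_measurable[OF \<omega>] sq_int_measurable[OF iop_slice[OF kernel_V(2) p(1) t]] by auto
    qed simp
    from is_weak_grad_unique[OF elim(1) this] show ?case .
  qed

  define I where "I z w = (LINT t|MT. ipM MO (z t) (w t))" for z w :: "real \<Rightarrow> real^'n \<Rightarrow> real"
  define Iv where "Iv z w = (LINT t|MT. ipM MO (z t) (w t))" for z w :: "real \<Rightarrow> real^'n \<Rightarrow> real^'n"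
  define Im where "Im z w = (LINT t|MT. ipM MO (z t) (w t))" for z w :: "real \<Rightarrow> real^'n \<Rightarrow> real^'n^'n"

  have parts1: "I \<theta>t \<theta>s = - I \<theta> \<omega>s" unfolding I_def
    by (rule integration_by_parts[OF \<theta>_C \<theta>t_ST f(8) f0(3) \<theta>s_C \<omega>s_ST s(7) s0(3)])
  have parts2: "Iv utt us = - Iv ut vs" unfolding Iv_def
    by (rule integration_by_parts[OF f(3) utt f(5) f0(2) C_H01v_C_L2[OF s(1)] vs_ST s(2) s0(1)])
  have conv: "Iv (iop (volt k) q) qs = Iv q (iop ?KT qs)" unfolding Iv_def by (rule iop_adjoint[OF K q_ST qs_ST])

  have kg: "kernel (\<lambda>t. g)"
  proof -
    obtain B where "\<And>t. t \<in> {0..T} \<Longrightarrow> \<bar>g t\<bar> \<le> B" by (rule continuous_bounded_T[OF g]) blast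
    then show ?thesis
      by (intro kernel_const[of _ B] continuous_imp_measurable_on_sets_lebesgue g) auto
  qed
  have k1: "kernel (\<lambda>t s. 1)" by (rule kernel_const[of _ 1]) auto
  have t0: "0 \<in> {0..T}" using T_pos by simp
  have g_iop: "iop (\<lambda>t. g) \<theta>s 0 = (\<lambda>x. LINT t|MT. g t * \<theta>s t x)"
    and one_iop: "iop (\<lambda>t s. 1) \<theta> 0 = (\<lambda>x. LINT t|MT. \<theta> t x)"
    by (simp_all add: iop_def fun_eq_iff)
  have gi: "integrable MT (\<lambda>t. g t * ipM MO (\<theta>s t) h)"
    using kernel_mult_integrable[OF kg t0 ST_ip_integrable(1)[OF \<theta>s_ST ST_const_t[OF h]]] by simp
  have R: "ipM MO (\<lambda>x. LINT t|MT. g t * \<theta>s t x) h = (LINT t|MT. g t * ipM MO (\<theta>s t) h)"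
    using iop_ip[OF kg \<theta>s_ST t0 h] by (simp add: g_iop)
  have "ipM MO (\<lambda>x. LINT t|MT. \<theta> t x) A = (LINT t|MT. ipM MO (\<theta> t) A)"
    using iop_ip[OF k1 \<theta>_ST t0 A] by (simp add: one_iop)
  then have L: "ipM MO A (\<lambda>x. LINT t|MT. \<theta> t x) = I \<theta> (\<lambda>t. A)"
    by (simp add: I_def ipM_def mult.commute)
  show "(\<lambda>x. LINT t|MT. g t * \<theta>s t x) \<in> sq_int MO"
    using iop_slice[OF kg \<theta>s_ST t0] by (simp add: g_iop)

  note ii = ST_ip_integrable(1)
  \<comment> \<open>Replaces the chosen gradients in the weak equations by the jointly measurable
    versions \<open>q\<close>, \<open>qs\<close> and \<open>p\<close>, so that the terms can be
    integrated over time.\<close>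
  have wg: "ipM MO w (wgrad Om z) = ipM MO w r" "ipM MO (wgrad Om z) w = ipM MO r w"
    if g: "is_weak_grad Om z r" and w: "w \<in> sq_int MO" for z r w
  proof -
    have m: "wgrad Om z \<in> borel_measurable MO"
      by (rule sq_int_measurable[OF is_weak_grad_sq_int[OF is_weak_grad_wgrad[OF g]]])
    note ms = m sq_int_measurable[OF is_weak_grad_sq_int[OF g]] sq_int_measurable[OF w]
    show "ipM MO w (wgrad Om z) = ipM MO w r" "ipM MO (wgrad Om z) w = ipM MO r w"
      by (rule ipM_cong_AE[OF AE_I2[OF refl] wgrad_AE_eq[OF g]] ipM_cong_AE[OF wgrad_AE_eq[OF g] AE_I2[OF refl]]; rule ms)+
  qed

  have F2: "rho * Cs * I \<theta>t \<theta>s + kap * Iv q qs + Iv (iop (volt k) q) qs - T0 * \<gamma> * Iv ut qs = (LINT t|MT. g t * ipM MO (\<theta>s t) h)"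
  proof -
    have "AE t in MT. rho * Cs * ipM MO (\<theta>t t) (\<theta>s t) + kap * ipM MO (q t) (qs t) + ipM MO (iop (volt k) q t) (qs t)
        - T0 * \<gamma> * ipM MO (ut t) (qs t) = g t * ipM MO (\<theta>s t) h"
      using FE gq gqs AE_space
    proof eventually_elim
      case (elim t)
      then have t: "t \<in> {0..T}" by simp
      have c: "conv k q t = iop (volt k) q t" by (rule ext) (rule conv_eq_iop[OF t])
      have m: "wgrad Om (\<theta>s t) \<in> sq_int MO" by (rule wgrad_sq_int[OF H01_H1[OF C_H01_slice[OF s(6) t]]])
      \<comment> \<open>The weak equations are quantified over both test functions jointly, so a
        vector-valued one has to be supplied as well.\<close>
      have "us t \<in> H01v Om" by (rule C_H01v_slice[OF s(1) t])
      then have "rho * Cs * L2ip Om (\<theta>t t) (\<theta>s t) + kap * L2ip Om (wgrad Om (\<theta> t)) (wgrad Om (\<theta>s t))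
             + L2ip Om (conv k q t) (wgrad Om (\<theta>s t)) - T0 * \<gamma> * L2ip Om (ut t) (wgrad Om (\<theta>s t))
             = L2ip Om (\<lambda>x. g t * h x) (\<theta>s t)"
        using elim(1) C_H01_slice[OF s(6) t] by blast
      moreover have "ipM MO (\<lambda>x. g t * h x) (\<theta>s t) = g t * ipM MO (\<theta>s t) h"
        by (simp add: ipM_def mult.assoc mult.commute[of "h _"])
      ultimately show ?case
        by (simp add: L2ip_eq c wg(2)[OF elim(2) m] wg(1)[OF elim(3) is_weak_grad_sq_int[OF elim(2)]]
            wg(1)[OF elim(3) iop_slice[OF K q_ST t]] wg(1)[OF elim(3) C_L2_slice[OF f(3) t]])
    qed
    then have "(LINT t|MT. rho * Cs * ipM MO (\<theta>t t) (\<theta>s t) + kap * ipM MO (q t) (qs t) + ipM MO (iop (volt k) q t) (qs t)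
        - T0 * \<gamma> * ipM MO (ut t) (qs t)) = (LINT t|MT. g t * ipM MO (\<theta>s t) h)"
      by (rule integral_cong_AE[rotated 2])
        (use ii[OF \<theta>t_ST \<theta>s_ST] ii[OF q_ST qs_ST] ii[OF iop_ST[OF K q_ST] qs_ST] ii[OF ut_ST qs_ST] gi in auto)
    then show ?thesis unfolding I_def Iv_def
      using ii[OF \<theta>t_ST \<theta>s_ST] ii[OF q_ST qs_ST] ii[OF iop_ST[OF K q_ST] qs_ST] ii[OF ut_ST qs_ST] by simp
  qed

  have A2: "- (rho * Cs * I \<theta> \<omega>s) + kap * Iv q qs + Iv q (iop ?KT qs) + \<gamma> * Iv q us = I \<theta> (\<lambda>t. A)"
  proof -
    note L = kernel_transpose[OF K]
    have "AE t in MT. - (rho * Cs * ipM MO (\<theta> t) (\<omega>s t)) + kap * ipM MO (q t) (qs t) + ipM MO (q t) (iop ?KT qs t)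
        + \<gamma> * ipM MO (q t) (us t) = ipM MO (\<theta> t) A"
      using SE gq gqs AE_space
    proof eventually_elim
      case (elim t)
      then have t: "t \<in> {0..T}" by simp
      have c: "conv_adj T k qs t = iop ?KT qs t" by (rule ext) (rule conv_adj_eq_iop[OF t])
      have m: "wgrad Om (\<theta> t) \<in> sq_int MO" by (rule wgrad_sq_int[OF H01_H1[OF C_H01_slice[OF f(7) t]]])
      have "us t \<in> H01v Om" by (rule C_H01v_slice[OF s(1) t])
      then have "- (rho * Cs * L2ip Om (\<omega>s t) (\<theta> t)) + kap * L2ip Om (wgrad Om (\<theta>s t)) (wgrad Om (\<theta> t))
             + L2ip Om (conv_adj T k qs t) (wgrad Om (\<theta> t)) + \<gamma> * L2ip Om (us t) (wgrad Om (\<theta> t)) = L2ip Om A (\<theta> t)"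
        using elim(1) C_H01_slice[OF f(7) t] by blast
      then have "- (rho * Cs * ipM MO (\<omega>s t) (\<theta> t)) + kap * ipM MO (qs t) (q t)
             + ipM MO (iop ?KT qs t) (q t) + \<gamma> * ipM MO (us t) (q t) = ipM MO A (\<theta> t)"
        by (simp add: L2ip_eq c wg(2)[OF elim(3) m] wg(1)[OF elim(2) is_weak_grad_sq_int[OF elim(3)]]
            wg(1)[OF elim(2) iop_slice[OF L qs_ST t]] wg(1)[OF elim(2) C_L2_slice[OF C_H01v_C_L2[OF s(1)] t]])
      then show ?case by (simp only: ipM_commute[where f = "\<theta> t"] ipM_commute[where f = "q t"])
    qed
    then have "(LINT t|MT. - (rho * Cs * ipM MO (\<theta> t) (\<omega>s t)) + kap * ipM MO (q t) (qs t) + ipM MO (q t) (iop ?KT qs t)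
        + \<gamma> * ipM MO (q t) (us t)) = (LINT t|MT. ipM MO (\<theta> t) A)"
      by (rule integral_cong_AE[rotated 2])
        (use ii[OF \<theta>_ST \<omega>s_ST] ii[OF q_ST qs_ST] ii[OF q_ST iop_ST[OF L qs_ST]] ii[OF q_ST us_ST] ii[OF \<theta>_ST ST_const_t[OF A]] in auto)
    then show ?thesis unfolding I_def Iv_def
      using ii[OF \<theta>_ST \<omega>s_ST] ii[OF q_ST qs_ST] ii[OF q_ST iop_ST[OF L qs_ST]] ii[OF q_ST us_ST] by simp
  qed

  have F1: "rho * Iv utt us + Im S (iop V J) + \<gamma> * Iv q us = 0"
  proof -
    have "AE t in MT. rho * ipM MO (utt t) (us t) + ipM MO (S t) (iop V J t) + \<gamma> * ipM MO (q t) (us t) = 0"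
      using FE gq AE_space
    proof eventually_elim
      case (elim t)
      then have t: "t \<in> {0..T}" by simp
      \<comment> \<open>Symmetry moves \<open>stress\<close> from the gradient of \<open>u\<close>
        to that of \<open>us\<close>, which makes the term agree with the one in
        \<open>A1\<close>.\<close>
      have el: "elastic_form Om lam mu (u t) (us t) = ipM MO (S t) (iop V J t)"
        unfolding elastic_form_eq[OF vu[OF t] Js(2)[OF t]] S_def ipM_def by (simp add: stress_sym)
      have "rho * L2ip Om (utt t) (us t) + elastic_form Om lam mu (u t) (us t) + \<gamma> * L2ip Om (wgrad Om (\<theta> t)) (us t) = 0"
        using elim(1) C_H01v_slice[OF s(1) t] C_H01_slice[OF s(6) t] by blast
      then show ?case by (simp add: L2ip_eq el wg(2)[OF elim(2) C_L2_slice[OF C_H01v_C_L2[OF s(1)] t]])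
    qed
    then have "(LINT t|MT. rho * ipM MO (utt t) (us t) + ipM MO (S t) (iop V J t) + \<gamma> * ipM MO (q t) (us t)) = (LINT t|MT. 0)"
      by (rule integral_cong_AE[rotated 2])
        (use ii[OF utt us_ST] ii[OF S iop_ST[OF kernel_V(1) J(1)]] ii[OF q_ST us_ST] in auto)
    then show ?thesis unfolding Iv_def Im_def
      using ii[OF utt us_ST] ii[OF S iop_ST[OF kernel_V(1) J(1)]] ii[OF q_ST us_ST] by simp
  qed

  have A1: "rho * Iv ut vs = Im S (iop V J) - \<gamma> * T0 * Iv ut qs"
  proof -
    have "AE t in MT. \<forall>\<phi>\<in>H01v Om. rho * F t \<phi> + ipM MO (S t) (wjac Om \<phi>) + \<gamma> * T0 * ipM MO (p t) \<phi> = 0"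
      using SE p(2) AE_space
    proof eventually_elim
      case (elim t)
      then have t: "t \<in> {0..T}" by simp
      show ?case
      proof
        fix \<phi> assume \<phi>: "\<phi> \<in> H01v Om"
        have el: "elastic_form Om lam mu (us t) \<phi> = ipM MO (S t) (wjac Om \<phi>)"
          unfolding elastic_form_eq[OF Js(2)[OF t] H01v_vgrad[OF \<phi>]] S_def ..
        have "rho * F t \<phi> + elastic_form Om lam mu (us t) \<phi> + \<gamma> * T0 * L2ip Om (wgrad Om (\<omega>s t)) \<phi> = 0"
          using elim(1) \<phi> C_H01_slice[OF s(6) t] by blast
        then show "rho * F t \<phi> + ipM MO (S t) (wjac Om \<phi>) + \<gamma> * T0 * ipM MO (p t) \<phi> = 0"
          by (simp add: L2ip_eq el wg(2)[OF elim(2) H01v_sq_int[OF \<phi>]])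
      qed
    qed
    from dual_equation_integrated[OF s0(2) s(3,4,5) rho S p(1) this f(4) ut_ST J]
    have "rho * Iv vs ut = Im S (iop V J) + \<gamma> * T0 * Iv (iop V' p) ut" by (simp add: Iv_def Im_def)
    moreover have "Iv (iop V' p) ut = - Iv qs ut"
    proof -
      have "Iv qs ut = (LINT t|MT. ipM MO (\<lambda>x. - iop V' p t x) (ut t))"
        unfolding Iv_def by (rule LINT_ip_cong[OF qs_ST ST_minus[OF iop_ST[OF kernel_V(2) p(1)]] ut_ST ut_ST qs_t]) simp
      then show ?thesis by (simp add: LINT_ip_minus_left Iv_def)
    qed
    moreover have "Iv vs ut = Iv ut vs" "Iv qs ut = Iv ut qs" unfolding Iv_def by (rule LINT_ip_commute)+
    ultimately show ?thesis by simp
  qed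
  \<comment> \<open>Subtracting \<open>F2\<close> from \<open>A2\<close> leaves the sum of the two
    coupling terms; \<open>F1\<close>, \<open>A1\<close> and \<open>parts2\<close> show that this
    sum is zero.\<close>
  have "I \<theta> (\<lambda>t. A) = (LINT t|MT. g t * ipM MO (\<theta>s t) h)"
    using F2 A2 F1 A1 parts1 parts2 conv by (simp add: algebra_simps)
  then show "ipM MO A (\<lambda>x. LINT t|MT. \<theta> t x) = ipM MO (\<lambda>x. LINT t|MT. g t * \<theta>s t x) h"
    unfolding L R .
qed

end

section \<open>The gradient of the cost functional\<close>

locale inverse_source = time_domain Om T for Om :: "(real^'n) set" and T :: real +
  fixes rho Cs kap T0 lam mu \<gamma> \<beta> :: real and k g :: "real \<Rightarrow> real"
    and u :: "(real^'n \<Rightarrow> real) \<Rightarrow> real \<Rightarrow> real^'n \<Rightarrow> real^'n"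
    and \<theta> :: "(real^'n \<Rightarrow> real) \<Rightarrow> real \<Rightarrow> real^'n \<Rightarrow> real"
    and \<Psi> f :: "real^'n \<Rightarrow> real"
  assumes k_cont: "continuous_on {0..T} k" and g_cont: "continuous_on {0..T} g" and rho: "rho \<noteq> 0"
    and fwd: "\<And>h. h \<in> L2 Om \<Longrightarrow> forward_solution T Om rho Cs kap T0 lam mu \<gamma> k g h (u h) (\<theta> h)"
    and fwd_unique: "\<And>h u' \<theta>'. h \<in> L2 Om \<Longrightarrow>
          forward_solution T Om rho Cs kap T0 lam mu \<gamma> k g h u' \<theta>' \<Longrightarrow> same_pair T Om u' \<theta>' (u h) (\<theta> h)"
    and adj: "\<And>h. h \<in> L2 Om \<Longrightarrow> \<exists>us \<theta>s. adjoint_solution T Om rho Cs kap T0 lam mu \<gamma> k h us \<theta>s"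
    and \<Psi>: "\<Psi> \<in> L2 Om" and f: "f \<in> L2 Om"
begin

abbreviation "P \<equiv> measurement T \<theta>"
abbreviation "residual x \<equiv> P f x - \<Psi> x"

section \<open>Linearity of the solution operator and of the measurement\<close>

lemma fwd_regular:
  assumes "h \<in> sq_int MO"
  shows "C_H01v T Om (u h)" "C_H01 T Om (\<theta> h)" "\<theta> h \<in> ST"
  using fwd[of h] assms C_L2_ST[OF C_H01_C_L2] by (auto simp: forward_solution_def L2_eq)

lemma fwd_lincomb:
  assumes h: "h1 \<in> sq_int MO" "h2 \<in> sq_int MO" and t: "t \<in> {0..T}"
  shows "AE x in MO. u (\<lambda>x. a * h1 x + b * h2 x) t x = a *\<^sub>R u h1 t x + b *\<^sub>R u h2 t x \<and>
    \<theta> (\<lambda>x. a * h1 x + b * h2 x) t x = a * \<theta> h1 t x + b * \<theta> h2 t x"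
proof -
  have "(\<lambda>x. a * h1 x + b * h2 x) \<in> L2 Om" using sq_int_lincomb[OF h, of a b] by (simp add: L2_eq)
  moreover have "forward_solution T Om rho Cs kap T0 lam mu \<gamma> k g (\<lambda>x. a * h1 x + b * h2 x)
      (\<lambda>t x. a *\<^sub>R u h1 t x + b *\<^sub>R u h2 t x) (\<lambda>t x. a * \<theta> h1 t x + b * \<theta> h2 t x)"
    by (rule forward_solution_lincomb[OF k_cont h]) (use fwd h in \<open>simp_all add: L2_eq\<close>)
  ultimately have "same_pair T Om (\<lambda>t x. a *\<^sub>R u h1 t x + b *\<^sub>R u h2 t x) (\<lambda>t x. a * \<theta> h1 t x + b * \<theta> h2 t x)
      (u (\<lambda>x. a * h1 x + b * h2 x)) (\<theta> (\<lambda>x. a * h1 x + b * h2 x))"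
    by (rule fwd_unique)
  then have "AE x in MO. a *\<^sub>R u h1 t x + b *\<^sub>R u h2 t x = u (\<lambda>x. a * h1 x + b * h2 x) t x \<and>
      a * \<theta> h1 t x + b * \<theta> h2 t x = \<theta> (\<lambda>x. a * h1 x + b * h2 x) t x"
    using t by (simp add: same_pair_def)
  then show ?thesis by eventually_elim simp
qed

lemma kernel_one: "kernel (\<lambda>t s. 1)"
  by (rule kernel_const[of _ 1]) auto

lemma P_eq_iop: "P h x = iop (\<lambda>t s. 1) (\<theta> h) 0 x"
  by (simp add: measurement_def iop_def)

lemma zero_mem_T: "0 \<in> {0..T}"
  using T_pos by simp

lemma P_sq_int: "h \<in> sq_int MO \<Longrightarrow> P h \<in> sq_int MO"
  using iop_slice[OF kernel_one fwd_regular(3) zero_mem_T, of h]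
  unfolding P_eq_iop[symmetric, THEN ext[of "iop (\<lambda>t s. 1) (\<theta> h) 0"]] .

lemma P_lincomb:
  assumes h: "h1 \<in> sq_int MO" "h2 \<in> sq_int MO"
  shows "AE x in MO. P (\<lambda>x. a * h1 x + b * h2 x) x = a * P h1 x + b * P h2 x"
proof -
  let ?h = "\<lambda>x. a * h1 x + b * h2 x"
  have hh: "?h \<in> sq_int MO" using sq_int_lincomb[OF h, of a b] by simp
  note st = fwd_regular(3)[OF h(1)] fwd_regular(3)[OF h(2)] fwd_regular(3)[OF hh]
  have "AE t in MT. AE x in MO. \<theta> ?h t x = a *\<^sub>R \<theta> h1 t x + b *\<^sub>R \<theta> h2 t x"
  proof (rule AE_MT_I)
    fix t assume "t \<in> {0..T}"
    from fwd_lincomb[OF h this, of a b] show "AE x in MO. \<theta> ?h t x = a *\<^sub>R \<theta> h1 t x + b *\<^sub>R \<theta> h2 t x"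
      by eventually_elim simp
  qed
  from iop_cong_AE[OF ST_jmeas[OF st(3)] ST_jmeas[OF ST_lincomb[OF st(1,2)]] this kernel_one]
    iop_lincomb[OF kernel_one st(1,2), of a b]
  show ?thesis by eventually_elim (use zero_mem_T in \<open>simp add: P_eq_iop\<close>)
qed

section \<open>Difference quotients and variations\<close>

lemma difference_quotient:
  assumes \<delta>: "\<delta> \<in> sq_int MO" and e: "e \<noteq> 0" and t: "t \<in> {0..T}"
  shows "AE x in MO. (1 / e) *\<^sub>R (u (\<lambda>y. f y + e * \<delta> y) t x - u f t x) = u \<delta> t x"
    and "AE x in MO. (1 / e) * (\<theta> (\<lambda>y. f y + e * \<delta> y) t x - \<theta> f t x) = \<theta> \<delta> t x"
proof -
  have "f \<in> sq_int MO" using f by (simp add: L2_eq)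
  from fwd_lincomb[OF this \<delta> t, of 1 e]
  have *: "AE x in MO. u (\<lambda>y. f y + e * \<delta> y) t x = u f t x + e *\<^sub>R u \<delta> t x \<and>
      \<theta> (\<lambda>y. f y + e * \<delta> y) t x = \<theta> f t x + e * \<theta> \<delta> t x" by simp
  from * show "AE x in MO. (1 / e) *\<^sub>R (u (\<lambda>y. f y + e * \<delta> y) t x - u f t x) = u \<delta> t x"
    by eventually_elim (use e in simp)
  from * show "AE x in MO. (1 / e) * (\<theta> (\<lambda>y. f y + e * \<delta> y) t x - \<theta> f t x) = \<theta> \<delta> t x"
    by eventually_elim (use e in simp)
qed

lemma perturbed_sq_int: "\<delta> \<in> sq_int MO \<Longrightarrow> (\<lambda>y. f y + e * \<delta> y) \<in> sq_int MO"
  using sq_int_lincomb[of f MO \<delta> 1 e] f by (simp add: L2_eq)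

lemma C_H01_slice_measurable: "C_H01 T Om z \<Longrightarrow> t \<in> {0..T} \<Longrightarrow> z t \<in> borel_measurable MO"
  by (intro sq_int_measurable H1_sq_int H01_H1 C_H01_slice)

lemma variation_exists:
  assumes \<delta>: "\<delta> \<in> sq_int MO"
  shows "is_variation T Om u \<theta> f \<delta> (u \<delta>) (\<theta> \<delta>)"
proof -
  have f': "f \<in> sq_int MO" using f by (simp add: L2_eq)
  have m\<theta>: "\<theta> h t \<in> borel_measurable MO" if "h \<in> sq_int MO" "t \<in> {0..T}" for h t
    using C_H01_slice_measurable[OF fwd_regular(2)[OF that(1)] that(2)] .
  have mu': "(\<lambda>x. u h t x $ i) \<in> borel_measurable MO" if "h \<in> sq_int MO" "t \<in> {0..T}" for h t i
    using C_H01_slice_measurable[of "\<lambda>t x. u h t x $ i"] fwd_regular(1)[OF that(1)] that(2) by (simp add: C_H01v_def)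
  have 1: "H1norm Om (\<lambda>x. (1 / e) * (\<theta> (\<lambda>y. f y + e * \<delta> y) t x - \<theta> f t x) - \<theta> \<delta> t x) = 0"
    if "e \<noteq> 0" "t \<in> {0..T}" for e t
  proof (rule H1norm_AE_0)
    show "AE x in MO. (1 / e) * (\<theta> (\<lambda>y. f y + e * \<delta> y) t x - \<theta> f t x) - \<theta> \<delta> t x = 0"
      using difference_quotient(2)[OF \<delta> that] by eventually_elim simp
  qed (intro borel_measurable_diff borel_measurable_times borel_measurable_const m\<theta> perturbed_sq_int f' \<delta> that)
  have 2: "H1normv Om (\<lambda>x. (1 / e) *\<^sub>R (u (\<lambda>y. f y + e * \<delta> y) t x - u f t x) - u \<delta> t x) = 0"
    if "e \<noteq> 0" "t \<in> {0..T}" for e t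
  proof -
    have "H1norm Om (\<lambda>x. ((1 / e) *\<^sub>R (u (\<lambda>y. f y + e * \<delta> y) t x - u f t x) - u \<delta> t x) $ i) = 0" for i
    proof (rule H1norm_AE_0)
      show "AE x in MO. ((1 / e) *\<^sub>R (u (\<lambda>y. f y + e * \<delta> y) t x - u f t x) - u \<delta> t x) $ i = 0"
        using difference_quotient(1)[OF \<delta> that] by eventually_elim simp
      have "(\<lambda>x. (1 / e) * (u (\<lambda>y. f y + e * \<delta> y) t x $ i - u f t x $ i) - u \<delta> t x $ i) \<in> borel_measurable MO"
        by (intro borel_measurable_diff borel_measurable_times borel_measurable_const mu' perturbed_sq_int f' \<delta> that)
      then show "(\<lambda>x. ((1 / e) *\<^sub>R (u (\<lambda>y. f y + e * \<delta> y) t x - u f t x) - u \<delta> t x) $ i) \<in> borel_measurable MO"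
        by simp
    qed
    then show ?thesis by (simp add: H1normv_def)
  qed
  have ev: "uniform_limit {0..T} F (\<lambda>t. 0) (at 0)" if "\<And>e t. e \<noteq> 0 \<Longrightarrow> t \<in> {0..T} \<Longrightarrow> F e t = 0"
    for F :: "real \<Rightarrow> real \<Rightarrow> real"
    unfolding uniform_limit_iff
  proof (intro allI impI)
    fix r :: real assume "0 < r"
    then show "\<forall>\<^sub>F e in at 0. \<forall>t\<in>{0..T}. dist (F e t) 0 < r"
      unfolding eventually_at_filter using that by (intro always_eventually allI impI ballI) simp
  qed
  show ?thesis
    unfolding is_variation_def
    by (intro conjI fwd_regular(1,2)[OF \<delta>] ev) ((rule 1 2; assumption)+)
qed

text \<open>Up to null sets the difference quotient is the same function for every
  \<open>e \<noteq> 0\<close>, so its distance from \<open>\<delta>\<theta>\<close> is constant in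
  \<open>e\<close>; tending to 0, it is zero.\<close>

lemma variation_unique:
  assumes \<delta>: "\<delta> \<in> sq_int MO" and var: "is_variation T Om u \<theta> f \<delta> \<delta>u \<delta>\<theta>" and t: "t \<in> {0..T}"
  shows "AE x in MO. \<delta>\<theta> t x = \<theta> \<delta> t x"
proof -
  have f': "f \<in> sq_int MO" using f by (simp add: L2_eq)
  have C: "C_H01 T Om \<delta>\<theta>" and lim: "uniform_limit {0..T}
       (\<lambda>e t. H1norm Om (\<lambda>x. (1 / e) * (\<theta> (\<lambda>y. f y + e * \<delta> y) t x - \<theta> f t x) - \<delta>\<theta> t x)) (\<lambda>t. 0) (at 0)"
    using var by (auto simp: is_variation_def)
  have m\<theta>: "\<theta> h t \<in> borel_measurable MO" if "h \<in> sq_int MO" for h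
    using C_H01_slice_measurable[OF fwd_regular(2)[OF that] t] .
  have D: "(\<lambda>x. \<theta> \<delta> t x - \<delta>\<theta> t x) \<in> H1 Om"
    by (intro U.H1.diff_mem H01_H1 C_H01_slice C fwd_regular \<delta> t)
  have eq: "H1norm Om (\<lambda>x. (1 / e) * (\<theta> (\<lambda>y. f y + e * \<delta> y) t x - \<theta> f t x) - \<delta>\<theta> t x) = H1norm Om (\<lambda>x. \<theta> \<delta> t x - \<delta>\<theta> t x)"
    if "e \<noteq> 0" for e
  proof (rule H1norm_cong_AE)
    show "AE x in MO. (1 / e) * (\<theta> (\<lambda>y. f y + e * \<delta> y) t x - \<theta> f t x) - \<delta>\<theta> t x = \<theta> \<delta> t x - \<delta>\<theta> t x"
      using difference_quotient(2)[OF \<delta> that t] by eventually_elim simp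
  qed (intro borel_measurable_diff borel_measurable_times borel_measurable_const m\<theta> perturbed_sq_int f' \<delta>
      C_H01_slice_measurable[OF C t])+
  have "((\<lambda>e. H1norm Om (\<lambda>x. (1 / e) * (\<theta> (\<lambda>y. f y + e * \<delta> y) t x - \<theta> f t x) - \<delta>\<theta> t x)) \<longlongrightarrow> 0) (at 0)"
    by (rule tendsto_uniform_limitI[OF lim t])
  then have "((\<lambda>e. H1norm Om (\<lambda>x. \<theta> \<delta> t x - \<delta>\<theta> t x)) \<longlongrightarrow> 0) (at (0::real))"
    by (rule Lim_transform_eventually) (unfold eventually_at_filter, intro always_eventually allI impI, rule eq)
  then have "H1norm Om (\<lambda>x. \<theta> \<delta> t x - \<delta>\<theta> t x) = 0" by (simp add: tendsto_const_iff)
  then have "nrmM MO (\<lambda>x. \<theta> \<delta> t x - \<delta>\<theta> t x) = 0"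
    using nrmM_le_H1norm(1)[OF D] sq.nrm_nonneg[OF H1_sq_int[OF D]] by simp
  then have "AE x in MO. \<theta> \<delta> t x - \<delta>\<theta> t x = 0" using nrmM_eq_0_iff[OF H1_sq_int[OF D]] by simp
  then show ?thesis by eventually_elim simp
qed

section \<open>The derivative of the cost functional and its representing elements\<close>

definition D :: "(real^'n \<Rightarrow> real) \<Rightarrow> real" where
  "D \<delta> = ipM MO (P \<delta>) residual + \<beta> * ipM MO f \<delta>"

lemma residual_sq_int: "residual \<in> sq_int MO"
  using f \<Psi> by (intro sq.diff_mem P_sq_int) (simp_all add: L2_eq)

lemma cost_gateaux:
  assumes \<delta>: "\<delta> \<in> sq_int MO"
  shows "has_gateaux_deriv (cost T Om \<theta> \<Psi> \<beta>) f \<delta> (D \<delta>)"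
proof -
  have f': "f \<in> sq_int MO" and \<Psi>': "\<Psi> \<in> sq_int MO" using f \<Psi> by (simp_all add: L2_eq)
  note P\<delta> = P_sq_int[OF \<delta>]
  define Q where "Q = ipM MO (P \<delta>) (P \<delta>) / 2 + \<beta> / 2 * ipM MO \<delta> \<delta>"
  have c: "cost T Om \<theta> \<Psi> \<beta> h = ipM MO (\<lambda>x. P h x - \<Psi> x) (\<lambda>x. P h x - \<Psi> x) / 2 + \<beta> / 2 * ipM MO h h" for h
    by (simp add: cost_def L2norm_eq nrmM_power2)
  have ex: "cost T Om \<theta> \<Psi> \<beta> (\<lambda>x. f x + e * \<delta> x) = cost T Om \<theta> \<Psi> \<beta> f + e * D \<delta> + e\<^sup>2 * Q" for e
  proof -
    \<comment> \<open>The measurement is linear only up to null sets, so the expansion in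
      \<open>e\<close> is carried out inside \<open>ipM\<close>.\<close>
    have ae: "AE x in MO. P (\<lambda>x. f x + e * \<delta> x) x - \<Psi> x = 1 *\<^sub>R residual x + e *\<^sub>R P \<delta> x"
      using P_lincomb[OF f' \<delta>, of 1 e] by eventually_elim simp
    have m: "(\<lambda>x. P (\<lambda>x. f x + e * \<delta> x) x - \<Psi> x) \<in> borel_measurable MO"
      "(\<lambda>x. 1 *\<^sub>R residual x + e *\<^sub>R P \<delta> x) \<in> borel_measurable MO"
      by (intro sq_int_measurable sq.diff_mem sq_int_lincomb residual_sq_int P\<delta> P_sq_int perturbed_sq_int \<delta> \<Psi>')+
    have "ipM MO (\<lambda>x. P (\<lambda>x. f x + e * \<delta> x) x - \<Psi> x) (\<lambda>x. P (\<lambda>x. f x + e * \<delta> x) x - \<Psi> x) =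
        ipM MO (\<lambda>x. 1 *\<^sub>R residual x + e *\<^sub>R P \<delta> x) (\<lambda>x. 1 *\<^sub>R residual x + e *\<^sub>R P \<delta> x)"
      by (rule ipM_cong_AE[OF ae ae m m])
    also have "\<dots> = ipM MO residual residual + 2 * e * ipM MO (P \<delta>) residual + e\<^sup>2 * ipM MO (P \<delta>) (P \<delta>)"
      unfolding sq.ip_lincomb_self[OF residual_sq_int P\<delta>] sq.ip_sym[OF residual_sq_int P\<delta>] by simp
    finally have 1: "ipM MO (\<lambda>x. P (\<lambda>x. f x + e * \<delta> x) x - \<Psi> x) (\<lambda>x. P (\<lambda>x. f x + e * \<delta> x) x - \<Psi> x) = \<dots>" .
    have 2: "ipM MO (\<lambda>x. f x + e * \<delta> x) (\<lambda>x. f x + e * \<delta> x) = ipM MO f f + 2 * e * ipM MO f \<delta> + e\<^sup>2 * ipM MO \<delta> \<delta>"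
      using sq.ip_lincomb_self[OF f' \<delta>, of 1 e] by simp
    show ?thesis unfolding c 1 2 D_def Q_def by (simp add: field_simps)
  qed
  have lim: "((\<lambda>e. D \<delta> + e * Q) \<longlongrightarrow> D \<delta>) (at 0)"
  proof -
    have "((\<lambda>e. D \<delta> + e * Q) \<longlongrightarrow> D \<delta> + 0 * Q) (at 0)" by (intro tendsto_intros)
    then show ?thesis by simp
  qed
  have "\<forall>\<^sub>F e in at 0. D \<delta> + e * Q = (cost T Om \<theta> \<Psi> \<beta> (\<lambda>x. f x + e * \<delta> x) - cost T Om \<theta> \<Psi> \<beta> f) / e"
    unfolding eventually_at_filter ex by (intro always_eventually) (simp add: field_simps power2_eq_square)
  then show ?thesis unfolding has_gateaux_deriv_def by (rule Lim_transform_eventually[OF lim])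
qed

lemma gateaux_deriv_eq:
  assumes "\<delta> \<in> sq_int MO"
  shows "gateaux_deriv (cost T Om \<theta> \<Psi> \<beta>) f \<delta> = D \<delta>"
  unfolding gateaux_deriv_def
proof (rule the_equality)
  show "has_gateaux_deriv (cost T Om \<theta> \<Psi> \<beta>) f \<delta> (D \<delta>)" by (rule cost_gateaux[OF assms])
  then show "d = D \<delta>" if "has_gateaux_deriv (cost T Om \<theta> \<Psi> \<beta>) f \<delta> d" for d
    using that tendsto_unique[OF at_neq_bot] unfolding has_gateaux_deriv_def by blast
qed

text \<open>\<open>D\<close> is built on the solution for the source \<open>\<delta>\<close>. An
  arbitrary variation agrees with it at each time up to a null set, and \<open>iop_cong_AE\<close>
  passes this on to the time integral.\<close>

lemma D_variation:
  assumes \<delta>: "\<delta> \<in> sq_int MO" and var: "is_variation T Om u \<theta> f \<delta> \<delta>u \<delta>\<theta>"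
  shows "D \<delta> = (LINT x|MO. (LINT t|MT. \<delta>\<theta> t x) * ((LINT t|MT. \<theta> f t x) - \<Psi> x)) + \<beta> * (LINT x|MO. f x * \<delta> x)"
proof -
  have C: "C_H01 T Om \<delta>\<theta>" using var by (simp add: is_variation_def)
  note st = C_L2_ST[OF C_H01_C_L2[OF C]] fwd_regular(3)[OF \<delta>]
  have "AE x in MO. \<forall>t\<in>{0..T}. iop (\<lambda>t s. 1) \<delta>\<theta> t x = iop (\<lambda>t s. 1) (\<theta> \<delta>) t x"
    by (rule iop_cong_AE[OF ST_jmeas[OF st(1)] ST_jmeas[OF st(2)] AE_MT_I kernel_one]) (rule variation_unique[OF \<delta> var])
  then have ae: "AE x in MO. P \<delta> x = iop (\<lambda>t s. 1) \<delta>\<theta> 0 x"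
    by eventually_elim (use zero_mem_T in \<open>simp add: P_eq_iop\<close>)
  have "ipM MO (P \<delta>) residual = ipM MO (iop (\<lambda>t s. 1) \<delta>\<theta> 0) residual"
    by (rule ipM_cong_AE[OF ae AE_I2[OF refl]])
      (intro sq_int_measurable P_sq_int \<delta> iop_slice[OF kernel_one st(1) zero_mem_T] residual_sq_int)+
  then show ?thesis by (simp add: D_def ipM_def iop_def measurement_def)
qed

lemma adjoint_gradient:
  assumes "adjoint_solution T Om rho Cs kap T0 lam mu \<gamma> k residual us \<theta>s"
  shows "(\<lambda>x. (LINT t|MT. g t * \<theta>s t x) + \<beta> * f x) \<in> sq_int MO"
    and "\<delta> \<in> sq_int MO \<Longrightarrow> D \<delta> = ipM MO (\<lambda>x. (LINT t|MT. g t * \<theta>s t x) + \<beta> * f x) \<delta>"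
proof -
  have f': "f \<in> sq_int MO" using f by (simp add: L2_eq)
  \<comment> \<open>The second part of \<open>adjoint_identity\<close> concerns the adjoint solution
    alone; the forward solution for \<open>f\<close> serves to instantiate it.\<close>
  note W = adjoint_identity(2)[OF k_cont g_cont rho f' residual_sq_int fwd[OF f] assms]
  show "(\<lambda>x. (LINT t|MT. g t * \<theta>s t x) + \<beta> * f x) \<in> sq_int MO"
    using sq_int_lincomb[OF W f', of 1 \<beta>] by simp
  assume \<delta>: "\<delta> \<in> sq_int MO"
  have "ipM MO residual (P \<delta>) = ipM MO (\<lambda>x. LINT t|MT. g t * \<theta>s t x) \<delta>"
    using adjoint_identity(1)[OF k_cont g_cont rho \<delta> residual_sq_int fwd assms] \<delta>
    by (simp add: L2_eq measurement_def[abs_def])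
  then show "D \<delta> = ipM MO (\<lambda>x. (LINT t|MT. g t * \<theta>s t x) + \<beta> * f x) \<delta>"
    using sq.ip_lincomb[OF W f' \<delta>, of 1 \<beta>] sq.ip_sym[OF residual_sq_int P_sq_int[OF \<delta>]] by (simp add: D_def)
qed

text \<open>Boundedness of the derivative needs no energy estimate: the adjoint problem represents it by an \<open>L\<^sup>2\<close> function.\<close>

lemma gradient_exists: "\<exists>G\<in>sq_int MO. \<forall>\<delta>\<in>sq_int MO. D \<delta> = ipM MO G \<delta>"
proof -
  have "residual \<in> L2 Om" using residual_sq_int by (simp add: L2_eq)
  then obtain us \<theta>s where "adjoint_solution T Om rho Cs kap T0 lam mu \<gamma> k residual us \<theta>s" using adj by blast
  then show ?thesis using adjoint_gradient by blast
qed

text \<open>The embedding constant \<open>C\<close> turns the Cauchy-Schwarz bound by the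
  \<open>L2\<close> representative \<open>G\<close> into a bound in the norm of \<open>H\<close>.
  Definiteness of \<open>ip\<close> holds up to null sets, and so does uniqueness of the
  gradient.\<close>

lemma hilbert_gradient:
  assumes hil: "hilbert_in_L2 Om H ip"
  shows "bounded_linear_functional_on H ip (gateaux_deriv (cost T Om \<theta> \<Psi> \<beta>) f)"
    and "\<exists>w. is_gradient H ip (cost T Om \<theta> \<Psi> \<beta>) f w \<and>
           (\<forall>w'. is_gradient H ip (cost T Om \<theta> \<Psi> \<beta>) f w' \<longrightarrow> (AE x in MO. w' x = w x))"
proof -
  interpret S: semi_inner_space H ip
    by unfold_locales (use hil in \<open>auto simp: hilbert_in_L2_def\<close>)
  have sub: "v \<in> sq_int MO" if "v \<in> H" for v using hil that by (auto simp: hilbert_in_L2_def L2_eq)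
  have "\<exists>C. \<forall>w\<in>H. L2norm Om w \<le> C * sqrt (ip w w)" using hil unfolding hilbert_in_L2_def by (elim conjE)
  then obtain C where C: "\<And>w. w \<in> H \<Longrightarrow> nrmM MO w \<le> C * S.nrm w"
    unfolding S.nrm_def L2norm_eq by blast
  have definite: "AE x in MO. w x = 0" if "w \<in> H" "ip w w = 0" for w
    using hil that by (simp add: hilbert_in_L2_def)
  have complete: "\<exists>w\<in>H. (\<lambda>n. S.nrm (\<lambda>x. X n x - w x)) \<longlonglongrightarrow> 0"
    if "\<And>n. X n \<in> H" "\<forall>e>0. \<exists>N. \<forall>m\<ge>N. \<forall>n\<ge>N. S.nrm (\<lambda>x. X m x - X n x) < e" for X :: "nat \<Rightarrow> _"
  proof -
    have "\<forall>X::nat \<Rightarrow> real^'n \<Rightarrow> real. (\<forall>n. X n \<in> H) \<and>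
        (\<forall>e>0. \<exists>N. \<forall>m\<ge>N. \<forall>n\<ge>N. S.nrm (\<lambda>x. X m x - X n x) < e) \<longrightarrow>
        (\<exists>w\<in>H. (\<lambda>n. S.nrm (\<lambda>x. X n x - w x)) \<longlonglongrightarrow> 0)"
      using hil unfolding hilbert_in_L2_def S.nrm_def by (elim conjE)
    then show ?thesis using that by blast
  qed
  obtain G where G: "G \<in> sq_int MO" "\<And>\<delta>. \<delta> \<in> sq_int MO \<Longrightarrow> D \<delta> = ipM MO G \<delta>" using gradient_exists by blast
  let ?l = "gateaux_deriv (cost T Om \<theta> \<Psi> \<beta>) f"
  have l: "?l \<delta> = ipM MO G \<delta>" if "\<delta> \<in> H" for \<delta> using gateaux_deriv_eq[OF sub[OF that]] G(2)[OF sub[OF that]] by simp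
  have lin: "?l (\<lambda>x. a *\<^sub>R v x + b *\<^sub>R w x) = a * ?l v + b * ?l w" if "v \<in> H" "w \<in> H" for v w a b
    using that sq.ip_lincomb_right[OF sub[OF that(1)] sub[OF that(2)] G(1), of a b] S.lincomb_mem[OF that, of a b] l by simp
  have bdd: "\<bar>?l w\<bar> \<le> (nrmM MO G * C) * S.nrm w" if w: "w \<in> H" for w
  proof -
    have "\<bar>?l w\<bar> \<le> nrmM MO G * nrmM MO w" unfolding l[OF w] by (rule sq.Cauchy_Schwarz[OF G(1) sub[OF w]])
    also have "\<dots> \<le> nrmM MO G * (C * S.nrm w)" by (intro mult_left_mono C w sq.nrm_nonneg G(1))
    finally show ?thesis by (simp add: mult.assoc)
  qed
  show "bounded_linear_functional_on H ip ?l"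
    unfolding bounded_linear_functional_on_def using lin bdd unfolding S.nrm_def real_scaleR_def by blast
  obtain w where w: "w \<in> H" "\<And>v. v \<in> H \<Longrightarrow> ?l v = ip w v"
    using S.Riesz_representation[OF complete lin bdd] by blast
  have "AE x in MO. w' x = w x" if "is_gradient H ip (cost T Om \<theta> \<Psi> \<beta>) f w'" for w'
  proof -
    have w': "w' \<in> H" "\<And>v. v \<in> H \<Longrightarrow> ?l v = ip w' v" using that by (auto simp: is_gradient_def)
    have d: "(\<lambda>x. w' x - w x) \<in> H" by (rule S.diff_mem[OF w'(1) w(1)])
    have "ip (\<lambda>x. w' x - w x) (\<lambda>x. w' x - w x) = 0"
      using S.ip_diff[OF w'(1) w(1) d] w(2)[OF d] w'(2)[OF d] by simp
    from definite[OF d this] show ?thesis by eventually_elim simp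
  qed
  then show "\<exists>w. is_gradient H ip (cost T Om \<theta> \<Psi> \<beta>) f w \<and>
           (\<forall>w'. is_gradient H ip (cost T Om \<theta> \<Psi> \<beta>) f w' \<longrightarrow> (AE x in MO. w' x = w x))"
    using w unfolding is_gradient_def by blast
qed

end

theorem theorem4p12:
  fixes Om :: "(real^'n) set"
    and T rho Cs kap T0 lam mu alphaT \<gamma> \<beta> r0l r0u r1l r1u :: real
    and k g :: "real \<Rightarrow> real"
    and u :: "(real^'n \<Rightarrow> real) \<Rightarrow> real \<Rightarrow> real^'n \<Rightarrow> real^'n"
    and \<theta> :: "(real^'n \<Rightarrow> real) \<Rightarrow> real \<Rightarrow> real^'n \<Rightarrow> real"
    and \<Psi> f r0 r1 :: "real^'n \<Rightarrow> real"
  assumes Om: "open Om" "bounded Om" "lipschitz_boundary Om"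
    and T: "0 < T"
    and constants: "0 < rho" "0 < Cs" "0 < kap" "0 < T0" "0 < lam" "0 < mu" "0 < alphaT"
    and gamma: "\<gamma> = alphaT * (3 * lam + 2 * mu)"
    and kernel: "admissible_kernel T k"
    and g: "admissible_g T g"
    and r0: "continuous_on Om r0" "0 < r0l" "\<And>x. x \<in> Om \<Longrightarrow> r0l \<le> r0 x \<and> r0 x \<le> r0u"
    and r1: "continuous_on Om r1" "0 < r1l" "\<And>x. x \<in> Om \<Longrightarrow> r1l \<le> r1 x \<and> r1 x \<le> r1u"
    and forward_exists: "\<And>h. h \<in> L2 Om \<Longrightarrow>
          forward_solution T Om rho Cs kap T0 lam mu \<gamma> k g h (u h) (\<theta> h)"
    and forward_unique: "\<And>h u' \<theta>'. h \<in> L2 Om \<Longrightarrow>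
          forward_solution T Om rho Cs kap T0 lam mu \<gamma> k g h u' \<theta>' \<Longrightarrow>
          same_pair T Om u' \<theta>' (u h) (\<theta> h)"
    and adjoint_exists: "\<And>h. h \<in> L2 Om \<Longrightarrow>
          \<exists>us \<theta>s. adjoint_solution T Om rho Cs kap T0 lam mu \<gamma> k h us \<theta>s"
    and adjoint_unique: "\<And>h us \<theta>s us' \<theta>s'. h \<in> L2 Om \<Longrightarrow>
          adjoint_solution T Om rho Cs kap T0 lam mu \<gamma> k h us \<theta>s \<Longrightarrow>
          adjoint_solution T Om rho Cs kap T0 lam mu \<gamma> k h us' \<theta>s' \<Longrightarrow>
          same_pair T Om us \<theta>s us' \<theta>s'"
    and Psi: "\<Psi> \<in> L2 Om"
    and beta: "0 \<le> \<beta>"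
    and f: "f \<in> L2 Om"
  shows
    "(\<forall>H ip. hilbert_in_L2 Om H ip \<longrightarrow>
        (\<forall>\<delta>f\<in>H.
           (\<exists>\<delta>u \<delta>\<theta>. is_variation T Om u \<theta> f \<delta>f \<delta>u \<delta>\<theta>) \<and>
           (\<forall>\<delta>u \<delta>\<theta>. is_variation T Om u \<theta> f \<delta>f \<delta>u \<delta>\<theta> \<longrightarrow>
              has_gateaux_deriv (cost T Om \<theta> \<Psi> \<beta>) f \<delta>f
                ((LINT x|lebesgue_on Om.
                    (LINT t|lebesgue_on {0..T}. \<delta>\<theta> t x) * ((LINT t|lebesgue_on {0..T}. \<theta> f t x) - \<Psi> x))
                  + \<beta> * (LINT x|lebesgue_on Om. f x * \<delta>f x)))) \<and>
        bounded_linear_functional_on H ip (gateaux_deriv (cost T Om \<theta> \<Psi> \<beta>) f) \<and>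
        (\<exists>w. is_gradient H ip (cost T Om \<theta> \<Psi> \<beta>) f w \<and>
           (\<forall>w'. is_gradient H ip (cost T Om \<theta> \<Psi> \<beta>) f w' \<longrightarrow>
              (AE x in lebesgue_on Om. w' x = w x)))) \<and>
     hilbert_in_L2 Om (L2 Om) (L2ip Om) \<and>
     (\<forall>us \<theta>s. adjoint_solution T Om rho Cs kap T0 lam mu \<gamma> k
                (\<lambda>x. measurement T \<theta> f x - \<Psi> x) us \<theta>s \<longrightarrow>
        is_gradient (L2 Om) (L2ip Om) (cost T Om \<theta> \<Psi> \<beta>) f
          (\<lambda>x. (LINT t|lebesgue_on {0..T}. g t * \<theta>s t x) + \<beta> * f x)) \<and>
     hilbert_in_L2 Om (H1 Om) (H1ip Om r0 r1) \<and>
     (\<forall>G K. is_gradient (L2 Om) (L2ip Om) (cost T Om \<theta> \<Psi> \<beta>) f G \<longrightarrow>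
        (is_gradient (H1 Om) (H1ip Om r0 r1) (cost T Om \<theta> \<Psi> \<beta>) f K \<longleftrightarrow>
         elliptic_solution Om r0 r1 G K))"
proof -
  have k: "continuous_on {0..T} k"
    using kernel unfolding admissible_kernel_def by (auto intro: DERIV_continuous_on)
  have g': "continuous_on {0..T} g"
    using g unfolding admissible_g_def by (auto intro: DERIV_continuous_on)
  interpret inverse_source Om T rho Cs kap T0 lam mu \<gamma> \<beta> k g u \<theta> \<Psi> f
    by unfold_locales (use Om T constants k g' forward_exists forward_unique adjoint_exists Psi f in auto)
  have OmL: "Om \<in> sets lebesgue" using Om by simp
  interpret W: weighted_domain Om r0 r1 r0l r0u r1l r1u
    by unfold_locales
      (use r0 r1 continuous_imp_measurable_on_sets_lebesgue[OF r0(1) OmL]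
        continuous_imp_measurable_on_sets_lebesgue[OF r1(1) OmL] in auto)
  show ?thesis
  proof (intro conjI allI impI ballI)
    fix H ip assume hil: "hilbert_in_L2 Om H ip"
    show "bounded_linear_functional_on H ip (gateaux_deriv (cost T Om \<theta> \<Psi> \<beta>) f)"
      "\<exists>w. is_gradient H ip (cost T Om \<theta> \<Psi> \<beta>) f w \<and>
           (\<forall>w'. is_gradient H ip (cost T Om \<theta> \<Psi> \<beta>) f w' \<longrightarrow> (AE x in lebesgue_on Om. w' x = w x))"
      by (rule hilbert_gradient[OF hil])+
    fix \<delta>f assume "\<delta>f \<in> H"
    then have \<delta>: "\<delta>f \<in> sq_int MO" using hil by (auto simp: hilbert_in_L2_def L2_eq)
    show "\<exists>\<delta>u \<delta>\<theta>. is_variation T Om u \<theta> f \<delta>f \<delta>u \<delta>\<theta>" using variation_exists[OF \<delta>] by blast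
    show "has_gateaux_deriv (cost T Om \<theta> \<Psi> \<beta>) f \<delta>f
          ((LINT x|lebesgue_on Om.
              (LINT t|lebesgue_on {0..T}. \<delta>\<theta> t x) * ((LINT t|lebesgue_on {0..T}. \<theta> f t x) - \<Psi> x))
            + \<beta> * (LINT x|lebesgue_on Om. f x * \<delta>f x))"
      if "is_variation T Om u \<theta> f \<delta>f \<delta>u \<delta>\<theta>" for \<delta>u \<delta>\<theta>
      using cost_gateaux[OF \<delta>] unfolding D_variation[OF \<delta> that] .
  next
    show "hilbert_in_L2 Om (L2 Om) (L2ip Om)" by (rule hilbert_L2)
    show "hilbert_in_L2 Om (H1 Om) (H1ip Om r0 r1)" by (rule W.hilbert_H1)
    show "is_gradient (L2 Om) (L2ip Om) (cost T Om \<theta> \<Psi> \<beta>) f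
          (\<lambda>x. (LINT t|lebesgue_on {0..T}. g t * \<theta>s t x) + \<beta> * f x)"
      if "adjoint_solution T Om rho Cs kap T0 lam mu \<gamma> k residual us \<theta>s" for us \<theta>s
      using adjoint_gradient[OF that] gateaux_deriv_eq by (simp add: is_gradient_def L2_eq L2ip_eq)
  next
    fix G K assume G: "is_gradient (L2 Om) (L2ip Om) (cost T Om \<theta> \<Psi> \<beta>) f G"
    \<comment> \<open>\<open>G\<close> represents the derivative on all of \<open>L2 Om\<close>,
      hence on \<open>H1 Om\<close>; both sides of the equivalence then state the same identity with
      the summands exchanged.\<close>
    have "gateaux_deriv (cost T Om \<theta> \<Psi> \<beta>) f \<phi> = L2ip Om G \<phi>" if "\<phi> \<in> H1 Om" for \<phi>
      using G H1_sq_int[OF that] by (simp add: is_gradient_def L2_eq)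
    then show "is_gradient (H1 Om) (H1ip Om r0 r1) (cost T Om \<theta> \<Psi> \<beta>) f K \<longleftrightarrow> elliptic_solution Om r0 r1 G K"
      by (auto simp: is_gradient_def elliptic_solution_def H1ip_def add.commute)
  qed
qed

end
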